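(* Let $d\ge 2$ and let $f:\mathbb{R}^d\to\mathbb{R}$ be $M$-strongly self-concordant, $\mu$-strongly convex and $L$-smooth, with $\varkappa=L/\mu$. Consider the greedy or random SR1 or BFGS method (described in the context) started from $\boldsymbol{x}_0\in\mathbb{R}^d$ and a (possibly random) $\boldsymbol{G}_0$ which always satisfies $\nabla^2 f(\boldsymbol{x}_0)\preceq\boldsymbol{G}_0\preceq\eta\nabla^2 f(\boldsymbol{x}_0)$ for some constant $\eta\ge1$. Let $c=1$ for the BFGS update and $c=\varkappa$ for the SR1 update, and suppose $$M\lambda_0\le\frac{\ln2}{4\eta(2cd+1)}.$$ Then there are nonnegative random variables $\delta_k$ ($k\ge0$) with $\nabla^2 f(\boldsymbol{x}_k)\preceq\boldsymbol{G}_k\preceq(1+\delta_k)\nabla^2 f(\boldsymbol{x}_k)$ and $\mathbb{E}\,\delta_k\le 2cd\eta\left(1-\frac1d\right)^k$ for all $k\ge 0$, such that: (1) for the greedy BFGS/SR1 method, $$\delta_k\le 2cd\eta\left(1-\frac1d\right)^k\quad\text{and}\quad\lambda_k\le(2cd\eta)^k\left(1-\frac1d\right)^{k(k-1)/2}\lambda_0,\qquad\forall k\ge0;$$ (2) for the random BFGS/SR1 method and any $\delta\in(0,1)$, with probability at least $1-\delta$, $$\delta_k\le\frac{4cd^3\eta}{\delta}\left(1-\frac1{d+1}\right)^k\quad\text{and}\quad\lambda_k\le\left(\frac{4cd^3\eta}{\delta}\right)^k\left(1-\frac1{d+1}\right)^{k(k-1)/2}\lambda_0,\qquad\forall k\g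e0.$$
   Context: A twice differentiable $f:\mathbb{R}^d\to\mathbb{R}$ is $\mu$-strongly convex and $L$-smooth ($\mu,L>0$) if $\mu \boldsymbol{I}_d\preceq\nabla^2 f(\boldsymbol{x})\preceq L\boldsymbol{I}_d$ for all $\boldsymbol{x}$. Write $\|\boldsymbol{h}\|_{\boldsymbol{z}}=\sqrt{\boldsymbol{h}^\top\nabla^2 f(\boldsymbol{z})\boldsymbol{h}}$. $f$ is $M$-strongly self-concordant ($M>0$) if $\nabla^2 f(\boldsymbol{y})-\nabla^2 f(\boldsymbol{x})\preceq M\|\boldsymbol{y}-\boldsymbol{x}\|_{\boldsymbol{z}}\nabla^2 f(\boldsymbol{w})$ for all $\boldsymbol{x},\boldsymbol{y},\boldsymbol{z},\boldsymbol{w}\in\mathbb{R}^d$. Here $\preceq$ is the Loewner order. $\lambda_f(\boldsymbol{x})=\sqrt{\nabla f(\boldsymbol{x})^\top[\nabla^2 f(\boldsymbol{x})]^{-1}\nabla f(\boldsymbol{x})}$, $\lambda_k=\lambda_f(\boldsymbol{x}_k)$; $\boldsymbol{e}_1,\dots,\boldsymbol{e}_d$ are the standard basis vectors; $\mathrm{Unif}(\mathcal{S}^{d-1})$ is the uniform distribution on the unit sphere. For symmetric $\boldsymbol{G}\succeq\boldsymbol{A}\succ0$: $\mathrm{SR1}(\boldsymbol{G},\boldsymbol{A},\boldsymbol{u})=\boldsymbol{G}$ if $\boldsymbol{G}\boldsymbol{u}=\boldsymbol{A}\boldsymbol{u}$, otherwise $\boldsymbol{G}-\frac{(\boldsymbol{G}-\boldsymbol{A})\boldsymbol{u}\boldsymbol{u}^\top(\boldsymbol{G}-\boldsymbol{A})}{\boldsymbol{u}^\top(\boldsymbol{G}-\boldsymbol{A})\boldsymbol{u}}$;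 and, for $\boldsymbol{u}\neq\boldsymbol{0}$, $\mathrm{BFGS}(\boldsymbol{G},\boldsymbol{A},\boldsymbol{u})=\boldsymbol{G}-\frac{\boldsymbol{G}\boldsymbol{u}\boldsymbol{u}^\top\boldsymbol{G}}{\boldsymbol{u}^\top\boldsymbol{G}\boldsymbol{u}}+\frac{\boldsymbol{A}\boldsymbol{u}\boldsymbol{u}^\top\boldsymbol{A}}{\boldsymbol{u}^\top\boldsymbol{A}\boldsymbol{u}}$. Method: given $\boldsymbol{x}_0$, symmetric $\boldsymbol{G}_0\succeq\nabla^2 f(\boldsymbol{x}_0)$ and square $\boldsymbol{L}_0$ with $\boldsymbol{L}_0^\top\boldsymbol{L}_0=\boldsymbol{G}_0^{-1}$, for each $k\ge0$ set $\boldsymbol{x}_{k+1}=\boldsymbol{x}_k-\boldsymbol{G}_k^{-1}\nabla f(\boldsymbol{x}_k)$, $r_k=\|\boldsymbol{x}_{k+1}-\boldsymbol{x}_k\|_{\boldsymbol{x}_k}$, $\tilde{\boldsymbol{G}}_k=(1+Mr_k)\boldsymbol{G}_k$, $\tilde{\boldsymbol{L}}_k=\boldsymbol{L}_k/\sqrt{1+Mr_k}$, $\boldsymbol{A}_k=\nabla^2 f(\boldsymbol{x}_{k+1})$, and use one fixed rule among the following. - SR1: $\boldsymbol{G}_{k+1}=\mathrm{SR1}(\tilde{\boldsymbol{G}}_k,\boldsymbol{A}_k,\boldsymbol{u}_k)$ with $\boldsymbol{u}_k\in\arg\max_{\boldsymbol{u}\in\{\boldsymbol{e}_1,\dots,\boldsymbol{e}_d\}}\boldsymbol{u}^\top(\tilde{\boldsymbol{G}}_k-\boldsymbol{A}_k)\boldsymbol{u}$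 (greedy) or $\boldsymbol{u}_k\sim\mathrm{Unif}(\mathcal{S}^{d-1})$ independent of the past (random). - BFGS: $\boldsymbol{G}_{k+1}=\mathrm{BFGS}(\tilde{\boldsymbol{G}}_k,\boldsymbol{A}_k,\boldsymbol{u}_k)$ with $\boldsymbol{u}_k=\tilde{\boldsymbol{L}}_k^\top\tilde{\boldsymbol{u}}_k$, where $\tilde{\boldsymbol{u}}_k\in\arg\max_{\tilde{\boldsymbol{u}}\in\{\boldsymbol{e}_1,\dots,\boldsymbol{e}_d\}}\tilde{\boldsymbol{u}}^\top\tilde{\boldsymbol{L}}_k^{-\top}\boldsymbol{A}_k^{-1}\tilde{\boldsymbol{L}}_k^{-1}\tilde{\boldsymbol{u}}$ (greedy) or $\tilde{\boldsymbol{u}}_k\sim\mathrm{Unif}(\mathcal{S}^{d-1})$ independent of the past (random); and $\boldsymbol{L}_{k+1}=\tilde{\boldsymbol{L}}_k-\frac{[\tilde{\boldsymbol{L}}_k\boldsymbol{A}_k\boldsymbol{u}_k-\boldsymbol{v}_k]\boldsymbol{u}_k^\top}{\boldsymbol{u}_k^\top\boldsymbol{A}_k\boldsymbol{u}_k}$, $\boldsymbol{v}_k=\sqrt{\boldsymbol{u}_k^\top\boldsymbol{A}_k\boldsymbol{u}_k}\frac{\tilde{\boldsymbol{u}}_k}{\|\tilde{\boldsymbol{u}}_k\|}$, which satisfies $\boldsymbol{L}_{k+1}^\top\boldsymbol{L}_{k+1}=\boldsymbol{G}_{k+1}^{-1}$. Ties in the arg max are broken arbitrarily. Probability and expectation are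 over the random directions (and $\boldsymbol{G}_0$, if random). *)

theory Defs
  imports "HOL-Probability.Probability"
begin

definition psd :: "real^'n^'n \<Rightarrow> bool" where
  "psd A \<longleftrightarrow> transpose A = A \<and> (\<forall>h. 0 \<le> h \<bullet> (A *v h))"

(* Loewner order; a comparison includes symmetry of the difference. *)
definition loewner_le :: "real^'n^'n \<Rightarrow> real^'n^'n \<Rightarrow> bool"  (infix "\<preceq>" 50) where
  "A \<preceq> B \<longleftrightarrow> psd (B - A)"

definition outer :: "real^'n \<Rightarrow> real^'n \<Rightarrow> real^'n^'n" where
  "outer u v = (\<chi> i j. u $ i * v $ j)"

definition grad :: "(real^'n \<Rightarrow> real) \<Rightarrow> real^'n \<Rightarrow> real^'n" where
  "grad f x = (THE g. GDERIV f x :> g)"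

definition hessian :: "(real^'n \<Rightarrow> real) \<Rightarrow> real^'n \<Rightarrow> real^'n^'n" where
  "hessian f x = jacobian (grad f) (at x)"

definition twice_differentiable :: "(real^'n \<Rightarrow> real) \<Rightarrow> bool" where
  "twice_differentiable f \<longleftrightarrow>
     (\<forall>x. f differentiable (at x)) \<and> (\<forall>x. grad f differentiable (at x))"

lemma GDERIV_grad:
  fixes f :: "real^'n \<Rightarrow> real"
  assumes "f differentiable (at x)"
  shows "GDERIV f x :> grad f x"
proof -
  obtain D where D: "(f has_derivative D) (at x)"
    using assms by (auto simp: differentiable_def)
  then have lin: "linear D"
    by (rule has_derivative_linear)
  have rep: "h \<bullet> adjoint D 1 = D h" for h
    using adjoint_works[OF lin, of h 1] by simp
  have "GDERIV f x :> adjoint D 1"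
    using D unfolding gderiv_def rep .
  moreover have "g = adjoint D 1" if "GDERIV f x :> g" for g
  proof -
    have "(\<lambda>h. h \<bullet> g) = D"
      using that D unfolding gderiv_def by (rule has_derivative_unique)
    then have "\<forall>h. h \<bullet> g = h \<bullet> adjoint D 1"
      by (simp add: rep fun_eq_iff)
    then show ?thesis
      by (rule vector_eq_ldot[THEN iffD1])
  qed
  ultimately show ?thesis
    unfolding grad_def by (rule theI)
qed

lemma has_derivative_grad:
  assumes "grad f differentiable (at x)"
  shows "(grad f has_derivative (\<lambda>h. hessian f x *v h)) (at x)"
  using assms unfolding hessian_def jacobian_works .

definition local_norm :: "(real^'n \<Rightarrow> real) \<Rightarrow> real^'n \<Rightarrow> real^'n \<Rightarrow> real" where
  "local_norm f z h = sqrt (h \<bullet> (hessian f z *v h))"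

definition newton_decrement :: "(real^'n \<Rightarrow> real) \<Rightarrow> real^'n \<Rightarrow> real" where
  "newton_decrement f x = sqrt (grad f x \<bullet> (matrix_inv (hessian f x) *v grad f x))"

definition strongly_convex :: "real \<Rightarrow> (real^'n \<Rightarrow> real) \<Rightarrow> bool" where
  "strongly_convex \<mu> f \<longleftrightarrow> (\<forall>x. \<mu> *\<^sub>R mat 1 \<preceq> hessian f x)"

definition smooth :: "real \<Rightarrow> (real^'n \<Rightarrow> real) \<Rightarrow> bool" where
  "smooth L f \<longleftrightarrow> (\<forall>x. hessian f x \<preceq> L *\<^sub>R mat 1)"

definition strongly_self_concordant :: "real \<Rightarrow> (real^'n \<Rightarrow> real) \<Rightarrow> bool" where
  "strongly_self_concordant M f \<longleftrightarrow>
     (\<forall>x y z w. hessian f y - hessian f x \<preceq> (M * local_norm f z (y - x)) *\<^sub>R hessian f w)"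

definition sr1_update :: "real^'n^'n \<Rightarrow> real^'n^'n \<Rightarrow> real^'n \<Rightarrow> real^'n^'n" where
  "sr1_update G A u =
     (if G *v u = A *v u then G
      else G - ((G - A) ** outer u u ** (G - A)) /\<^sub>R (u \<bullet> ((G - A) *v u)))"

(* For u = 0, where the BFGS update is undefined, division by zero makes the value G.
   In the random method this happens only on a null set, in the greedy method never. *)
definition bfgs_update :: "real^'n^'n \<Rightarrow> real^'n^'n \<Rightarrow> real^'n \<Rightarrow> real^'n^'n" where
  "bfgs_update G A u =
     G - (G ** outer u u ** G) /\<^sub>R (u \<bullet> (G *v u)) + (A ** outer u u ** A) /\<^sub>R (u \<bullet> (A *v u))"

(* The update of the factor L; w is the direction before the change of variables,
   so that u = transpose L *v w. *)
definition bfgs_factor_update ::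
    "real^'n^'n \<Rightarrow> real^'n^'n \<Rightarrow> real^'n \<Rightarrow> real^'n \<Rightarrow> real^'n^'n" where
  "bfgs_factor_update L A u w =
     (let v = sqrt (u \<bullet> (A *v u)) *\<^sub>R (w /\<^sub>R norm w)
      in L - outer (L *v (A *v u) - v) u /\<^sub>R (u \<bullet> (A *v u)))"

(* 1 + M r_k *)
definition correction :: "(real^'n \<Rightarrow> real) \<Rightarrow> real \<Rightarrow> (nat \<Rightarrow> real^'n) \<Rightarrow> nat \<Rightarrow> real" where
  "correction f M x k = 1 + M * local_norm f (x k) (x (Suc k) - x k)"

definition corrected_G ::
    "(real^'n \<Rightarrow> real) \<Rightarrow> real \<Rightarrow> (nat \<Rightarrow> real^'n) \<Rightarrow> (nat \<Rightarrow> real^'n^'n) \<Rightarrow> nat \<Rightarrow> real^'n^'n" where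
  "corrected_G f M x G k = correction f M x k *\<^sub>R G k"

definition corrected_L ::
    "(real^'n \<Rightarrow> real) \<Rightarrow> real \<Rightarrow> (nat \<Rightarrow> real^'n) \<Rightarrow> (nat \<Rightarrow> real^'n^'n) \<Rightarrow> nat \<Rightarrow> real^'n^'n" where
  "corrected_L f M x L k = L k /\<^sub>R sqrt (correction f M x k)"

definition quasi_newton_points ::
    "(real^'n \<Rightarrow> real) \<Rightarrow> real^'n \<Rightarrow> (nat \<Rightarrow> real^'n) \<Rightarrow> (nat \<Rightarrow> real^'n^'n) \<Rightarrow> bool" where
  "quasi_newton_points f x0 x G \<longleftrightarrow>
     x 0 = x0 \<and> (\<forall>k. x (Suc k) = x k - matrix_inv (G k) *v grad f (x k))"

definition sr1_run ::
    "(real^'n \<Rightarrow> real) \<Rightarrow> real \<Rightarrow> real^'n \<Rightarrow> (nat \<Rightarrow> real^'n) \<Rightarrow> (nat \<Rightarrow> real^'n^'n) \<Rightarrow>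
     (nat \<Rightarrow> real^'n) \<Rightarrow> bool" where
  "sr1_run f M x0 x G u \<longleftrightarrow>
     quasi_newton_points f x0 x G \<and>
     (\<forall>k. G (Suc k) = sr1_update (corrected_G f M x G k) (hessian f (x (Suc k))) (u k))"

definition bfgs_run ::
    "(real^'n \<Rightarrow> real) \<Rightarrow> real \<Rightarrow> real^'n \<Rightarrow> (nat \<Rightarrow> real^'n) \<Rightarrow> (nat \<Rightarrow> real^'n^'n) \<Rightarrow>
     (nat \<Rightarrow> real^'n^'n) \<Rightarrow> (nat \<Rightarrow> real^'n) \<Rightarrow> bool" where
  "bfgs_run f M x0 x G L w \<longleftrightarrow>
     quasi_newton_points f x0 x G \<and>
     transpose (L 0) ** L 0 = matrix_inv (G 0) \<and>
     (\<forall>k. let A = hessian f (x (Suc k));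
              G' = corrected_G f M x G k;
              L' = corrected_L f M x L k;
              u = transpose L' *v w k
          in G (Suc k) = bfgs_update G' A u \<and> L (Suc k) = bfgs_factor_update L' A u (w k))"

definition sr1_greedy ::
    "(real^'n \<Rightarrow> real) \<Rightarrow> real \<Rightarrow> (nat \<Rightarrow> real^'n) \<Rightarrow> (nat \<Rightarrow> real^'n^'n) \<Rightarrow>
     (nat \<Rightarrow> real^'n) \<Rightarrow> bool" where
  "sr1_greedy f M x G u \<longleftrightarrow>
     (\<forall>k. is_arg_max (\<lambda>b. b \<bullet> ((corrected_G f M x G k - hessian f (x (Suc k))) *v b))
            (\<lambda>b. b \<in> Basis) (u k))"

definition bfgs_greedy ::
    "(real^'n \<Rightarrow> real) \<Rightarrow> real \<Rightarrow> (nat \<Rightarrow> real^'n) \<Rightarrow> (nat \<Rightarrow> real^'n^'n) \<Rightarrow>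
     (nat \<Rightarrow> real^'n) \<Rightarrow> bool" where
  "bfgs_greedy f M x L w \<longleftrightarrow>
     (\<forall>k. let K = matrix_inv (corrected_L f M x L k)
          in is_arg_max
               (\<lambda>b. b \<bullet> ((transpose K ** matrix_inv (hessian f (x (Suc k))) ** K) *v b))
               (\<lambda>b. b \<in> Basis) (w k))"

(* Normalised surface measure: the surface measure of a set A of unit vectors is proportional
   to the volume of the cone of all r a with a in A and 0 < r < 1. *)
definition unif_sphere :: "(real^'n) measure" where
  "unif_sphere = distr (uniform_measure lborel (ball 0 1)) borel sgn"

(* All quantities of iterations before the k-th direction is drawn are functions of the
   initial data and of the earlier directions, so these represent the past. *)
definition random_directions ::
    "'w measure \<Rightarrow> ('w \<Rightarrow> 'b::topological_space) \<Rightarrow> (nat \<Rightarrow> 'w \<Rightarrow> real^'n) \<Rightarrow> bool" where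
  "random_directions P init w \<longleftrightarrow>
     init \<in> borel_measurable P \<and>
     (\<forall>k. w k \<in> borel_measurable P \<and>
          distr P borel (w k) = unif_sphere \<and>
          prob_space.indep_set P
            (sets (vimage_algebra (space P) (\<lambda>\<omega>. (init \<omega>, \<lambda>i\<in>{..<k}. w i \<omega>))
                     (borel \<Otimes>\<^sub>M Pi\<^sub>M {..<k} (\<lambda>_. borel))))
            (sets (vimage_algebra (space P) (w k) borel)))"

datatype update_rule = SR1 | BFGS
datatype direction_rule = Greedy | Random

(* w is the chosen basis vector or the sampled unit vector: the update direction itself for SR1,
   the direction before multiplication by the transposed factor for BFGS. The factors L play no
   role for SR1. Ties are broken arbitrarily, even non-measurably. *)
fun quasi_newton_method ::
    "'w measure \<Rightarrow> update_rule \<Rightarrow> direction_rule \<Rightarrow> (real^'n \<Rightarrow> real) \<Rightarrow> real \<Rightarrow> real^'n \<Rightarrow>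
     (nat \<Rightarrow> 'w \<Rightarrow> real^'n) \<Rightarrow> (nat \<Rightarrow> 'w \<Rightarrow> real^'n^'n) \<Rightarrow> (nat \<Rightarrow> 'w \<Rightarrow> real^'n^'n) \<Rightarrow>
     (nat \<Rightarrow> 'w \<Rightarrow> real^'n) \<Rightarrow> bool" where
  "quasi_newton_method P SR1 Greedy f M x0 x G L w \<longleftrightarrow>
     (\<forall>\<omega>\<in>space P. sr1_run f M x0 (\<lambda>k. x k \<omega>) (\<lambda>k. G k \<omega>) (\<lambda>k. w k \<omega>) \<and>
                  sr1_greedy f M (\<lambda>k. x k \<omega>) (\<lambda>k. G k \<omega>) (\<lambda>k. w k \<omega>))"
| "quasi_newton_method P SR1 Random f M x0 x G L w \<longleftrightarrow>
     (\<forall>\<omega>\<in>space P. sr1_run f M x0 (\<lambda>k. x k \<omega>) (\<lambda>k. G k \<omega>) (\<lambda>k. w k \<omega>)) \<and>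
     random_directions P (G 0) w"
| "quasi_newton_method P BFGS Greedy f M x0 x G L w \<longleftrightarrow>
     (\<forall>\<omega>\<in>space P. bfgs_run f M x0 (\<lambda>k. x k \<omega>) (\<lambda>k. G k \<omega>) (\<lambda>k. L k \<omega>) (\<lambda>k. w k \<omega>) \<and>
                  bfgs_greedy f M (\<lambda>k. x k \<omega>) (\<lambda>k. L k \<omega>) (\<lambda>k. w k \<omega>))"
| "quasi_newton_method P BFGS Random f M x0 x G L w \<longleftrightarrow>
     (\<forall>\<omega>\<in>space P. bfgs_run f M x0 (\<lambda>k. x k \<omega>) (\<lambda>k. G k \<omega>) (\<lambda>k. L k \<omega>) (\<lambda>k. w k \<omega>)) \<and>
     random_directions P (\<lambda>\<omega>. (G 0 \<omega>, L 0 \<omega>)) w"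

lemma prob_space_unif_sphere: "prob_space (unif_sphere :: (real^'n) measure)"
proof -
  have "emeasure lborel (ball (0::real^'n) 1) \<noteq> 0"
    using content_ball_pos[of 1 "0::real^'n"] by (auto simp: measure_def)
  moreover have "emeasure lborel (ball (0::real^'n) 1) \<noteq> \<infinity>"
    using emeasure_bounded_finite[of "ball (0::real^'n) 1"] by simp
  ultimately interpret prob_space "uniform_measure lborel (ball (0::real^'n) 1)"
    by (rule prob_space_uniform_measure)
  show ?thesis
    unfolding unif_sphere_def by (rule prob_space_distr) measurable
qed

lemma AE_unif_sphere: "AE u in (unif_sphere :: (real^'n) measure). u \<in> sphere 0 1"
proof -
  have "AE x in lborel. x \<noteq> (0::real^'n)"
    by (rule AE_lborel_singleton)
  then have "AE x in uniform_measure lborel (ball (0::real^'n) 1). sgn x \<in> sphere 0 1"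
    by (intro AE_uniform_measureI) (auto simp: norm_sgn)
  then show ?thesis
    unfolding unif_sphere_def by (subst AE_distr_iff) (auto simp: pred_def)
qed

end

theory Submission
  imports Defs
begin

text \<open>For BFGS let \<open>D\<^sub>k = tr(H\<^sub>k\<inverse> G\<^sub>k) - d\<close> and for SR1 let \<open>D\<^sub>k = tr(G\<^sub>k - H\<^sub>k) / \<mu>\<close>,
  where \<open>H\<^sub>k\<close> is the Hessian at \<open>x\<^sub>k\<close>; in both cases \<open>G\<^sub>k\<close> is bounded by \<open>(1 + D\<^sub>k) H\<^sub>k\<close>. An update
  multiplies \<open>D\<close> by at most \<open>1 - 1/d\<close>, surely for greedy and on average for random directions, while
  moving from \<open>H\<^sub>k\<close> to \<open>H\<^sub>k\<^sub>+\<^sub>1\<close> costs a factor \<open>(1 + M\<lambda>\<^sub>k)\<^sup>2\<close> and an additive term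
  \<open>2cdM\<lambda>\<^sub>k\<close>. Whatever the directions are, the updates preserve a bound \<open>G\<^sub>k \<preceq> 2\<eta> H\<^sub>k\<close>, so that
  \<open>\<lambda>\<^sub>k\<close> decays at least like \<open>(1 - 1/(2\<eta>))\<^sup>k\<close>. On the other hand
  \<open>\<lambda>\<^sub>k\<^sub>+\<^sub>1 \<le> \<theta>\<^sub>k \<lambda>\<^sub>k\<close> for the potential \<open>\<theta>\<^sub>k = D\<^sub>k + 2cdM\<lambda>\<^sub>k\<close>, which
  absorbs the additive term and therefore contracts by \<open>(1 - 1/d) exp (2(2cd+1)M\<lambda>\<^sub>k)\<close> per
  step. The product of the exponential factors is at most 2 by the assumption on \<open>\<lambda>\<^sub>0\<close>.
  The random case follows with Markov's inequality and a union bound over \<open>k\<close>.\<close>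

section \<open>Symmetric and positive definite matrices\<close>

text \<open>The contraction factor of the potential contains \<lambda>_k, which is random. To pull
  it out of an expectation, a bound on \<lambda>_k that holds on every path is required; supplying
  it is the purpose of the linear rate. With that rate the exponents
  \<open>2 (2cd+1) M \<lambda>_k\<close> sum to at most
  \<open>4 \<eta> (2cd+1) M \<lambda>_0\<close>, and requiring this to be at most
  \<open>ln 2\<close> is exactly the assumption on \<lambda>_0. The additive cost of a moving
  Hessian can be absorbed because \<lambda>_(k+1) itself carries the factor \<theta>_k: the new term
  \<open>2cd M \<lambda>_(k+1)\<close> is at most \<open>2cd M \<lambda>_k \<theta>_k\<close>, a
  relative perturbation of \<theta>_k. SR1 selects directions in fixed coordinates, so its error is
  measured against the identity; converting to the Hessian costs \<open>1/\<mu>\<close>, while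
  traces of Hessians are at most \<open>Ld\<close>, whence \<open>c = L/\<mu>\<close>. BFGS works in
  coordinates in which \<open>G\<close> is the identity, and \<open>c = 1\<close>. Greedy ties may
  be broken non-measurably; there a deterministic sequence serves as \<delta>_k, while
  \<open>D_k\<close> itself serves in the random case.\<close>

definition posdef :: "real^'n^'n \<Rightarrow> bool" where
  "posdef A \<longleftrightarrow> transpose A = A \<and> (\<forall>h. h \<noteq> 0 \<longrightarrow> 0 < h \<bullet> (A *v h))"

lemma sym_inner:
  fixes A :: "real^'n^'n"
  assumes "transpose A = A"
  shows "(A *v x) \<bullet> y = x \<bullet> (A *v y)"
  by (metis assms dot_lmul_matrix transpose_matrix_vector)

lemma symI:
  fixes A :: "real^'n^'n"
  assumes "\<And>x y. (A *v x) \<bullet> y = x \<bullet> (A *v y)"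
  shows "transpose A = A"
proof -
  have "(transpose A *v x) \<bullet> y = (A *v x) \<bullet> y" for x y
    using assms by (simp add: dot_lmul_matrix)
  then have "transpose A *v x = A *v x" for x
    using vector_eq_rdot by blast
  then show ?thesis by (simp add: matrix_eq)
qed

lemma mat_transpose_simps:
  fixes A B :: "real^'n^'n"
  shows "transpose (A + B) = transpose A + transpose B"
    and "transpose (A - B) = transpose A - transpose B"
  by (simp_all add: transpose_def vec_eq_iff)

lemma scaleR_mult_vec: "(c *\<^sub>R A) *v x = c *\<^sub>R (A *v x)" for A :: "real^'n^'m"
  by (simp add: scaleR_matrix_vector_assoc)

lemmas mv_simps = matrix_vector_mult_add_rdistrib matrix_vector_mult_diff_rdistrib
  matrix_vector_mult_diff_distrib matrix_vector_right_distrib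
  matrix_vector_mult_scaleR scaleR_mult_vec inner_add_left inner_add_right
  inner_diff_left inner_diff_right

lemma loewner_leD: "A \<preceq> B \<Longrightarrow> h \<bullet> (A *v h) \<le> h \<bullet> (B *v h)"
  by (auto simp: loewner_le_def psd_def mv_simps)

lemma loewner_leI:
  assumes "transpose A = A" "transpose B = B" "\<And>h. h \<bullet> (A *v h) \<le> h \<bullet> (B *v h)"
  shows "A \<preceq> B"
  using assms by (auto simp: loewner_le_def psd_def mv_simps mat_transpose_simps)

text \<open>The order demands symmetry of the difference alone, so the symmetry of one side passes
  to the other. This is how \<open>G\<close> inherits symmetry from the Hessian below it.\<close>

lemma loewner_le_sym:
  assumes "A \<preceq> B"
  shows "transpose A = A \<longleftrightarrow> transpose B = B"
proof -
  have "transpose B - transpose A = B - A"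
    using assms by (simp add: loewner_le_def psd_def mat_transpose_simps)
  then have "transpose B - B = transpose A - A"
    by (simp add: algebra_simps)
  then show ?thesis by (metis right_minus_eq)
qed

lemma posdef_sym: "posdef A \<Longrightarrow> transpose A = A"
  and posdef_pos: "posdef A \<Longrightarrow> h \<noteq> 0 \<Longrightarrow> 0 < h \<bullet> (A *v h)"
  by (auto simp: posdef_def)

lemma posdef_nonneg: "posdef A \<Longrightarrow> 0 \<le> h \<bullet> (A *v h)"
  by (cases "h = 0") (auto simp: posdef_def less_imp_le)

lemma posdef_psd: "posdef A \<Longrightarrow> psd A"
  by (auto simp: psd_def posdef_sym posdef_nonneg)

lemma posdef_mono:
  assumes "posdef A" "A \<preceq> B"
  shows "posdef B"
  unfolding posdef_def using assms loewner_le_sym[OF assms(2)] loewner_leD[OF assms(2)] posdef_pos[OF assms(1)]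
  by (metis less_le_trans posdef_sym)

lemma posdef_scaleR: "posdef A \<Longrightarrow> 0 < c \<Longrightarrow> posdef (c *\<^sub>R A)"
  by (simp add: posdef_def scaleR_mult_vec transpose_scalar)

lemma matrix_inv_right:
  fixes A :: "real^'n^'n" assumes "invertible A" shows "A ** matrix_inv A = mat 1"
  using assms unfolding invertible_def matrix_inv_def by (metis (mono_tags, lifting) someI_ex)

lemma matrix_inv_left:
  fixes A :: "real^'n^'n" assumes "invertible A" shows "matrix_inv A ** A = mat 1"
  using assms unfolding invertible_def matrix_inv_def by (metis (mono_tags, lifting) someI_ex)

lemma matrix_inv_unique:
  fixes A :: "real^'n^'n" assumes "A ** B = mat 1" shows "matrix_inv A = B"
proof -
  have "invertible A" using assms invertible_right_inverse by blast
  then have "matrix_inv A ** (A ** B) = B"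
    by (metis matrix_inv_left matrix_mul_assoc matrix_mul_lid)
  then show ?thesis using assms by simp
qed

lemma posdef_invertible: "posdef A \<Longrightarrow> invertible A" for A :: "real^'n^'n"
  unfolding invertible_left_inverse matrix_left_invertible_ker
  by (metis inner_zero_right less_irrefl posdef_pos)

lemma posdef_inv [simp]:
  fixes A :: "real^'n^'n" assumes "posdef A"
  shows "A *v (matrix_inv A *v x) = x" and "matrix_inv A *v (A *v x) = x"
  using posdef_invertible[OF assms]
  by (simp_all add: matrix_vector_mul_assoc matrix_inv_left matrix_inv_right)

lemma posdef_matrix_inv:
  fixes A :: "real^'n^'n" assumes "posdef A"
  shows "posdef (matrix_inv A)"
proof -
  have "(matrix_inv A *v x) \<bullet> y = x \<bullet> (matrix_inv A *v y)" for x y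
    by (metis assms posdef_inv(1) posdef_sym sym_inner)
  moreover have "0 < h \<bullet> (matrix_inv A *v h)" if "h \<noteq> 0" for h
  proof -
    have "matrix_inv A *v h \<noteq> 0" using that assms by (metis matrix_vector_mult_0_right posdef_inv(1))
    then show ?thesis
      by (metis assms inner_commute posdef_inv(1) posdef_pos)
  qed
  ultimately show ?thesis by (auto simp: posdef_def intro: symI)
qed

text \<open>The weight \<open>s = sqrt (Q / P)\<close> makes both summands equal to the bound. If
  \<open>P\<close> or \<open>Q\<close> vanishes, a suitable \<open>s\<close> already contradicts
  \<open>0 < x\<close>.\<close>

lemma le_geometric_mean:
  fixes x P Q :: real
  assumes "0 \<le> P" "0 \<le> Q" and le: "\<And>s. 0 < s \<Longrightarrow> 2 * x \<le> s * P + Q / s"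
  shows "x \<le> sqrt P * sqrt Q"
proof (cases "x \<le> 0")
  case True
  then show ?thesis using assms by (smt (verit) mult_nonneg_nonneg real_sqrt_ge_0_iff)
next
  case False
  then have x: "0 < x" by simp
  have P: "P \<noteq> 0"
  proof
    assume "P = 0"
    with le[of "(Q + 1) / x"] x assms have "2 * x \<le> Q * x / (Q + 1)" by simp
    also have "\<dots> \<le> x" using x assms by (simp add: field_simps)
    finally show False using x by simp
  qed
  have Q: "Q \<noteq> 0"
  proof
    assume "Q = 0"
    with le[of "x / P"] x P assms show False by simp
  qed
  have pos: "0 < P" "0 < Q" using P Q assms by auto
  have "sqrt (Q / P) * P = sqrt Q * (P / sqrt P)" "Q / sqrt (Q / P) = sqrt P * (Q / sqrt Q)"
    using pos by (simp_all add: real_sqrt_divide)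
  then have "sqrt (Q / P) * P = sqrt P * sqrt Q" "Q / sqrt (Q / P) = sqrt P * sqrt Q"
    using pos by (simp_all add: real_div_sqrt)
  with le[of "sqrt (Q / P)"] pos show ?thesis by simp
qed

text \<open>Polarisation gives the bound with the arithmetic mean of the two forms; scaling
  \<open>p\<close> by \<open>sqrt s\<close> and \<open>q\<close> by its inverse and optimising over
  \<open>s\<close> turns it into the geometric mean. The case \<open>E = B\<close> is
  Cauchy-Schwarz.\<close>

lemma bilinear_form_le:
  fixes E B :: "real^'n^'n"
  assumes E: "transpose E = E" and B: "psd B" and "0 \<le> \<epsilon>"
    and le: "\<And>h. \<bar>h \<bullet> (E *v h)\<bar> \<le> \<epsilon> * (h \<bullet> (B *v h))"
  shows "\<bar>p \<bullet> (E *v q)\<bar> \<le> \<epsilon> * (sqrt (p \<bullet> (B *v p)) * sqrt (q \<bullet> (B *v q)))"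
proof -
  have Bn: "0 \<le> h \<bullet> (B *v h)" for h using B by (simp add: psd_def)
  have half: "2 * \<bar>a \<bullet> (E *v b)\<bar> \<le> \<epsilon> * (a \<bullet> (B *v a) + b \<bullet> (B *v b))" for a b
  proof -
    have s: "b \<bullet> (E *v a) = a \<bullet> (E *v b)" by (metis E inner_commute sym_inner)
    have "4 * \<bar>a \<bullet> (E *v b)\<bar> = \<bar>(a+b) \<bullet> (E *v (a+b)) - (a-b) \<bullet> (E *v (a-b))\<bar>"
      by (simp add: mv_simps s)
    also have "\<dots> \<le> \<epsilon> * ((a+b) \<bullet> (B *v (a+b))) + \<epsilon> * ((a-b) \<bullet> (B *v (a-b)))"
      using le[of "a+b"] le[of "a-b"] by linarith
    also have "\<dots> = 2 * (\<epsilon> * (a \<bullet> (B *v a) + b \<bullet> (B *v b)))"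
      by (simp add: mv_simps algebra_simps)
    finally show ?thesis by simp
  qed
  have "\<bar>p \<bullet> (E *v q)\<bar> \<le> sqrt (\<epsilon> * (p \<bullet> (B *v p))) * sqrt (\<epsilon> * (q \<bullet> (B *v q)))"
  proof (rule le_geometric_mean)
    fix s :: real assume "0 < s"
    have "p \<bullet> (E *v q) = (sqrt s *\<^sub>R p) \<bullet> (E *v (q /\<^sub>R sqrt s))"
      using \<open>0 < s\<close> by (simp add: mv_simps)
    then have "2 * \<bar>p \<bullet> (E *v q)\<bar> \<le> \<epsilon> * ((sqrt s *\<^sub>R p) \<bullet> (B *v (sqrt s *\<^sub>R p))
        + (q /\<^sub>R sqrt s) \<bullet> (B *v (q /\<^sub>R sqrt s)))"
      using half by metis
    also have "\<dots> = s * (\<epsilon> * (p \<bullet> (B *v p))) + \<epsilon> * (q \<bullet> (B *v q)) / s"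
      using \<open>0 < s\<close> by (simp add: mv_simps field_simps flip: power2_eq_square)
    finally show "2 * \<bar>p \<bullet> (E *v q)\<bar> \<le> s * (\<epsilon> * (p \<bullet> (B *v p))) + \<epsilon> * (q \<bullet> (B *v q)) / s" .
  qed (use Bn \<open>0 \<le> \<epsilon>\<close> in auto)
  also have "\<dots> = \<epsilon> * (sqrt (p \<bullet> (B *v p)) * sqrt (q \<bullet> (B *v q)))"
    using \<open>0 \<le> \<epsilon>\<close> by (simp add: real_sqrt_mult)
  finally show ?thesis .
qed

lemma psd_Cauchy_Schwarz:
  assumes "psd A"
  shows "\<bar>p \<bullet> (A *v q)\<bar> \<le> sqrt (p \<bullet> (A *v p)) * sqrt (q \<bullet> (A *v q))"
  using bilinear_form_le[of A A 1 p q] assms by (auto simp: psd_def)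

lemma psd_Cauchy_Schwarz_square:
  assumes "psd A"
  shows "(p \<bullet> (A *v q))\<^sup>2 \<le> (p \<bullet> (A *v p)) * (q \<bullet> (A *v q))"
proof -
  have "(p \<bullet> (A *v q))\<^sup>2 \<le> (sqrt (p \<bullet> (A *v p)) * sqrt (q \<bullet> (A *v q)))\<^sup>2"
    using psd_Cauchy_Schwarz[OF assms, of p q] by (metis abs_ge_zero power2_abs power_mono)
  then show ?thesis using assms by (simp add: power_mult_distrib psd_def)
qed

lemma psd_null:
  assumes "psd A" "u \<bullet> (A *v u) = 0"
  shows "A *v u = 0"
  using psd_Cauchy_Schwarz_square[OF assms(1), of "A *v u" u] assms(2) by simp

text \<open>Cauchy-Schwarz in \<open>A\<close> for \<open>p = B^-1 h\<close> and
  \<open>q = A^-1 h\<close>: as \<open>A q = h\<close>, the square of \<open>h . p\<close> is at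
  most \<open>(p . A p) (q . A q)\<close>, hence at most \<open>c (h . p) (h . q)\<close>, and one
  factor \<open>h . p\<close> cancels.\<close>

lemma inv_antimono:
  assumes A: "posdef A" and B: "posdef B" and c: "0 \<le> c"
    and le: "\<And>h. h \<bullet> (A *v h) \<le> c * (h \<bullet> (B *v h))"
  shows "h \<bullet> (matrix_inv B *v h) \<le> c * (h \<bullet> (matrix_inv A *v h))"
proof -
  define p where "p = matrix_inv B *v h"
  define q where "q = matrix_inv A *v h"
  have pB: "h \<bullet> p = p \<bullet> (B *v p)" using B by (simp add: p_def inner_commute)
  have qA: "h \<bullet> q = q \<bullet> (A *v q)" using A by (simp add: q_def inner_commute)
  have "(h \<bullet> p)\<^sup>2 = (p \<bullet> (A *v q))\<^sup>2" using A by (simp add: q_def inner_commute)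
  also have "\<dots> \<le> (p \<bullet> (A *v p)) * (q \<bullet> (A *v q))"
    by (rule psd_Cauchy_Schwarz_square[OF posdef_psd[OF A]])
  also have "\<dots> \<le> (c * (h \<bullet> p)) * (h \<bullet> q)"
    using le[of p] pB qA posdef_nonneg[OF A, of q] by (simp add: mult_right_mono)
  finally have *: "(h \<bullet> p) * (h \<bullet> p) \<le> (h \<bullet> p) * (c * (h \<bullet> q))"
    by (simp add: power2_eq_square mult_ac)
  have "0 \<le> h \<bullet> p" "0 \<le> h \<bullet> q" using pB qA A B by (simp_all add: posdef_nonneg)
  then show ?thesis using * c unfolding p_def[symmetric] q_def[symmetric]
    by (cases "h \<bullet> p = 0") (auto simp: mult_le_cancel_left)
qed

section \<open>Rank-one matrices and traces\<close>

lemma outer_mult_vec: "outer u v *v h = (v \<bullet> h) *\<^sub>R u"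
  by (simp add: outer_def vec_eq_iff matrix_vector_mult_def inner_vec_def sum_distrib_left mult_ac)

lemma transpose_outer: "transpose (outer u v) = outer v u"
  by (simp add: outer_def transpose_def vec_eq_iff mult_ac)

lemma mult_outer_mult: "A ** outer u v ** B = outer (A *v u) (transpose B *v v)"
  unfolding matrix_eq by (simp add: outer_mult_vec matrix_vector_mul_assoc[symmetric] mv_simps dot_lmul_matrix)

lemma mult_outer: "A ** outer u v = outer (A *v u) v"
  using mult_outer_mult[of A u v "mat 1"] by simp

lemma trace_outer: "trace (outer u v) = u \<bullet> v"
  by (simp add: trace_def outer_def inner_vec_def)

lemma trace_scaleR: "trace (c *\<^sub>R A) = c * trace A" for A :: "real^'n^'n"
  by (simp add: trace_def sum_distrib_left)

lemma trace_sum: "trace (\<Sum>i\<in>S. X i) = (\<Sum>i\<in>S. trace (X i))" for X :: "_ \<Rightarrow> real^'n^'n"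
  by (simp add: trace_def sum.swap[of _ S])

text \<open>By Cauchy-Schwarz the subtracted rank-one form never exceeds that of \<open>Y\<close>.
  If \<open>u . Y u = 0\<close>, division by zero leaves \<open>Y\<close> unchanged. The same
  deflation is the SR1 step and the elimination step of a Cholesky decomposition.\<close>

lemma psd_deflate:
  fixes Y :: "real^'n^'n"
  assumes Y: "psd Y"
  shows "psd (Y - outer (Y *v u) (Y *v u) /\<^sub>R (u \<bullet> (Y *v u)))"
  unfolding psd_def
proof (intro conjI allI)
  have sym: "transpose Y = Y" using Y by (simp add: psd_def)
  show "transpose (Y - outer (Y *v u) (Y *v u) /\<^sub>R (u \<bullet> (Y *v u)))
      = Y - outer (Y *v u) (Y *v u) /\<^sub>R (u \<bullet> (Y *v u))"
    by (simp add: mat_transpose_simps sym transpose_outer transpose_scalar)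
  fix h
  have "(h \<bullet> (Y *v u))\<^sup>2 \<le> h \<bullet> (Y *v h) * (u \<bullet> (Y *v u))"
    by (rule psd_Cauchy_Schwarz_square[OF Y])
  moreover have "h \<bullet> ((Y - outer (Y *v u) (Y *v u) /\<^sub>R (u \<bullet> (Y *v u))) *v h)
      = h \<bullet> (Y *v h) - (h \<bullet> (Y *v u))\<^sup>2 / (u \<bullet> (Y *v u))"
    by (simp add: mv_simps outer_mult_vec power2_eq_square inner_commute divide_inverse mult_ac)
  ultimately show "0 \<le> h \<bullet> ((Y - outer (Y *v u) (Y *v u) /\<^sub>R (u \<bullet> (Y *v u))) *v h)"
    using Y by (cases "u \<bullet> (Y *v u) = 0") (auto simp: psd_def divide_le_eq less_le)
qed

text \<open>A Cholesky decomposition: deflating along an axis puts that axis into the kernel and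
  keeps there the axes treated before, so after all axes nothing is left.\<close>

lemma psd_eq_sum_outer:
  fixes X :: "real^'n^'n"
  assumes "psd X"
  shows "\<exists>v :: 'n \<Rightarrow> real^'n. X = (\<Sum>i\<in>UNIV. outer (v i) (v i))"
proof -
  have "\<exists>v :: 'n \<Rightarrow> real^'n. psd (X - (\<Sum>i\<in>S. outer (v i) (v i))) \<and>
      (\<forall>j\<in>S. (X - (\<Sum>i\<in>S. outer (v i) (v i))) *v axis j 1 = 0)" for S :: "'n set"
    using finite[of S]
  proof (induction S rule: finite_induct)
    case empty
    then show ?case using assms by simp
  next
    case (insert i S)
    then obtain v :: "'n \<Rightarrow> real^'n" where v: "psd (X - (\<Sum>i\<in>S. outer (v i) (v i)))"
      "\<forall>j\<in>S. (X - (\<Sum>i\<in>S. outer (v i) (v i))) *v axis j 1 = 0" by auto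
    define Y where "Y = X - (\<Sum>i\<in>S. outer (v i) (v i))"
    define e where "e = (axis i 1 :: real^'n)"
    define s where "s = e \<bullet> (Y *v e)"
    define y where "y = (Y *v e) /\<^sub>R sqrt s"
    have Y: "psd Y" "transpose Y = Y" using v by (auto simp: Y_def psd_def)
    have s: "0 \<le> s" using Y by (simp add: s_def psd_def)
    have "(inverse (sqrt s))\<^sup>2 = inverse s"
      using s by (simp add: power_inverse)
    then have yy: "outer y y = outer (Y *v e) (Y *v e) /\<^sub>R s"
      by (simp add: outer_def y_def vec_eq_iff power2_eq_square mult_ac)
    then have y0: "outer y y *v h = ((e \<bullet> (Y *v h)) / s) *\<^sub>R (Y *v e)" for h
      by (simp add: outer_mult_vec mv_simps divide_inverse mult_ac sym_inner Y)
    have psd: "psd (Y - outer y y)"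
      using psd_deflate[OF Y(1), of e] by (simp add: yy s_def)
    have null: "(Y - outer y y) *v axis j 1 = 0" if "j \<in> insert i S" for j
    proof (cases "j = i")
      case True
      then show ?thesis
        using psd_null[OF Y(1), of e] s
        by (cases "s = 0") (auto simp: matrix_vector_mult_diff_rdistrib y0 s_def simp flip: e_def)
    next
      case False
      then have "Y *v axis j 1 = 0" using v(2) that by (auto simp: Y_def)
      then show ?thesis by (simp add: matrix_vector_mult_diff_rdistrib y0)
    qed
    have eq: "X - (\<Sum>k\<in>insert i S. outer ((v(i:=y)) k) ((v(i:=y)) k)) = Y - outer y y"
    proof -
      have "(\<Sum>k\<in>S. outer ((v(i:=y)) k) ((v(i:=y)) k)) = (\<Sum>k\<in>S. outer (v k) (v k))"
        using insert.hyps by (intro sum.cong) auto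
      then show ?thesis using insert.hyps by (simp add: Y_def algebra_simps)
    qed
    show ?case using psd null eq by (intro exI[of _ "v(i:=y)"]) auto
  qed
  from this[of UNIV] obtain v :: "'n \<Rightarrow> real^'n"
    where v: "\<And>j. (X - (\<Sum>i\<in>UNIV. outer (v i) (v i))) *v axis j 1 = 0" by auto
  have "X - (\<Sum>i\<in>UNIV. outer (v i) (v i)) = 0"
  proof -
    have "(X - (\<Sum>i\<in>UNIV. outer (v i) (v i))) $ k $ j = 0" for k j
      using v[of j] by (metis matrix_vector_mult_basis column_def vec_lambda_beta zero_index)
    then show ?thesis by (simp only: vec_eq_iff zero_index) blast
  qed
  then show ?thesis by auto
qed

lemma matrix_mult_sum_right:
  fixes B :: "real^'n^'m"
  shows "B ** (\<Sum>i\<in>S. X i) = (\<Sum>i\<in>S. B ** X i)"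
  by (induction S rule: infinite_finite_induct) (simp_all add: matrix_add_ldistrib)

text \<open>With \<open>X\<close> split into rank-one terms, the trace is a sum of values of the
  form of \<open>B\<close>.\<close>

lemma trace_mult_psd_nonneg:
  assumes "psd B" "psd X"
  shows "0 \<le> trace (B ** X)"
proof -
  obtain v :: "'a \<Rightarrow> real^'a" where "X = (\<Sum>i\<in>UNIV. outer (v i) (v i))"
    using psd_eq_sum_outer[OF assms(2)] ..
  then have "trace (B ** X) = (\<Sum>i\<in>UNIV. (B *v v i) \<bullet> v i)"
    by (simp add: matrix_mult_sum_right trace_sum mult_outer trace_outer)
  then show ?thesis using assms(1) by (auto simp: psd_def inner_commute intro!: sum_nonneg)
qed

section \<open>The SR1 and BFGS updates\<close>

lemma psd_diffD: "A \<preceq> B \<Longrightarrow> psd (B - A)"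
  by (simp add: loewner_le_def)

lemma psd_mat_1: "psd (mat 1 :: real^'n^'n)"
  by (simp add: psd_def)

lemma posdef_mat_1: "posdef (mat 1 :: real^'n^'n)"
  by (simp add: posdef_def)

lemma matrix_inv_mat_1: "matrix_inv (mat 1 :: real^'n^'n) = mat 1"
  by (rule matrix_inv_unique) simp

lemma matrix_diff_ldistrib: "A ** (B - C) = A ** B - A ** C" for A B C :: "real^'n^'n"
  by (simp add: matrix_matrix_mult_def vec_eq_iff sum_subtractf algebra_simps)

lemma matrix_scaleR_right: "A ** (c *\<^sub>R B) = c *\<^sub>R (A ** B)" for A B :: "real^'n^'n"
  by (simp add: matrix_matrix_mult_def vec_eq_iff sum_distrib_left mult_ac)

lemma matrix_scaleR_left: "(c *\<^sub>R A) ** B = c *\<^sub>R (A ** B)" for A B :: "real^'n^'n"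
  by (simp add: matrix_matrix_mult_def vec_eq_iff sum_distrib_left mult_ac)

lemma trace_mult_mono:
  assumes "psd B" "X \<preceq> Y"
  shows "trace (B ** X) \<le> trace (B ** Y)"
proof -
  have "0 \<le> trace (B ** (Y - X))" using assms by (intro trace_mult_psd_nonneg psd_diffD)
  then show ?thesis by (simp add: matrix_diff_ldistrib trace_sub)
qed

lemma trace_mono: "X \<preceq> Y \<Longrightarrow> trace X \<le> trace Y"
  using trace_mult_mono[OF psd_mat_1] by simp

text \<open>A positive semidefinite \<open>R\<close> dominates the rank-one matrix
  \<open>(R h) (R h)\<^sup>T / h\<^sup>T R h\<close>, whose trace against \<open>A\<inverse>\<close> is at least \<open>h\<^sup>T R h / h\<^sup>T A h\<close>.\<close>

lemma psd_le_trace: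
  fixes A R :: "real^'n^'n"
  assumes A: "posdef A" and R: "psd R"
  shows "h \<bullet> (R *v h) \<le> trace (matrix_inv A ** R) * (h \<bullet> (A *v h))"
proof -
  define q where "q = h \<bullet> (R *v h)"
  define v where "v = R *v h"
  have q: "0 \<le> q" using R by (simp add: q_def psd_def)
  have inv: "psd (matrix_inv A)" by (intro posdef_psd posdef_matrix_inv A)
  have tr: "0 \<le> trace (matrix_inv A ** R)" by (rule trace_mult_psd_nonneg[OF inv R])
  show ?thesis
  proof (cases "q = 0")
    case True
    then show ?thesis using tr posdef_nonneg[OF A, of h] by (simp add: q_def)
  next
    case False
    then have q: "0 < q" using q by simp
    have "0 \<le> trace (matrix_inv A ** (R - outer v v /\<^sub>R q))"
      using psd_deflate[OF R, of h] by (intro trace_mult_psd_nonneg inv) (simp add: v_def q_def)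
    also have "\<dots> = trace (matrix_inv A ** R) - (v \<bullet> (matrix_inv A *v v)) / q"
      by (simp add: matrix_diff_ldistrib trace_sub matrix_scaleR_right mult_outer trace_outer
          trace_scaleR inner_commute divide_inverse mult_ac)
    finally have 1: "v \<bullet> (matrix_inv A *v v) \<le> q * trace (matrix_inv A ** R)"
      using q by (simp add: field_simps)
    have "q\<^sup>2 = (v \<bullet> (matrix_inv A *v (A *v h)))\<^sup>2"
      using A by (simp add: v_def q_def inner_commute)
    also have "\<dots> \<le> (v \<bullet> (matrix_inv A *v v)) * ((A *v h) \<bullet> (matrix_inv A *v (A *v h)))"
      by (rule psd_Cauchy_Schwarz_square[OF inv])
    also have "\<dots> \<le> q * trace (matrix_inv A ** R) * (h \<bullet> (A *v h))"
      using 1 A by (simp add: inner_commute[of "A *v h"] mult_right_mono posdef_nonneg)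
    finally show ?thesis using q unfolding q_def[symmetric]
      by (simp add: power2_eq_square mult.assoc)
  qed
qed

text \<open>For the residual \<open>G - A\<close>, SR1 is just a deflation. The exceptional branch
  fits the same formula, since there \<open>(G - A) *v u\<close> is zero.\<close>

lemma sr1_update_diff:
  fixes G A :: "real^'n^'n"
  assumes "transpose (G - A) = G - A"
  shows "sr1_update G A u - A = (G - A) - outer ((G - A) *v u) ((G - A) *v u) /\<^sub>R (u \<bullet> ((G - A) *v u))"
  using assms by (auto simp: sr1_update_def mult_outer_mult matrix_vector_mult_diff_rdistrib)

lemma psd_add: "psd A \<Longrightarrow> psd B \<Longrightarrow> psd (A + B)"
  by (simp add: psd_def mat_transpose_simps mv_simps)

lemma loewner_le_trans:
  assumes "A \<preceq> B" "B \<preceq> C"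
  shows "A \<preceq> C"
proof -
  have "psd ((B - A) + (C - B))" using assms by (intro psd_add psd_diffD)
  then show ?thesis by (simp add: loewner_le_def)
qed

lemma psd_scaleR: "psd A \<Longrightarrow> 0 \<le> c \<Longrightarrow> psd (c *\<^sub>R A)"
  by (simp add: psd_def transpose_scalar scaleR_mult_vec)

lemma sr1_update_bounds:
  fixes G A :: "real^'n^'n"
  assumes "A \<preceq> G"
  shows "A \<preceq> sr1_update G A u" and "sr1_update G A u \<preceq> G"
proof -
  have R: "psd (G - A)" by (rule psd_diffD[OF assms])
  have "transpose (G - A) = G - A" using R by (simp add: psd_def)
  note eq = sr1_update_diff[OF this, of u]
  show "A \<preceq> sr1_update G A u"
    unfolding loewner_le_def eq by (rule psd_deflate[OF R])
  have "G - sr1_update G A u = (G - A) - (sr1_update G A u - A)" by simp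
  also have "\<dots> = (1 / (u \<bullet> ((G - A) *v u))) *\<^sub>R outer ((G - A) *v u) ((G - A) *v u)"
    unfolding eq by (simp add: divide_inverse)
  finally have "G - sr1_update G A u = (1 / (u \<bullet> ((G - A) *v u))) *\<^sub>R outer ((G - A) *v u) ((G - A) *v u)" .
  moreover have "psd (outer v v)" for v :: "real^'n"
    by (simp add: psd_def transpose_outer outer_mult_vec inner_commute)
  ultimately show "sr1_update G A u \<preceq> G"
    unfolding loewner_le_def using R by (auto simp: psd_def[of "G - A"] intro!: psd_scaleR)
qed

lemma bfgs_update_mult_vec:
  assumes "transpose A = A" "transpose G = G"
  shows "bfgs_update G A u *v h = G *v h - ((u \<bullet> (G *v h)) / (u \<bullet> (G *v u))) *\<^sub>R (G *v u)
    + ((u \<bullet> (A *v h)) / (u \<bullet> (A *v u))) *\<^sub>R (A *v u)"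
  using sym_inner[OF assms(1), of u h] sym_inner[OF assms(2), of u h]
  by (simp add: bfgs_update_def mult_outer_mult assms matrix_vector_mult_add_rdistrib
      matrix_vector_mult_diff_rdistrib scaleR_mult_vec outer_mult_vec divide_inverse mult.commute)

lemma bfgs_update_form:
  assumes "transpose A = A" "transpose G = G"
  shows "h \<bullet> (bfgs_update G A u *v h) = h \<bullet> (G *v h) - (u \<bullet> (G *v h))\<^sup>2 / (u \<bullet> (G *v u))
    + (u \<bullet> (A *v h))\<^sup>2 / (u \<bullet> (A *v u))"
proof -
  have "h \<bullet> (A *v u) = u \<bullet> (A *v h)" "h \<bullet> (G *v u) = u \<bullet> (G *v h)"
    using assms by (metis inner_commute sym_inner)+
  then show ?thesis
    by (simp add: bfgs_update_mult_vec[OF assms] inner_add_right inner_diff_right power2_eq_square)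
qed

lemma bfgs_update_sym:
  assumes "transpose A = A" "transpose G = G"
  shows "transpose (bfgs_update G A u) = bfgs_update G A u"
  using assms by (simp add: bfgs_update_def mult_outer_mult mat_transpose_simps transpose_outer transpose_scalar)

text \<open>The deflated form at \<open>h\<close> is the minimum of the form over all
  \<open>h - t u\<close>. The minimiser \<open>t\<close> for \<open>G\<close> is a competitor for
  \<open>A\<close>, so the inequality between the forms survives minimisation.\<close>

lemma deflated_form_mono:
  fixes A G :: "real^'n^'n"
  assumes A: "posdef A" and G: "posdef G" and AG: "\<And>h. h \<bullet> (A *v h) \<le> c * (h \<bullet> (G *v h))"
  shows "h \<bullet> (A *v h) - (u \<bullet> (A *v h))\<^sup>2 / (u \<bullet> (A *v u))
     \<le> c * (h \<bullet> (G *v h) - (u \<bullet> (G *v h))\<^sup>2 / (u \<bullet> (G *v u)))"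
proof (cases "u = 0")
  case True
  then show ?thesis using AG by simp
next
  case False
  define t where "t = (u \<bullet> (G *v h)) / (u \<bullet> (G *v u))"
  have a: "0 < u \<bullet> (A *v u)" "0 < u \<bullet> (G *v u)" using False A G by (auto simp: posdef_pos)
  have expand: "(h - t *\<^sub>R u) \<bullet> (X *v (h - t *\<^sub>R u)) = h \<bullet> (X *v h) - 2 * t * (u \<bullet> (X *v h)) + t\<^sup>2 * (u \<bullet> (X *v u))"
    if "transpose X = X" for X :: "real^'n^'n"
  proof -
    have "h \<bullet> (X *v u) = u \<bullet> (X *v h)" using that by (metis inner_commute sym_inner)
    then show ?thesis by (simp add: mv_simps power2_eq_square algebra_simps)
  qed
  have "0 \<le> (t * (u \<bullet> (A *v u)) - u \<bullet> (A *v h))\<^sup>2 / (u \<bullet> (A *v u))" using a by simp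
  also have "\<dots> = (u \<bullet> (A *v h))\<^sup>2 / (u \<bullet> (A *v u)) - 2 * t * (u \<bullet> (A *v h)) + t\<^sup>2 * (u \<bullet> (A *v u))"
    using a by (simp add: field_simps power2_eq_square)
  finally have "h \<bullet> (A *v h) - (u \<bullet> (A *v h))\<^sup>2 / (u \<bullet> (A *v u)) \<le> (h - t *\<^sub>R u) \<bullet> (A *v (h - t *\<^sub>R u))"
    using expand[OF posdef_sym[OF A]] by simp
  also have "\<dots> \<le> c * ((h - t *\<^sub>R u) \<bullet> (G *v (h - t *\<^sub>R u)))" by (rule AG)
  also have "(h - t *\<^sub>R u) \<bullet> (G *v (h - t *\<^sub>R u)) = h \<bullet> (G *v h) - (u \<bullet> (G *v h))\<^sup>2 / (u \<bullet> (G *v u))"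
    unfolding expand[OF posdef_sym[OF G]] using a by (simp add: t_def field_simps power2_eq_square)
  finally show ?thesis .
qed

text \<open>BFGS deflates \<open>G\<close> along \<open>u\<close> and adds back the part that
  \<open>A\<close> has there. Both bounds compare deflated forms, once in each direction; the added
  part is at most \<open>\<eta>\<close> times itself because \<open>\<eta> \<ge> 1\<close>.\<close>

lemma bfgs_update_bounds:
  fixes G A :: "real^'n^'n"
  assumes A: "posdef A" and AG: "A \<preceq> G" and le: "G \<preceq> \<eta> *\<^sub>R A" and \<eta>: "1 \<le> \<eta>"
  shows "A \<preceq> bfgs_update G A u" and "bfgs_update G A u \<preceq> \<eta> *\<^sub>R A"
proof -
  have G: "posdef G" by (rule posdef_mono[OF A AG])
  note sym = posdef_sym[OF A] posdef_sym[OF G]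
  show "A \<preceq> bfgs_update G A u"
  proof (rule loewner_leI)
    fix h show "h \<bullet> (A *v h) \<le> h \<bullet> (bfgs_update G A u *v h)"
      using deflated_form_mono[OF A G, of 1 h u] loewner_leD[OF AG]
      by (simp add: bfgs_update_form sym)
  qed (simp_all add: sym bfgs_update_sym)
  show "bfgs_update G A u \<preceq> \<eta> *\<^sub>R A"
  proof (rule loewner_leI)
    fix h
    have "0 \<le> (u \<bullet> (A *v h))\<^sup>2 / (u \<bullet> (A *v u))" using A by (simp add: posdef_nonneg)
    then have "(u \<bullet> (A *v h))\<^sup>2 / (u \<bullet> (A *v u)) \<le> \<eta> * ((u \<bullet> (A *v h))\<^sup>2 / (u \<bullet> (A *v u)))"
      using \<eta> by (metis mult_le_cancel_right1 not_le)
    then show "h \<bullet> (bfgs_update G A u *v h) \<le> h \<bullet> ((\<eta> *\<^sub>R A) *v h)"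
      using deflated_form_mono[OF G A, of \<eta> h u] loewner_leD[OF le]
      by (simp add: bfgs_update_form sym scaleR_mult_vec right_diff_distrib)
  qed (simp_all add: sym bfgs_update_sym transpose_scalar)
qed

section \<open>The gap between an approximation and the Hessian\<close>

fun gap :: "update_rule \<Rightarrow> real \<Rightarrow> real^'n^'n \<Rightarrow> real^'n^'n \<Rightarrow> real" where
  "gap SR1 \<mu> A G = trace (G - A) / \<mu>"
| "gap BFGS \<mu> A G = trace (matrix_inv A ** G) - real CARD('n)"

text \<open>A unit direction \<open>w\<close> lowers the gap at least by \<open>w\<^sup>T score w\<close>, up to the constant 1 for BFGS;
  hence directions with \<open>w\<^sup>T score w \<ge> tr(score) / d\<close> are good enough (see \<open>gap_update\<close>).\<close>

fun score :: "update_rule \<Rightarrow> real \<Rightarrow> real^'n^'n \<Rightarrow> real^'n^'n \<Rightarrow> real^'n^'n \<Rightarrow> real^'n^'n" where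
  "score SR1 \<mu> A G F = (G - A) /\<^sub>R \<mu>"
| "score BFGS \<mu> A G F = transpose (matrix_inv F) ** matrix_inv A ** matrix_inv F"

fun qn_update :: "update_rule \<Rightarrow> real^'n^'n \<Rightarrow> real^'n^'n \<Rightarrow> real^'n^'n \<Rightarrow> real^'n \<Rightarrow> real^'n^'n" where
  "qn_update SR1 A G F w = sr1_update G A w"
| "qn_update BFGS A G F w = bfgs_update G A (transpose F *v w)"

lemma gap_BFGS_eq:
  assumes "posdef A"
  shows "gap BFGS \<mu> A G = trace (matrix_inv A ** (G - A))"
  using assms by (simp add: matrix_diff_ldistrib trace_sub matrix_inv_left posdef_invertible trace_I)

lemma gap_nonneg:
  assumes "posdef A" "A \<preceq> G" "0 < \<mu>"
  shows "0 \<le> gap upd \<mu> A G"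
proof (cases upd)
  case SR1
  then show ?thesis using trace_mono[OF assms(2)] assms(3) by (simp add: trace_sub)
next
  case BFGS
  then show ?thesis unfolding BFGS gap_BFGS_eq[OF assms(1)]
    by (intro trace_mult_psd_nonneg posdef_psd posdef_matrix_inv psd_diffD assms)
qed

text \<open>Both rules use \<open>psd_le_trace\<close> for the residual: BFGS relative to
  \<open>A\<close>, SR1 relative to the identity, which is then replaced by
  \<open>A / \<mu>\<close>.\<close>

lemma loewner_gap:
  fixes A :: "real^'n^'n"
  assumes A: "posdef A" and AG: "A \<preceq> G" and "0 < \<mu>" and \<mu>A: "\<mu> *\<^sub>R mat 1 \<preceq> A"
  shows "G \<preceq> (1 + gap upd \<mu> A G) *\<^sub>R A"
proof (rule loewner_leI)
  fix h
  have R: "psd (G - A)" by (rule psd_diffD[OF AG])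
  have "h \<bullet> ((G - A) *v h) \<le> gap upd \<mu> A G * (h \<bullet> (A *v h))"
  proof (cases upd)
    case SR1
    have "0 \<le> trace (G - A)" using trace_mono[OF AG] by (simp add: trace_sub)
    moreover have "\<mu> * (h \<bullet> h) \<le> h \<bullet> (A *v h)" using loewner_leD[OF \<mu>A, of h] by (simp add: mv_simps)
    ultimately have "trace (G - A) * (\<mu> * (h \<bullet> h)) \<le> trace (G - A) * (h \<bullet> (A *v h))"
      by (intro mult_left_mono)
    moreover have "h \<bullet> ((G - A) *v h) \<le> trace (G - A) * (h \<bullet> h)"
      using psd_le_trace[OF posdef_mat_1 R, of h] by (simp add: matrix_inv_mat_1)
    then have "h \<bullet> ((G - A) *v h) * \<mu> \<le> trace (G - A) * (h \<bullet> h) * \<mu>"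
      using \<open>0 < \<mu>\<close> by (intro mult_right_mono) auto
    ultimately have "h \<bullet> ((G - A) *v h) * \<mu> \<le> trace (G - A) * (h \<bullet> (A *v h))"
      by (simp add: mult_ac)
    then show ?thesis using \<open>0 < \<mu>\<close> SR1 by (simp add: pos_le_divide_eq)
  next
    case BFGS
    show ?thesis unfolding BFGS gap_BFGS_eq[OF A] by (rule psd_le_trace[OF A R])
  qed
  then show "h \<bullet> (G *v h) \<le> h \<bullet> (((1 + gap upd \<mu> A G) *\<^sub>R A) *v h)"
    by (simp add: mv_simps algebra_simps)
qed (use A AG in \<open>simp_all add: posdef_sym transpose_scalar posdef_mono[OF A AG]\<close>)

text \<open>The residual is at most \<open>(\<eta> - 1) A\<close>. Its weighted trace is governed by
  \<open>tr (A^-1 A) = d\<close> for BFGS and by \<open>tr A / \<mu> \<le> L d / \<mu>\<close> for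
  SR1; the two values of \<open>c\<close> come from here.\<close>

lemma gap_le_initial:
  fixes A :: "real^'n^'n"
  assumes A: "posdef A" and AG: "A \<preceq> G" and le: "G \<preceq> \<eta> *\<^sub>R A" and "1 \<le> \<eta>"
    and "0 < \<mu>" and AL: "A \<preceq> L *\<^sub>R mat 1"
    and c: "c = (case upd of BFGS \<Rightarrow> 1 | SR1 \<Rightarrow> L / \<mu>)"
  shows "gap upd \<mu> A G \<le> c * real CARD('n) * (\<eta> - 1)"
proof (cases upd)
  case SR1
  have "trace A \<le> L * real CARD('n)" using trace_mono[OF AL] by (simp add: trace_scaleR trace_I)
  then have "(\<eta> - 1) * trace A \<le> (\<eta> - 1) * (L * real CARD('n))" using \<open>1 \<le> \<eta>\<close> by (intro mult_left_mono) auto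
  moreover have "trace G \<le> \<eta> * trace A" using trace_mono[OF le] by (simp add: trace_scaleR)
  ultimately have "trace (G - A) \<le> L * real CARD('n) * (\<eta> - 1)" by (simp add: trace_sub algebra_simps)
  then show ?thesis using SR1 c \<open>0 < \<mu>\<close> by (simp add: divide_right_mono)
next
  case BFGS
  have "trace (matrix_inv A ** G) \<le> trace (matrix_inv A ** (\<eta> *\<^sub>R A))"
    by (intro trace_mult_mono posdef_psd posdef_matrix_inv A le)
  then have "trace (matrix_inv A ** G) \<le> \<eta> * real CARD('n)"
    using A by (simp add: matrix_scaleR_right trace_scaleR matrix_inv_left posdef_invertible trace_I)
  then show ?thesis using BFGS c by (simp add: algebra_simps)
qed

text \<open>One factor \<open>t\<close> comes from scaling \<open>G\<close>, the other from
  comparing \<open>B\<close> with \<open>A\<close>. The remaining cost, of order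
  \<open>t^2 - 1\<close>, is written as at most \<open>2 t^2 (t - 1)\<close> (because
  \<open>t + 1 \<le> 2 t^2\<close>), so that it joins the gap under a common factor
  \<open>t^2\<close>.\<close>

lemma gap_correct:
  fixes A B :: "real^'n^'n"
  assumes A: "posdef A" and B: "posdef B" and AG: "A \<preceq> G" and AB: "A \<preceq> t *\<^sub>R B"
    and t: "1 \<le> t" and "0 < \<mu>" and "0 < L" and AL: "A \<preceq> L *\<^sub>R mat 1"
    and c: "c = (case upd of BFGS \<Rightarrow> 1 | SR1 \<Rightarrow> L / \<mu>)"
  shows "gap upd \<mu> B (t *\<^sub>R G) \<le> t\<^sup>2 * (gap upd \<mu> A G + 2 * c * real CARD('n) * (t - 1))"
proof -
  define d where "d = real CARD('n)"
  have d: "0 < d" by (simp add: d_def)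
  have t2: "t\<^sup>2 - 1 \<le> t\<^sup>2 * (2 * (t - 1))"
  proof -
    have "(t - 1) * (t + 1) \<le> (t - 1) * (2 * t\<^sup>2)"
      using t by (intro mult_left_mono) (auto simp: power2_eq_square intro: order_trans[of _ "2 * t"])
    then show ?thesis by (simp add: power2_eq_square algebra_simps)
  qed
  show ?thesis
  proof (cases upd)
    case SR1
    have trA: "trace A \<le> L * d" using trace_mono[OF AL] by (simp add: trace_scaleR trace_I d_def)
    have trA0: "0 \<le> trace A" using trace_mult_psd_nonneg[OF psd_mat_1 posdef_psd[OF A]] by simp
    have R: "0 \<le> trace G - trace A" using trace_mono[OF AG] by simp
    have tB: "trace A \<le> t * trace B" using trace_mono[OF AB] by (simp add: trace_scaleR)
    have "t * (t * trace A - trace B) \<le> (t\<^sup>2 - 1) * trace A" using tB by (simp add: power2_eq_square algebra_simps)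
    moreover have "0 \<le> (t\<^sup>2 - 1) * trace A" using trA0 t by simp
    ultimately have "t * (t * trace A - trace B) \<le> t * ((t\<^sup>2 - 1) * trace A)"
      using t by (metis mult_le_cancel_right1 not_le order_trans)
    then have "t * trace A - trace B \<le> (t\<^sup>2 - 1) * trace A" using t by simp
    also have "\<dots> \<le> (t\<^sup>2 * (2 * (t - 1))) * (L * d)"
      using t2 trA trA0 t by (intro mult_mono) auto
    finally have 1: "t * trace A - trace B \<le> t\<^sup>2 * (2 * (t - 1)) * (L * d)" .
    have "t * (trace G - trace A) \<le> t\<^sup>2 * (trace G - trace A)"
      using t R by (intro mult_right_mono) (auto simp: power2_eq_square)
    with 1 have "t * trace G - trace B \<le> t\<^sup>2 * ((trace G - trace A) + 2 * L * d * (t - 1))"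
      by (simp add: algebra_simps)
    then have "(t * trace G - trace B) / \<mu> \<le> t\<^sup>2 * ((trace G - trace A) + 2 * L * d * (t - 1)) / \<mu>"
      using \<open>0 < \<mu>\<close> by (simp add: divide_right_mono)
    then show ?thesis using SR1 c \<open>0 < \<mu>\<close>
      by (simp add: trace_sub trace_scaleR d_def add_divide_distrib distrib_left)
  next
    case BFGS
    have "matrix_inv B \<preceq> t *\<^sub>R matrix_inv A"
    proof (rule loewner_leI)
      fix h show "h \<bullet> (matrix_inv B *v h) \<le> h \<bullet> ((t *\<^sub>R matrix_inv A) *v h)"
        using inv_antimono[OF A B, of t h] loewner_leD[OF AB] t by (simp add: scaleR_mult_vec)
    qed (simp_all add: transpose_scalar posdef_sym posdef_matrix_inv A B)
    then have "trace (G ** matrix_inv B) \<le> trace (G ** (t *\<^sub>R matrix_inv A))"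
      by (intro trace_mult_mono posdef_psd posdef_mono[OF A AG])
    then have "trace (matrix_inv B ** G) \<le> t * trace (matrix_inv A ** G)"
      by (simp add: matrix_scaleR_right trace_scaleR trace_mul_sym[of G])
    then have "t * trace (matrix_inv B ** G) \<le> t\<^sup>2 * trace (matrix_inv A ** G)"
      using t by (simp add: power2_eq_square)
    moreover have "d * (t\<^sup>2 - 1) \<le> d * (t\<^sup>2 * (2 * (t - 1)))" using t2 d by (intro mult_left_mono) auto
    ultimately show ?thesis using BFGS c
      by (simp add: matrix_scaleR_right trace_scaleR d_def[symmetric] algebra_simps)
  qed
qed

text \<open>All rest on \<open>F G F^T = I\<close>: in the coordinates \<open>w\<close> with
  \<open>u = F^T w\<close>, the form of \<open>G\<close> becomes the Euclidean one.\<close>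

lemma factor_identities:
  fixes G F :: "real^'n^'n"
  assumes G: "posdef G" and F: "transpose F ** F = matrix_inv G"
  shows "F *v (G *v (transpose F *v w)) = w"
    and "transpose F *v (F *v (G *v w)) = w"
    and "invertible F"
    and "G *v (transpose F *v w) = matrix_inv F *v w"
    and "matrix_inv F ** transpose (matrix_inv F) = G"
proof -
  have 1: "transpose F ** (F ** G) = mat 1"
    by (metis F G matrix_inv_left matrix_mul_assoc posdef_invertible)
  then have 2: "F ** G ** transpose F = mat 1"
    by (simp add: matrix_left_right_inverse)
  then show 3: "invertible F"
    by (metis invertible_right_inverse matrix_mul_assoc)
  show a: "F *v (G *v (transpose F *v w)) = w" for w
    by (metis 2 matrix_vector_mul_assoc matrix_vector_mul_lid)
  show "transpose F *v (F *v (G *v w)) = w"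
    by (metis 1 matrix_vector_mul_assoc matrix_vector_mul_lid)
  show b: "G *v (transpose F *v w) = matrix_inv F *v w" for w
    by (metis 3 a matrix_inv_left matrix_vector_mul_assoc matrix_vector_mul_lid)
  have "matrix_inv F ** transpose (matrix_inv F) = G ** transpose F ** transpose (matrix_inv F)"
    using b by (metis matrix_eq matrix_vector_mul_assoc)
  also have "\<dots> = G ** transpose (matrix_inv F ** F)"
    by (simp add: matrix_transpose_mul matrix_mul_assoc)
  finally show "matrix_inv F ** transpose (matrix_inv F) = G"
    by (simp add: matrix_inv_left[OF 3])
qed

text \<open>With \<open>K\<close> the new factor and \<open>B\<close> the new matrix,
  \<open>K^T K B h = h\<close> is checked for each \<open>h\<close>. For \<open>w = 0\<close> the
  conventions on division by zero leave both matrices unchanged.\<close>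

lemma bfgs_factor_update_correct:
  fixes G F A :: "real^'n^'n"
  assumes A: "posdef A" and G: "posdef G" and F: "transpose F ** F = matrix_inv G"
    and u: "u = transpose F *v w"
  shows "transpose (bfgs_factor_update F A u w) ** bfgs_factor_update F A u w
    = matrix_inv (bfgs_update G A u)"
proof (cases "w = 0")
  case True
  then have u0: "u = 0" by (simp add: u)
  have "outer x (0::real^'n) = 0" for x :: "real^'n" by (simp add: outer_def vec_eq_iff)
  then show ?thesis using F by (simp add: u0 True bfgs_factor_update_def bfgs_update_def)
next
  case False
  note id = factor_identities[OF G F]
  have u0: "u \<noteq> 0" using False id(1)[of w] by (auto simp: u)
  define s where "s = u \<bullet> (A *v u)"
  define n where "n = norm w"
  define v where "v = (sqrt s / n) *\<^sub>R w"
  define K where "K = bfgs_factor_update F A u w"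
  have s: "0 < s" using u0 A by (simp add: s_def posdef_pos)
  have n: "0 < n" using False by (simp add: n_def)
  have nn: "w \<bullet> w = n\<^sup>2" by (simp add: n_def power2_norm_eq_inner)
  have Fu: "F *v (G *v u) = w" using id(1) u by simp
  have uG: "u \<bullet> (G *v u) = n\<^sup>2"
  proof -
    have "u \<bullet> (G *v u) = w \<bullet> (F *v (G *v u))" by (simp add: u dot_lmul_matrix)
    then show ?thesis by (simp add: Fu nn)
  qed
  have K: "K *v h = F *v h - ((u \<bullet> h) / s) *\<^sub>R (F *v (A *v u) - v)" for h
    by (simp add: K_def bfgs_factor_update_def Let_def outer_mult_vec mv_simps s_def n_def v_def
        divide_inverse mult_ac)
  have KT: "transpose K *v y = transpose F *v y - (((F *v (A *v u) - v) \<bullet> y) / s) *\<^sub>R u" for y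
  proof -
    have "transpose K = transpose F - outer u (F *v (A *v u) - v) /\<^sub>R s"
      by (simp add: K_def bfgs_factor_update_def Let_def mat_transpose_simps transpose_scalar
          transpose_outer s_def n_def v_def divide_inverse mult_ac)
    then show ?thesis
      by (simp only: matrix_vector_mult_diff_rdistrib scaleR_mult_vec outer_mult_vec scaleR_scaleR
          divide_inverse mult_ac)
  qed
  have B: "bfgs_update G A u *v h = G *v h - ((u \<bullet> (G *v h)) / n\<^sup>2) *\<^sub>R (G *v u)
      + ((u \<bullet> (A *v h)) / s) *\<^sub>R (A *v u)" for h
    unfolding bfgs_update_mult_vec[OF posdef_sym[OF A] posdef_sym[OF G]] uG s_def ..
  have "transpose K *v (K *v (bfgs_update G A u *v h)) = h" for h
  proof -
    define a where "a = u \<bullet> (A *v h)"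
    define g where "g = u \<bullet> (G *v h)"
    define p where "p = a / (n * sqrt s) - g / n\<^sup>2"
    \<comment> \<open>The secant equation in dual form: \<open>u\<close> cannot distinguish the new
      matrix from \<open>A\<close>. It makes the multiples of \<open>F A u\<close> cancel in
      \<open>K B h\<close>, leaving \<open>F G h\<close> plus \<open>p\<close> times
      \<open>w\<close>.\<close>
    have ub: "u \<bullet> (bfgs_update G A u *v h) = a"
      using n s by (simp add: B mv_simps uG s_def[symmetric] a_def g_def)
    have y: "K *v (bfgs_update G A u *v h) = F *v (G *v h) + p *\<^sub>R w"
    proof -
      have "K *v (bfgs_update G A u *v h)
          = F *v (bfgs_update G A u *v h) - (a / s) *\<^sub>R (F *v (A *v u)) + (a / s) *\<^sub>R v"
        unfolding K ub by (simp add: algebra_simps)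
      also have "F *v (bfgs_update G A u *v h) = F *v (G *v h) - (g / n\<^sup>2) *\<^sub>R w + (a / s) *\<^sub>R (F *v (A *v u))"
        unfolding B by (simp add: mv_simps Fu a_def g_def)
      also have "(a / s) *\<^sub>R v = (a / (n * sqrt s)) *\<^sub>R w"
        using s n by (simp add: v_def field_simps)
      finally show ?thesis by (simp add: p_def algebra_simps)
    qed
    have i1: "(F *v (A *v u)) \<bullet> (F *v (G *v h)) = a"
    proof -
      have "(F *v (A *v u)) \<bullet> (F *v (G *v h)) = (A *v u) \<bullet> (transpose F *v (F *v (G *v h)))"
        by (metis dot_lmul_matrix inner_commute transpose_matrix_vector)
      also have "\<dots> = a" using id(2)[of h] posdef_sym[OF A] by (simp add: a_def sym_inner)
      finally show ?thesis .
    qed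
    have i2: "(F *v (A *v u)) \<bullet> w = s"
      by (metis dot_lmul_matrix inner_commute transpose_matrix_vector u s_def)
    have i3: "w \<bullet> (F *v (G *v h)) = g"
      by (metis dot_lmul_matrix transpose_matrix_vector u g_def)
    \<comment> \<open>The value of \<open>p\<close> makes \<open>v . (K B h)\<close> equal to
      \<open>a\<close>, which cancels against \<open>i1\<close>; the remaining \<open>p * s\<close>
      removes the \<open>p u\<close> that \<open>F^T\<close> produces.\<close>
    have "(F *v (A *v u) - v) \<bullet> (F *v (G *v h) + p *\<^sub>R w) = p * s"
      using n s by (simp add: mv_simps i1 i2 i3 v_def nn p_def field_simps power2_eq_square)
    then show ?thesis
      using s id(2)[of h] unfolding y KT
      by (simp add: matrix_vector_right_distrib matrix_vector_mult_scaleR u[symmetric] del: transpose_matrix_vector)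
  qed
  then have "transpose K ** K ** bfgs_update G A u = mat 1"
    unfolding matrix_eq matrix_vector_mul_assoc[symmetric] by (simp del: transpose_matrix_vector)
  then show ?thesis
    unfolding K_def[symmetric] by (metis matrix_inv_unique matrix_left_right_inverse)
qed

lemma trace_score_SR1: "trace (score SR1 \<mu> A G F) = gap SR1 \<mu> A G"
  by (simp add: trace_scaleR divide_inverse mult_ac)

text \<open>Cyclicity of the trace turns the score into \<open>A^-1 G\<close>. Divided by
  \<open>d\<close>, the extra summand contributes 1, which compensates the 1 that a BFGS update adds
  to the trace.\<close>

lemma trace_score_BFGS:
  fixes G F A :: "real^'n^'n"
  assumes "posdef G" "transpose F ** F = matrix_inv G"
  shows "trace (score BFGS \<mu> A G F) = gap BFGS \<mu> A G + real CARD('n)"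
proof -
  have "trace (score BFGS \<mu> A G F) = trace (matrix_inv A ** (matrix_inv F ** transpose (matrix_inv F)))"
    by (simp add: matrix_mul_assoc[symmetric] trace_mul_sym[of "transpose (matrix_inv F)"])
  then show ?thesis using factor_identities(5)[OF assms] by simp
qed

lemma psd_score:
  assumes "posdef A" "A \<preceq> G" "0 < \<mu>"
  shows "psd (score upd \<mu> A G F)"
proof (cases upd)
  case SR1
  then show ?thesis using psd_diffD[OF assms(2)] assms(3) by (simp add: psd_scaleR)
next
  case BFGS
  have inv: "posdef (matrix_inv A)" by (rule posdef_matrix_inv[OF assms(1)])
  then have "transpose (score BFGS \<mu> A G F) = score BFGS \<mu> A G F"
    by (simp add: matrix_transpose_mul posdef_sym matrix_mul_assoc)
  moreover have "h \<bullet> (score BFGS \<mu> A G F *v h) = (matrix_inv F *v h) \<bullet> (matrix_inv A *v (matrix_inv F *v h))" for h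
    by (simp add: matrix_vector_mul_assoc[symmetric]) (metis dot_lmul_matrix inner_commute)
  ultimately show ?thesis using posdef_nonneg[OF inv] BFGS by (simp add: psd_def)
qed

text \<open>The last summand is the shortfall of \<open>w\<close> against the average score: at most
  zero for greedy directions, of mean zero for random ones. For SR1 the bound is Cauchy-Schwarz for
  \<open>w\<close> and \<open>R w\<close>; for BFGS it holds with equality, since
  \<open>u . G u = 1\<close> in the new coordinates.\<close>

lemma gap_update:
  fixes A G F :: "real^'n^'n"
  assumes A: "posdef A" and AG: "A \<preceq> G" and "0 < \<mu>"
    and F: "upd = BFGS \<Longrightarrow> transpose F ** F = matrix_inv G" and w: "norm w = 1"
  shows "gap upd \<mu> A (qn_update upd A G F w) \<le> (1 - 1 / real CARD('n)) * gap upd \<mu> A G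
    + (trace (score upd \<mu> A G F) / real CARD('n) - w \<bullet> (score upd \<mu> A G F *v w))"
proof (cases upd)
  case SR1
  define R where "R = G - A"
  have R: "psd R" unfolding R_def by (rule psd_diffD[OF AG])
  define q where "q = w \<bullet> (R *v w)"
  have q: "0 \<le> q" using R by (simp add: q_def psd_def)
  have "q \<le> ((R *v w) \<bullet> (R *v w)) / q"
  proof (cases "q = 0")
    case False
    have "q\<^sup>2 \<le> (w \<bullet> w) * ((R *v w) \<bullet> (R *v w))"
      unfolding q_def by (rule Cauchy_Schwarz_ineq)
    then show ?thesis using False q w by (simp add: norm_eq_1 field_simps power2_eq_square)
  qed simp
  moreover have "trace (sr1_update G A w - A) = trace R - ((R *v w) \<bullet> (R *v w)) / q"
    using sr1_update_diff[of G A w] R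
    by (simp add: R_def[symmetric] psd_def trace_sub trace_scaleR trace_outer q_def[symmetric] divide_inverse mult_ac)
  ultimately have "trace (sr1_update G A w - A) / \<mu> \<le> (trace R - q) / \<mu>"
    using \<open>0 < \<mu>\<close> by (intro divide_right_mono) auto
  then show ?thesis
    using SR1 trace_score_SR1[of \<mu> A G F]
    by (simp add: R_def[symmetric] scaleR_mult_vec q_def[symmetric] diff_divide_distrib divide_inverse algebra_simps)
next
  case BFGS
  have G: "posdef G" by (rule posdef_mono[OF A AG])
  have F': "transpose F ** F = matrix_inv G" using F BFGS by simp
  note id = factor_identities[OF G F']
  define u where "u = transpose F *v w"
  define z where "z = matrix_inv F *v w"
  have Gu: "G *v u = z" using id(4) by (simp add: u_def z_def)
  have "u \<noteq> 0" using id(1)[of w] w by (auto simp: u_def)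
  then have s: "0 < u \<bullet> (A *v u)" using A by (simp add: posdef_pos)
  have uGu: "u \<bullet> (G *v u) = 1"
  proof -
    have "u \<bullet> (G *v u) = w \<bullet> (F *v (G *v u))" by (simp add: u_def dot_lmul_matrix)
    then show ?thesis using id(1)[of w] w by (simp add: u_def norm_eq_1)
  qed
  have "matrix_inv A ** bfgs_update G A u
      = matrix_inv A ** G - outer (matrix_inv A *v z) z + outer u (A *v u) /\<^sub>R (u \<bullet> (A *v u))"
  proof -
    have "G ** outer u u ** G = outer z z" "A ** outer u u ** A = outer (A *v u) (A *v u)"
      unfolding mult_outer_mult posdef_sym[OF A] posdef_sym[OF G] Gu by (rule refl)+
    then show ?thesis
      using A by (simp add: bfgs_update_def uGu matrix_diff_ldistrib matrix_add_ldistrib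
          matrix_scaleR_right mult_outer)
  qed
  then have "trace (matrix_inv A ** bfgs_update G A u)
      = trace (matrix_inv A ** G) - z \<bullet> (matrix_inv A *v z) + 1"
    using s by (simp add: trace_add trace_sub trace_scaleR trace_outer inner_commute)
  moreover have "w \<bullet> (score BFGS \<mu> A G F *v w) = z \<bullet> (matrix_inv A *v z)"
    by (simp add: z_def matrix_vector_mul_assoc[symmetric]) (metis dot_lmul_matrix inner_commute)
  moreover have "trace (score BFGS \<mu> A G F) / real CARD('n) = gap BFGS \<mu> A G / real CARD('n) + 1"
    by (simp add: trace_score_BFGS[OF G F'] add_divide_distrib del: gap.simps score.simps)
  moreover have "(1 - 1 / real CARD('n)) * gap BFGS \<mu> A G = gap BFGS \<mu> A G - gap BFGS \<mu> A G / real CARD('n)"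
    by (simp add: left_diff_distrib del: gap.simps)
  moreover have "gap BFGS \<mu> A (bfgs_update G A u) = trace (matrix_inv A ** bfgs_update G A u) - real CARD('n)"
    and "gap BFGS \<mu> A G = trace (matrix_inv A ** G) - real CARD('n)" by simp_all
  ultimately show ?thesis
    unfolding BFGS qn_update.simps u_def[symmetric] by linarith
qed

text \<open>The scores of the basis vectors are the diagonal entries, and the largest entry is at
  least their average.\<close>

lemma trace_le_max_Basis:
  fixes B :: "real^'n^'n"
  assumes "is_arg_max (\<lambda>b. b \<bullet> (B *v b)) (\<lambda>b. b \<in> Basis) w"
  shows "trace B / real CARD('n) \<le> w \<bullet> (B *v w)" and "norm w = 1"
proof -
  have w: "w \<in> Basis" and max: "\<And>b. b \<in> Basis \<Longrightarrow> b \<bullet> (B *v b) \<le> w \<bullet> (B *v w)"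
    using assms by (auto simp: is_arg_max_def not_less)
  show "norm w = 1" using w by simp
  have "B $ i $ i \<le> w \<bullet> (B *v w)" for i
    using max[of "axis i 1"] by (simp add: inner_axis' matrix_vector_mult_basis column_def)
  then have "trace B \<le> (\<Sum>i\<in>(UNIV::'n set). w \<bullet> (B *v w))" unfolding trace_def by (intro sum_mono)
  then show "trace B / real CARD('n) \<le> w \<bullet> (B *v w)" by (simp add: divide_le_eq mult_ac)
qed

section \<open>Newton steps for self-concordant functions\<close>

lemma matrix_vector_mult_minus: "A *v (- x) = - (A *v x)" for A :: "real^'n^'m"
  by (rule linear_neg[OF matrix_vector_mul_linear])

lemma local_norm_scaleR: "local_norm f z (t *\<^sub>R h) = \<bar>t\<bar> * local_norm f z h"
proof -
  have "(t *\<^sub>R h) \<bullet> (hessian f z *v (t *\<^sub>R h)) = t\<^sup>2 * (h \<bullet> (hessian f z *v h))"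
    by (simp add: matrix_vector_mult_scaleR power2_eq_square)
  then show ?thesis by (simp add: local_norm_def real_sqrt_mult)
qed

section \<open>Scalar recursions\<close>

lemma geometric_sum_le:
  fixes \<rho> :: real
  assumes "0 \<le> \<rho>" "\<rho> < 1"
  shows "(\<Sum>i<k. \<rho> ^ i) \<le> 1 / (1 - \<rho>)"
proof -
  have "(\<Sum>i<k. \<rho> ^ i) = (1 - \<rho> ^ k) / (1 - \<rho>)" using assms by (simp add: sum_gp_strict)
  also have "\<dots> \<le> 1 / (1 - \<rho>)" using assms by (intro divide_right_mono) auto
  finally show ?thesis .
qed

text \<open>The exponential perturbations multiply to \<open>exp\<close> of a geometric sum, which
  is at most \<open>exp (ln 2) = 2\<close>; this is the 2 in \<open>2cd\<eta>\<close>.\<close>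

lemma perturbed_geometric_decay:
  fixes e :: "nat \<Rightarrow> real"
  assumes step: "\<And>k. e (Suc k) \<le> q * exp (b * \<rho> ^ k) * e k" and e0: "e 0 \<le> E"
    and "0 \<le> q" "0 \<le> E" "0 \<le> b" "0 \<le> \<rho>" "\<rho> < 1" and b: "b / (1 - \<rho>) \<le> ln 2"
  shows "e k \<le> 2 * E * q ^ k"
proof -
  have "e k \<le> exp (b * (\<Sum>i<k. \<rho> ^ i)) * (E * q ^ k)"
  proof (induction k)
    case (Suc k)
    have "e (Suc k) \<le> q * exp (b * \<rho> ^ k) * e k" by (rule step)
    also have "\<dots> \<le> q * exp (b * \<rho> ^ k) * (exp (b * (\<Sum>i<k. \<rho> ^ i)) * (E * q ^ k))"
      using Suc assms by (intro mult_left_mono) auto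
    also have "\<dots> = exp (b * (\<Sum>i<Suc k. \<rho> ^ i)) * (E * q ^ Suc k)"
      by (simp add: exp_add distrib_left)
    finally show ?case .
  qed (simp add: e0)
  also have "\<dots> \<le> 2 * (E * q ^ k)"
  proof (intro mult_right_mono)
    have "b * (\<Sum>i<k. \<rho> ^ i) \<le> b * (1 / (1 - \<rho>))"
      using assms geometric_sum_le[of \<rho> k] by (intro mult_left_mono) auto
    also have "\<dots> \<le> ln 2" using b by simp
    finally have "exp (b * (\<Sum>i<k. \<rho> ^ i)) \<le> exp (ln 2)" by (subst exp_le_cancel_iff)
    then show "exp (b * (\<Sum>i<k. \<rho> ^ i)) \<le> 2" by simp
  qed (use assms in auto)
  finally show ?thesis by simp
qed

text \<open>Chaining the bounds adds up the exponents \<open>0 + 1 + ... + (k - 1)\<close>.\<close>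

lemma superlinear_product:
  fixes l \<theta> :: "nat \<Rightarrow> real"
  assumes step: "\<And>k. l (Suc k) \<le> \<theta> k * l k" and le: "\<And>k. \<theta> k \<le> K * q ^ k"
    and nonneg: "\<And>k. 0 \<le> l k" and "0 \<le> K" "0 \<le> q"
  shows "l k \<le> K ^ k * q ^ (k * (k - 1) div 2) * l 0"
proof (induction k)
  case (Suc k)
  have tri: "Suc k * (Suc k - 1) div 2 = k + k * (k - 1) div 2"
  proof -
    have "Suc k * (Suc k - 1) = 2 * k + k * (k - 1)" by (cases k) (auto simp: algebra_simps)
    then show ?thesis by simp
  qed
  have "l (Suc k) \<le> \<theta> k * l k" by (rule step)
  also have "\<dots> \<le> (K * q ^ k) * l k" by (intro mult_right_mono le nonneg)
  also have "\<dots> \<le> (K * q ^ k) * (K ^ k * q ^ (k * (k - 1) div 2) * l 0)"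
    using Suc assms by (intro mult_left_mono) auto
  also have "\<dots> = K ^ Suc k * q ^ (Suc k * (Suc k - 1) div 2) * l 0"
    unfolding tri by (simp add: power_add)
  finally show ?case .
qed simp

locale self_concordant_objective =
  fixes f :: "real^'n \<Rightarrow> real" and M \<mu> L :: real
  assumes M: "0 < M" and \<mu>: "0 < \<mu>" and L: "0 < L"
    and twice_diff: "twice_differentiable f"
    and concordant: "strongly_self_concordant M f"
    and convex: "strongly_convex \<mu> f"
    and smooth: "smooth L f"
begin

lemma hessian_lower: "\<mu> *\<^sub>R mat 1 \<preceq> hessian f x"
  using convex by (simp add: strongly_convex_def)

lemma hessian_upper: "hessian f x \<preceq> L *\<^sub>R mat 1"
  using smooth by (simp add: smooth_def)

lemma posdef_hessian: "posdef (hessian f x)"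
  by (rule posdef_mono[OF posdef_scaleR[OF posdef_mat_1 \<mu>] hessian_lower])

lemma condition_number_ge_1: "1 \<le> L / \<mu>"
proof -
  define h where "h = (axis undefined 1 :: real^'n)"
  have "h \<bullet> h = 1" by (simp add: h_def inner_axis_axis)
  then have "\<mu> \<le> L"
    using loewner_leD[OF hessian_lower, of h] loewner_leD[OF hessian_upper, of h]
    by (simp add: mv_simps) (meson order_trans)
  then show ?thesis using \<mu> by simp
qed

lemma local_norm_nonneg: "0 \<le> local_norm f z h"
  by (simp add: local_norm_def posdef_nonneg posdef_hessian)

lemma newton_decrement_nonneg: "0 \<le> newton_decrement f x"
  by (simp add: newton_decrement_def posdef_nonneg posdef_hessian posdef_matrix_inv)

lemma newton_decrement_square:
  "(newton_decrement f x)\<^sup>2 = grad f x \<bullet> (matrix_inv (hessian f x) *v grad f x)"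
  by (simp add: newton_decrement_def posdef_nonneg posdef_hessian posdef_matrix_inv)

lemma hessian_change:
  "h \<bullet> (hessian f y *v h) \<le> (1 + M * local_norm f z (y - x)) * (h \<bullet> (hessian f x *v h))"
proof -
  have "hessian f y - hessian f x \<preceq> (M * local_norm f z (y - x)) *\<^sub>R hessian f x"
    using concordant by (simp add: strongly_self_concordant_def)
  from loewner_leD[OF this, of h] show ?thesis by (simp add: mv_simps algebra_simps)
qed

text \<open>The mean value theorem is applied to \<open>t \<mapsto> a\<^sup>T \<nabla>f(x + t s)\<close> for the single vector
  \<open>a = \<nabla>\<^sup>2f(y)\<inverse> \<nabla>f(y)\<close>, so that one Hessian on the segment replaces the averaged Hessian.\<close>

lemma newton_step:
  assumes HG: "hessian f x \<preceq> G" and G\<eta>: "G \<preceq> \<eta> *\<^sub>R hessian f x" and \<eta>: "1 \<le> \<eta>"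
    and y: "y = x - matrix_inv G *v grad f x"
  defines "r \<equiv> local_norm f x (y - x)"
  shows "r \<le> newton_decrement f x"
    and "newton_decrement f y
      \<le> max (1 + M * r - 1 / \<eta>) (M * r * (1 + M * r)) * newton_decrement f x"
proof -
  define g where "g = grad f x"
  define s where "s = y - x"
  define ld where "ld = newton_decrement f x"
  define ld' where "ld' = newton_decrement f y"
  have H: "posdef (hessian f z)" for z by (rule posdef_hessian)
  have G: "posdef G" by (rule posdef_mono[OF H HG])
  have s: "s = - (matrix_inv G *v g)" by (simp add: s_def y g_def)
  have Gs: "G *v s = - g" using G by (simp add: s matrix_vector_mult_minus)
  have r: "0 \<le> r" by (simp add: r_def local_norm_nonneg)
  have Mr: "0 \<le> M * r" using r M by simp
  have HGq: "h \<bullet> (hessian f x *v h) \<le> h \<bullet> (G *v h)" for h by (rule loewner_leD[OF HG])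
  have GHq: "h \<bullet> (G *v h) \<le> \<eta> * (h \<bullet> (hessian f x *v h))" for h
    using loewner_leD[OF G\<eta>, of h] by (simp add: scaleR_mult_vec)
  have "r\<^sup>2 = s \<bullet> (hessian f x *v s)"
    by (simp add: r_def local_norm_def s_def posdef_nonneg H)
  also have "\<dots> \<le> s \<bullet> (G *v s)" by (rule HGq)
  also have "\<dots> = g \<bullet> (matrix_inv G *v g)" unfolding Gs by (simp add: s inner_commute)
  also have "\<dots> \<le> 1 * (g \<bullet> (matrix_inv (hessian f x) *v g))"
    using HGq by (intro inv_antimono H G) auto
  also have "\<dots> = ld\<^sup>2" by (simp add: ld_def newton_decrement_square g_def)
  finally have "r\<^sup>2 \<le> ld\<^sup>2" .
  then show "r \<le> newton_decrement f x"
    unfolding ld_def[symmetric] by (rule power2_le_imp_le) (simp add: ld_def newton_decrement_nonneg)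
  define a where "a = matrix_inv (hessian f y) *v grad f y"
  have deriv: "((\<lambda>t. a \<bullet> grad f (x + t *\<^sub>R s)) has_real_derivative
      a \<bullet> (hessian f (x + t *\<^sub>R s) *v s)) (at t)" for t
  proof -
    have "(grad f has_derivative (\<lambda>h. hessian f (x + t *\<^sub>R s) *v h)) (at (x + t *\<^sub>R s))"
      using twice_diff by (intro has_derivative_grad) (simp add: twice_differentiable_def)
    moreover have "((\<lambda>t. x + t *\<^sub>R s) has_derivative (\<lambda>h. h *\<^sub>R s)) (at t)"
      by (auto intro!: derivative_eq_intros)
    ultimately have "((\<lambda>t. grad f (x + t *\<^sub>R s)) has_derivative
        (\<lambda>h. hessian f (x + t *\<^sub>R s) *v (h *\<^sub>R s))) (at t)"
      using diff_chain_at[of "\<lambda>t. x + t *\<^sub>R s"] by (simp add: o_def)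
    then have "((\<lambda>t. a \<bullet> grad f (x + t *\<^sub>R s)) has_derivative
        (\<lambda>h. a \<bullet> (hessian f (x + t *\<^sub>R s) *v (h *\<^sub>R s)))) (at t)"
      by (rule has_derivative_inner_right)
    then show ?thesis
      unfolding has_field_derivative_def
      by (simp add: matrix_vector_mult_scaleR mult.commute[of _ "a \<bullet> _"] mult_commute_abs)
  qed
  obtain t where t: "0 < t" "t < 1"
    and mvt: "a \<bullet> grad f (x + 1 *\<^sub>R s) - a \<bullet> grad f (x + 0 *\<^sub>R s)
      = (1 - 0) * (a \<bullet> (hessian f (x + t *\<^sub>R s) *v s))"
    using MVT2[of 0 1 "\<lambda>t. a \<bullet> grad f (x + t *\<^sub>R s)" "\<lambda>t. a \<bullet> (hessian f (x + t *\<^sub>R s) *v s)"] deriv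
    by auto
  define z where "z = x + t *\<^sub>R s"
  define J where "J = hessian f z"
  have J: "posdef J" by (simp add: J_def H)
  define E where "E = matrix_inv G - matrix_inv J"
  have "z - x = t *\<^sub>R s" "x - z = (- t) *\<^sub>R s" "z - y = (t - 1) *\<^sub>R s"
    by (simp_all add: z_def s_def algebra_simps)
  moreover have "local_norm f x s = r" by (simp add: r_def s_def)
  \<comment> \<open>All displacements are measured in the norm at \<open>x\<close>. Strong
    self-concordance allows any base point for the norm, so the single \<open>r\<close> controls the
    change between \<open>z\<close> and \<open>y\<close> as well.\<close>
  ultimately have "local_norm f x (z - x) \<le> r" "local_norm f x (x - z) \<le> r" "local_norm f x (z - y) \<le> r"
    using t r by (simp_all only: local_norm_scaleR) (auto simp: abs_if mult_left_le_one_le)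
  then have "1 + M * local_norm f x (z - x) \<le> 1 + M * r"
    "1 + M * local_norm f x (x - z) \<le> 1 + M * r" "1 + M * local_norm f x (z - y) \<le> 1 + M * r"
    using M by auto
  note this[THEN mult_right_mono, OF posdef_nonneg[OF H]]
  then have JH: "h \<bullet> (J *v h) \<le> (1 + M * r) * (h \<bullet> (hessian f x *v h))"
    and HJ: "h \<bullet> (hessian f x *v h) \<le> (1 + M * r) * (h \<bullet> (J *v h))"
    and JHy: "h \<bullet> (J *v h) \<le> (1 + M * r) * (h \<bullet> (hessian f y *v h))" for h
    unfolding J_def using hessian_change order_trans by blast+
  define \<kappa> where "\<kappa> = \<eta> * (1 + M * r)"
  have \<kappa>: "1 \<le> \<kappa>"
    using \<eta> Mr mult_mono[of 1 \<eta> 1 "1 + M * r"] by (simp add: \<kappa>_def)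
  \<comment> \<open>Relative to \<open>J^-1\<close>, the matrix \<open>G^-1\<close> lies between
    \<open>1 / \<kappa>\<close> and \<open>1 + M * r\<close>; \<open>\<epsilon>\<close> is the
    larger deviation from 1.\<close>
  define \<epsilon> where "\<epsilon> = max (1 - 1 / \<kappa>) (M * r)"
  have \<epsilon>: "0 \<le> \<epsilon>" using Mr by (simp add: \<epsilon>_def)
  have JG: "h \<bullet> (J *v h) \<le> (1 + M * r) * (h \<bullet> (G *v h))" for h
    using JH[of h] HGq[of h] Mr by (meson add_nonneg_nonneg mult_left_mono order_trans zero_le_one)
  have GJ: "h \<bullet> (G *v h) \<le> \<kappa> * (h \<bullet> (J *v h))" for h
  proof -
    have "h \<bullet> (G *v h) \<le> \<eta> * (h \<bullet> (hessian f x *v h))" by (rule GHq)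
    also have "\<dots> \<le> \<eta> * ((1 + M * r) * (h \<bullet> (J *v h)))" using HJ \<eta> by (intro mult_left_mono) auto
    finally show ?thesis by (simp add: \<kappa>_def mult.assoc)
  qed
  have Ebound: "\<bar>h \<bullet> (E *v h)\<bar> \<le> \<epsilon> * (h \<bullet> (matrix_inv J *v h))" for h
  proof -
    define j where "j = h \<bullet> (matrix_inv J *v h)"
    define i where "i = h \<bullet> (matrix_inv G *v h)"
    have j: "0 \<le> j" by (simp add: j_def posdef_nonneg posdef_matrix_inv J)
    have 1: "i \<le> (1 + M * r) * j"
      unfolding i_def j_def using JG Mr by (intro inv_antimono J G) auto
    have "j \<le> \<kappa> * i"
      unfolding i_def j_def using GJ \<kappa> by (intro inv_antimono J G) auto
    then have "j - i \<le> (1 - 1 / \<kappa>) * j"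
      using \<kappa> by (simp add: field_simps)
    also have "\<dots> \<le> \<epsilon> * j" using j by (intro mult_right_mono) (simp_all add: \<epsilon>_def)
    finally have "j - i \<le> \<epsilon> * j" .
    moreover have "i - j \<le> \<epsilon> * j"
    proof -
      have "i - j \<le> M * r * j" using 1 by (simp add: algebra_simps)
      also have "\<dots> \<le> \<epsilon> * j" using j by (intro mult_right_mono) (simp_all add: \<epsilon>_def)
      finally show ?thesis .
    qed
    ultimately show ?thesis
      by (simp add: E_def matrix_vector_mult_diff_rdistrib inner_diff_right i_def j_def abs_le_iff)
  qed
  have E: "transpose E = E"
    by (simp add: E_def mat_transpose_simps posdef_sym posdef_matrix_inv G J)
  have ld'a: "ld'\<^sup>2 = a \<bullet> grad f y" "ld'\<^sup>2 = a \<bullet> (hessian f y *v a)"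
    by (simp_all add: ld'_def newton_decrement_square a_def H inner_commute)
  have "a \<bullet> grad f y = a \<bullet> g + a \<bullet> (J *v s)"
    using mvt by (simp add: s_def g_def J_def z_def)
  \<comment> \<open>As \<open>s = - G^-1 g\<close>, the new gradient tested against \<open>a\<close>
    only sees \<open>E\<close>, the error of \<open>G^-1\<close> as an inverse of
    \<open>J\<close>.\<close>
  also have "\<dots> = - (a \<bullet> (J *v (E *v g)))"
    using J by (simp add: E_def s mv_simps matrix_vector_mult_minus)
  also have "\<dots> = - ((J *v a) \<bullet> (E *v g))"
    by (simp add: sym_inner posdef_sym J)
  also have "\<dots> \<le> \<epsilon> * (sqrt ((J *v a) \<bullet> (matrix_inv J *v (J *v a))) * sqrt (g \<bullet> (matrix_inv J *v g)))"
    using bilinear_form_le[OF E posdef_psd[OF posdef_matrix_inv[OF J]] \<epsilon> Ebound, of "J *v a" g] by linarith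
  also have "\<dots> \<le> \<epsilon> * (sqrt ((1 + M * r) * ld'\<^sup>2) * sqrt ((1 + M * r) * ld\<^sup>2))"
  proof (intro mult_left_mono mult_mono real_sqrt_le_mono)
    show "(J *v a) \<bullet> (matrix_inv J *v (J *v a)) \<le> (1 + M * r) * ld'\<^sup>2"
      using JHy[of a] J by (simp add: ld'a(2) inner_commute)
    have "g \<bullet> (matrix_inv J *v g) \<le> (1 + M * r) * (g \<bullet> (matrix_inv (hessian f x) *v g))"
      using HJ Mr by (intro inv_antimono J H) auto
    then show "g \<bullet> (matrix_inv J *v g) \<le> (1 + M * r) * ld\<^sup>2"
      by (simp add: ld_def newton_decrement_square g_def)
  qed (use \<epsilon> Mr in \<open>auto simp: posdef_nonneg posdef_matrix_inv J\<close>)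
  also have "\<dots> = ld' * (\<epsilon> * (1 + M * r) * ld)"
    using Mr by (simp add: real_sqrt_mult ld_def ld'_def newton_decrement_nonneg mult_ac)
  finally have "ld' * ld' \<le> ld' * (\<epsilon> * (1 + M * r) * ld)"
    using ld'a(1) by (simp add: power2_eq_square)
  moreover have "0 \<le> ld'" "0 \<le> ld" by (simp_all add: ld_def ld'_def newton_decrement_nonneg)
  ultimately have "ld' \<le> \<epsilon> * (1 + M * r) * ld"
    using \<epsilon> Mr by (cases "ld' = 0") (auto simp: mult_le_cancel_left)
  \<comment> \<open>The factor \<open>1 + M * r\<close> contained in \<open>\<kappa>\<close>
    cancels, so \<open>1 / \<eta>\<close> enters without loss.\<close>
  also have "\<epsilon> * (1 + M * r) = max (1 + M * r - 1 / \<eta>) (M * r * (1 + M * r))"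
  proof -
    have "(1 - 1 / \<kappa>) * (1 + M * r) = 1 + M * r - 1 / \<eta>"
      using Mr \<eta> by (simp add: \<kappa>_def left_diff_distrib)
    then show ?thesis unfolding \<epsilon>_def using Mr by (simp add: max_mult_distrib_right)
  qed
  finally show "newton_decrement f y
      \<le> max (1 + M * r - 1 / \<eta>) (M * r * (1 + M * r)) * newton_decrement f x"
    by (simp add: ld_def ld'_def)
qed

end

section \<open>Linear rate and contraction of the potential\<close>

lemma real_exp_ge_square: "0 \<le> m \<Longrightarrow> (1 + m)\<^sup>2 \<le> exp (2 * m)" for m :: real
proof -
  assume "0 \<le> m"
  then have "(1 + m)\<^sup>2 \<le> (exp m)\<^sup>2" by (intro power_mono) auto
  then show ?thesis by (simp add: exp_double)
qed

lemma loewner_scaleR_mono: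
  assumes "A \<preceq> B" "0 \<le> c"
  shows "c *\<^sub>R A \<preceq> c *\<^sub>R B"
  using assms by (simp add: loewner_le_def psd_scaleR flip: scaleR_diff_right)

lemma loewner_scaleR_left_mono:
  assumes "posdef A" "a \<le> b"
  shows "a *\<^sub>R A \<preceq> b *\<^sub>R A"
  using assms by (simp add: loewner_le_def psd_scaleR posdef_psd flip: scaleR_diff_left)

context self_concordant_objective
begin

text \<open>With \<open>t = 1 + M r\<close>, consecutive Hessians are within a factor
  \<open>t\<close> of each other in both directions. Scaling \<open>G\<close> by \<open>t\<close>
  therefore keeps it above the next Hessian, and the upper bound pays \<open>t^2\<close>: once for
  the scaling and once for the change of Hessian.\<close>

lemma correction_bounds:
  fixes x :: "nat \<Rightarrow> real^'n"
  assumes HG: "hessian f (x k) \<preceq> G k" and G\<eta>: "G k \<preceq> \<eta> *\<^sub>R hessian f (x k)" and \<eta>: "1 \<le> \<eta>"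
    and x: "x (Suc k) = x k - matrix_inv (G k) *v grad f (x k)"
  shows "1 \<le> correction f M x k" and "correction f M x k \<le> 1 + M * newton_decrement f (x k)"
    and "hessian f (x k) \<preceq> correction f M x k *\<^sub>R hessian f (x (Suc k))"
    and "hessian f (x (Suc k)) \<preceq> corrected_G f M x G k"
    and "corrected_G f M x G k \<preceq> ((correction f M x k)\<^sup>2 * \<eta>) *\<^sub>R hessian f (x (Suc k))"
proof -
  define s where "s = x (Suc k) - x k"
  define t where "t = correction f M x k"
  have t: "t = 1 + M * local_norm f (x k) s" by (simp add: t_def correction_def s_def)
  have H: "posdef (hessian f z)" for z by (rule posdef_hessian)
  have G: "posdef (G k)" by (rule posdef_mono[OF H HG])
  show t1: "1 \<le> correction f M x k"
    using M local_norm_nonneg by (simp add: correction_def)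
  show "correction f M x k \<le> 1 + M * newton_decrement f (x k)"
    using newton_step(1)[OF HG G\<eta> \<eta> x] M by (simp add: correction_def)
  have sym: "transpose (c *\<^sub>R hessian f z) = c *\<^sub>R hessian f z" for c z
    by (simp add: transpose_scalar posdef_sym H)
  have le1: "h \<bullet> (hessian f (x (Suc k)) *v h) \<le> t * (h \<bullet> (hessian f (x k) *v h))" for h
    using hessian_change[of h "x (Suc k)" "x k" "x k"] by (simp add: t s_def)
  have "local_norm f (x k) (x k - x (Suc k)) = local_norm f (x k) s"
    using local_norm_scaleR[of f "x k" "-1" s] by (simp add: s_def)
  then have le2: "h \<bullet> (hessian f (x k) *v h) \<le> t * (h \<bullet> (hessian f (x (Suc k)) *v h))" for h
    using hessian_change[of h "x k" "x k" "x (Suc k)"] by (simp add: t)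
  show 1: "hessian f (x k) \<preceq> correction f M x k *\<^sub>R hessian f (x (Suc k))"
    unfolding t_def[symmetric] using le2
    by (intro loewner_leI) (simp_all add: sym posdef_sym H scaleR_mult_vec)
  have "hessian f (x (Suc k)) \<preceq> t *\<^sub>R hessian f (x k)"
    using le1 by (intro loewner_leI) (simp_all add: sym posdef_sym H scaleR_mult_vec)
  also have "t *\<^sub>R hessian f (x k) \<preceq> corrected_G f M x G k"
    using t1 by (simp add: corrected_G_def t_def loewner_scaleR_mono HG)
  finally (loewner_le_trans) show "hessian f (x (Suc k)) \<preceq> corrected_G f M x G k" .
  have "corrected_G f M x G k \<preceq> (t * \<eta>) *\<^sub>R hessian f (x k)"
    using loewner_scaleR_mono[OF G\<eta>, of t] t1 by (simp add: corrected_G_def t_def)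
  also have "(t * \<eta>) *\<^sub>R hessian f (x k) \<preceq> (t\<^sup>2 * \<eta>) *\<^sub>R hessian f (x (Suc k))"
    using loewner_scaleR_mono[OF 1, of "t * \<eta>"] t1 \<eta> by (simp add: t_def power2_eq_square mult_ac)
  finally (loewner_le_trans) show "corrected_G f M x G k \<preceq> ((correction f M x k)\<^sup>2 * \<eta>) *\<^sub>R hessian f (x (Suc k))"
    unfolding t_def .
qed

text \<open>The Loewner bound and the decay depend on each other, so one induction carries both: a
  step enlarges the upper factor by at most \<open>exp (2 M \<lambda>_k)\<close>, geometric decay
  bounds the sum of the \<lambda>_k, and decay holds while the factor stays close to
  \<open>\<eta>\<close>. The assumption \<open>update\<close> says that the rule preserves two-sided
  bounds, for whatever direction.\<close>

lemma quasi_newton_linear_rate: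
  fixes x :: "nat \<Rightarrow> real^'n"
  assumes points: "quasi_newton_points f x0 x G" and \<eta>: "1 \<le> \<eta>"
    and init: "hessian f x0 \<preceq> G 0" "G 0 \<preceq> \<eta> *\<^sub>R hessian f x0"
    and update: "\<And>k t. 1 \<le> t \<Longrightarrow> hessian f (x (Suc k)) \<preceq> corrected_G f M x G k \<Longrightarrow>
        corrected_G f M x G k \<preceq> t *\<^sub>R hessian f (x (Suc k)) \<Longrightarrow>
        hessian f (x (Suc k)) \<preceq> G (Suc k) \<and> G (Suc k) \<preceq> t *\<^sub>R hessian f (x (Suc k))"
    and small: "M * newton_decrement f x0 \<le> 1 / (20 * \<eta>)"
  shows "hessian f (x k) \<preceq> G k" and "G k \<preceq> (2 * \<eta>) *\<^sub>R hessian f (x k)"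
    and "newton_decrement f (x k) \<le> (1 - 1 / (2 * \<eta>)) ^ k * newton_decrement f x0"
proof -
  define l where "l = (\<lambda>k. newton_decrement f (x k))"
  define \<rho> where "\<rho> = 1 - 1 / (2 * \<eta>)"
  define S where "S = (\<lambda>k. \<Sum>i<k. l i)"
  have x0: "x 0 = x0" and x: "\<And>k. x (Suc k) = x k - matrix_inv (G k) *v grad f (x k)"
    using points by (auto simp: quasi_newton_points_def)
  have l: "0 \<le> l k" for k by (simp add: l_def newton_decrement_nonneg)
  have S: "0 \<le> S k" for k by (simp add: S_def sum_nonneg l)
  have \<rho>: "0 \<le> \<rho>" "\<rho> < 1" using \<eta> by (simp_all add: \<rho>_def)
  have Ml0: "M * l 0 \<le> 1 / (20 * \<eta>)" using small by (simp add: l_def x0)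
  have S_le: "2 * (M * S k) \<le> 1 / 5" if "\<forall>i<k. l i \<le> \<rho> ^ i * l 0" for k
  proof -
    \<comment> \<open>The geometric sum is at most \<open>2 * \<eta>\<close>, so the threshold
      \<open>1 / (20 * \<eta>)\<close> gives \<open>M * S k \<le> 1 / 10\<close>.\<close>
    have "S k \<le> (\<Sum>i<k. \<rho> ^ i * l 0)" unfolding S_def using that by (intro sum_mono) auto
    also have "\<dots> = (\<Sum>i<k. \<rho> ^ i) * l 0" by (simp add: sum_distrib_right)
    also have "\<dots> \<le> (1 / (1 - \<rho>)) * l 0"
      using l by (intro mult_right_mono geometric_sum_le \<rho>)
    also have "\<dots> = 2 * \<eta> * l 0" using \<eta> by (simp add: \<rho>_def)
    finally have "M * S k \<le> 2 * \<eta> * (M * l 0)" using M by (simp add: mult_left_mono)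
    also have "\<dots> \<le> 2 * \<eta> * (1 / (20 * \<eta>))" using Ml0 \<eta> by (intro mult_left_mono) auto
    also have "\<dots> = 1 / 10" using \<eta> by simp
    finally show ?thesis by simp
  qed
  have main: "hessian f (x k) \<preceq> G k \<and> G k \<preceq> (\<eta> * exp (2 * (M * S k))) *\<^sub>R hessian f (x k) \<and>
      (\<forall>i\<le>k. l i \<le> \<rho> ^ i * l 0)" for k
  proof (induction k)
    case 0
    then show ?case using init by (simp add: x0 S_def)
  next
    case (Suc k)
    define \<eta>' where "\<eta>' = \<eta> * exp (2 * (M * S k))"
    define r where "r = local_norm f (x k) (x (Suc k) - x k)"
    have HG: "hessian f (x k) \<preceq> G k" and G\<eta>: "G k \<preceq> \<eta>' *\<^sub>R hessian f (x k)"
      and lk: "\<And>i. i \<le> k \<Longrightarrow> l i \<le> \<rho> ^ i * l 0" using Suc by (auto simp: \<eta>'_def)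
    have MS: "0 \<le> 2 * (M * S k)" "2 * (M * S k) \<le> 1 / 5" using S_le[of k] lk M S by auto
    have \<eta>': "1 \<le> \<eta>'"
      using \<eta> MS mult_mono[of 1 \<eta> 1 "exp (2 * (M * S k))"] by (simp add: \<eta>'_def)
    have "l k \<le> 1 * l 0"
      using lk[of k] \<rho> l by (meson less_imp_le mult_right_mono order_refl order_trans power_le_one)
    then have "M * l k \<le> 1 / (20 * \<eta>)" using Ml0 M by (smt (verit) mult_left_mono)
    moreover have "0 \<le> r" "r \<le> l k"
      using newton_step(1)[OF HG G\<eta> \<eta>' x] by (simp_all add: r_def l_def local_norm_nonneg)
    ultimately have Mr: "0 \<le> M * r" "M * r \<le> 1 / (20 * \<eta>)"
      using M by (auto intro: order_trans[OF mult_left_mono])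
    have "1 / (20 * \<eta>) \<le> 1 / 20" using \<eta> by (simp add: field_simps)
    then have Mr': "M * r \<le> 1 / 20" using Mr by simp
    \<comment> \<open>Hence \<open>1 / \<eta>'\<close> is at least \<open>4 / (5 * \<eta>)\<close>,
      and with \<open>M * r \<le> 1 / (20 * \<eta>)\<close> the first entry of the maximum is at
      most \<open>1 - 3 / (4 * \<eta>)\<close>, which is below \<open>\<rho>\<close>.\<close>
    have "1 - 1 / 5 \<le> exp (- (2 * (M * S k)))"
      using exp_ge_add_one_self[of "- (2 * (M * S k))"] MS by simp
    then have "(1 - 1 / 5) / \<eta> \<le> exp (- (2 * (M * S k))) / \<eta>"
      using \<eta> by (intro divide_right_mono) auto
    also have "\<dots> = 1 / \<eta>'" by (simp add: \<eta>'_def exp_minus field_simps)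
    finally have "1 + M * r - 1 / \<eta>' \<le> 1 + 1 / (20 * \<eta>) - (4 / 5) / \<eta>" using Mr by simp
    also have "\<dots> \<le> \<rho>" using \<eta> by (simp add: \<rho>_def field_simps)
    finally have c1: "1 + M * r - 1 / \<eta>' \<le> \<rho>" .
    have "M * r * (1 + M * r) \<le> (1 / 20) * (1 + 1 / 20)" using Mr Mr' by (intro mult_mono) auto
    also have "\<dots> \<le> \<rho>"
    proof -
      have "1 / (2 * \<eta>) \<le> 1 / 2" using \<eta> by (simp add: field_simps)
      then show ?thesis by (simp add: \<rho>_def)
    qed
    finally have "max (1 + M * r - 1 / \<eta>') (M * r * (1 + M * r)) \<le> \<rho>" using c1 by simp
    then have "l (Suc k) \<le> \<rho> * l k"
      using newton_step(2)[OF HG G\<eta> \<eta>' x] l[of k] unfolding l_def r_def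
      by (meson mult_right_mono order_trans)
    also have "\<dots> \<le> \<rho> ^ Suc k * l 0"
      using lk[of k] \<rho> by (simp add: mult.assoc mult_left_mono)
    finally have lSuc: "l (Suc k) \<le> \<rho> ^ Suc k * l 0" .
    note cb = correction_bounds[where G = G and k = k, OF HG G\<eta> \<eta>' x]
    have "(correction f M x k)\<^sup>2 \<le> exp (2 * (M * l k))"
    proof -
      have "(correction f M x k)\<^sup>2 \<le> (1 + M * l k)\<^sup>2"
        using cb(1,2) by (intro power_mono) (auto simp: l_def)
      also have "\<dots> \<le> exp (2 * (M * l k))" using M l by (intro real_exp_ge_square) auto
      finally show ?thesis .
    qed
    then have "(correction f M x k)\<^sup>2 * \<eta>' \<le> exp (2 * (M * l k)) * \<eta>'"
      using \<eta>' by (intro mult_right_mono) auto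
    also have "\<dots> = \<eta> * exp (2 * (M * S (Suc k)))"
      by (simp add: \<eta>'_def S_def distrib_left exp_add mult_ac)
    finally have t_le: "(correction f M x k)\<^sup>2 * \<eta>' \<le> \<eta> * exp (2 * (M * S (Suc k)))" .
    have "1 \<le> (correction f M x k)\<^sup>2 * \<eta>'"
      using cb(1) \<eta>' by (metis mult_mono' mult.right_neutral one_le_power zero_le_one)
    from update[OF this cb(4,5)] have 1: "hessian f (x (Suc k)) \<preceq> G (Suc k)"
      and "G (Suc k) \<preceq> ((correction f M x k)\<^sup>2 * \<eta>') *\<^sub>R hessian f (x (Suc k))" by auto
    then have "G (Suc k) \<preceq> (\<eta> * exp (2 * (M * S (Suc k)))) *\<^sub>R hessian f (x (Suc k))"
      using loewner_scaleR_left_mono[OF posdef_hessian t_le] loewner_le_trans by blast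
    with 1 lk lSuc show ?case by (auto simp: le_Suc_eq)
  qed
  then show "hessian f (x k) \<preceq> G k"
    and "newton_decrement f (x k) \<le> (1 - 1 / (2 * \<eta>)) ^ k * newton_decrement f x0"
    by (auto simp: l_def \<rho>_def x0)
  have "exp (2 * (M * S k)) \<le> 2"
  proof -
    have "exp (2 * (M * S k)) \<le> exp (1 / 5)" using S_le[of k] main[of k] by simp
    also have "\<dots> \<le> 2" using exp_bound[of "1/5"] by (simp add: power2_eq_square)
    finally show ?thesis .
  qed
  then have "(\<eta> * exp (2 * (M * S k))) *\<^sub>R hessian f (x k) \<preceq> (2 * \<eta>) *\<^sub>R hessian f (x k)"
    using \<eta> by (intro loewner_scaleR_left_mono posdef_hessian) auto
  then show "G k \<preceq> (2 * \<eta>) *\<^sub>R hessian f (x k)"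
    using main[of k] loewner_le_trans by blast
qed

text \<open>Here \<open>newton_step\<close> is applied with \<open>1 + D\<close> in the role of
  \<open>\<eta>\<close>, where \<open>D\<close> is the current gap; this couples the decay of the
  Newton decrement to the gap. The second part stops before the update: applying the rule then only
  adds the shortfall of the direction.\<close>

lemma potential_step:
  fixes x :: "nat \<Rightarrow> real^'n"
  assumes x: "x (Suc k) = x k - matrix_inv (G k) *v grad f (x k)"
    and HG: "hessian f (x k) \<preceq> G k"
    and c: "c = (case upd of BFGS \<Rightarrow> 1 | SR1 \<Rightarrow> L / \<mu>)"
    and d: "d = real CARD('n)" "2 \<le> d"
    and small: "M * newton_decrement f (x k) \<le> 1"
  defines "\<theta> \<equiv> gap upd \<mu> (hessian f (x k)) (G k) + 2 * c * d * (M * newton_decrement f (x k))"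
  shows "newton_decrement f (x (Suc k)) \<le> \<theta> * newton_decrement f (x k)"
    and "(1 - 1 / d) * gap upd \<mu> (hessian f (x (Suc k))) (corrected_G f M x G k)
      + 2 * c * d * (M * newton_decrement f (x (Suc k)))
      \<le> (1 - 1 / d) * exp (2 * (2 * c * d + 1) * (M * newton_decrement f (x k))) * \<theta>"
proof -
  define D where "D = gap upd \<mu> (hessian f (x k)) (G k)"
  define m where "m = M * newton_decrement f (x k)"
  define C where "C = 2 * c * d"
  define t where "t = correction f M x k"
  define r where "r = local_norm f (x k) (x (Suc k) - x k)"
  have H: "posdef (hessian f z)" for z by (rule posdef_hessian)
  have D: "0 \<le> D" unfolding D_def by (intro gap_nonneg H HG \<mu>)
  have GD: "G k \<preceq> (1 + D) *\<^sub>R hessian f (x k)"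
    unfolding D_def by (intro loewner_gap H HG \<mu> hessian_lower)
  have D1: "1 \<le> 1 + D" using D by simp
  note cb = correction_bounds[where G = G and k = k, OF HG GD D1 x]
  have m: "0 \<le> m" using M newton_decrement_nonneg by (simp add: m_def)
  have "1 \<le> c" using c condition_number_ge_1 by (cases upd) auto
  then have "2 \<le> c * d" using d(2) mult_mono[of 1 c 2 d] by simp
  then have C: "4 \<le> C" by (simp add: C_def)
  have t: "t = 1 + M * r" "1 \<le> t" "t \<le> 1 + m"
    using cb(1,2) by (simp_all add: t_def m_def r_def correction_def)
  have \<theta>: "\<theta> = D + C * m" by (simp add: \<theta>_def D_def C_def m_def)
  have \<theta>0: "0 \<le> \<theta>" using D C m by (simp add: \<theta>)
  have "1 + M * r - 1 / (1 + D) \<le> \<theta>"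
  proof -
    have "1 - 1 / (1 + D) \<le> D" using D by (simp add: field_simps)
    moreover have "M * r \<le> C * m" using t C m mult_mono[of 1 C m m] by simp
    ultimately show ?thesis by (simp add: \<theta>)
  qed
  moreover have "M * r * (1 + M * r) \<le> \<theta>"
  proof -
    have "M * r * (1 + M * r) \<le> m * (1 + m)" using t by (intro mult_mono) auto
    also have "\<dots> \<le> m * 2" using small m by (intro mult_left_mono) (auto simp: m_def)
    also have "\<dots> \<le> C * m" using C m by (metis mult.commute mult_right_mono order_trans numeral_le_iff semiring_norm(68) semiring_norm(71) semiring_norm(69))
    finally show ?thesis using D by (simp add: \<theta>)
  qed
  ultimately have "max (1 + M * r - 1 / (1 + D)) (M * r * (1 + M * r)) \<le> \<theta>" by simp
  then show lam: "newton_decrement f (x (Suc k)) \<le> \<theta> * newton_decrement f (x k)"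
    using newton_step(2)[OF HG GD D1 x] newton_decrement_nonneg unfolding r_def
    by (meson mult_right_mono order_trans)
  have q: "1 / 2 \<le> 1 - 1 / d" using d(2) by (simp add: field_simps)
  have "gap upd \<mu> (hessian f (x (Suc k))) (t *\<^sub>R G k) \<le> t\<^sup>2 * (D + 2 * c * real CARD('n) * (t - 1))"
    unfolding D_def using cb(3) t by (intro gap_correct[where L = L] H HG \<mu> L hessian_upper c) (auto simp: t_def)
  also have "\<dots> \<le> (1 + m)\<^sup>2 * \<theta>"
  proof (intro mult_mono power_mono)
    show "D + 2 * c * real CARD('n) * (t - 1) \<le> \<theta>"
      using t C by (simp add: \<theta> C_def d(1)[symmetric] mult_left_mono)
    show "0 \<le> D + 2 * c * real CARD('n) * (t - 1)"
      using D t C by (simp add: C_def d(1)[symmetric])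
  qed (use t in auto)
  finally have 1: "(1 - 1 / d) * gap upd \<mu> (hessian f (x (Suc k))) (t *\<^sub>R G k) \<le> (1 - 1 / d) * ((1 + m)\<^sup>2 * \<theta>)"
    using q by (intro mult_left_mono) auto
  have "M * newton_decrement f (x (Suc k)) \<le> m * \<theta>"
    using lam M by (simp add: m_def mult_ac mult_left_mono)
  then have "C * (M * newton_decrement f (x (Suc k))) \<le> C * (m * \<theta>)"
    using C by (intro mult_left_mono) auto
  also have "\<dots> = (1 / 2) * (2 * C * m * \<theta>)" by simp
  \<comment> \<open>The decrement term does not contract by itself; for \<open>d \<ge> 2\<close> the
    factor \<open>1 - 1 / d\<close> is at least one half and can be extracted at the price of
    doubling the term.\<close>
  also have "\<dots> \<le> (1 - 1 / d) * (2 * C * m * \<theta>)"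
    using q C m \<theta>0 by (intro mult_right_mono) auto
  finally have "(1 - 1 / d) * gap upd \<mu> (hessian f (x (Suc k))) (t *\<^sub>R G k)
      + C * (M * newton_decrement f (x (Suc k))) \<le> (1 - 1 / d) * (((1 + m)\<^sup>2 + 2 * C * m) * \<theta>)"
    using 1 by (simp add: algebra_simps)
  also have "\<dots> \<le> (1 - 1 / d) * (exp (2 * (C + 1) * m) * \<theta>)"
  proof (intro mult_left_mono mult_right_mono)
    \<comment> \<open>Turning the sum into a product lets both costs enter one exponential; its
      exponent \<open>2 (C + 1) m\<close> is the source of \<open>2cd + 1\<close> in the starting
      condition.\<close>
    have "(1 + m)\<^sup>2 + 2 * C * m \<le> (1 + m)\<^sup>2 * (1 + 2 * C * m)"
    proof -
      have "1 \<le> (1 + m)\<^sup>2" using m by simp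
      then have "1 * (2 * C * m) \<le> (1 + m)\<^sup>2 * (2 * C * m)" using C m by (intro mult_right_mono) auto
      then show ?thesis by (simp add: distrib_left)
    qed
    also have "\<dots> \<le> exp (2 * m) * exp (2 * C * m)"
      using m C by (intro mult_mono real_exp_ge_square) auto
    also have "\<dots> = exp (2 * (C + 1) * m)" by (simp add: algebra_simps flip: exp_add)
    finally show "(1 + m)\<^sup>2 + 2 * C * m \<le> exp (2 * (C + 1) * m)" .
  qed (use q \<theta>0 in auto)
  finally show "(1 - 1 / d) * gap upd \<mu> (hessian f (x (Suc k))) (corrected_G f M x G k)
      + 2 * c * d * (M * newton_decrement f (x (Suc k)))
      \<le> (1 - 1 / d) * exp (2 * (2 * c * d + 1) * (M * newton_decrement f (x k))) * \<theta>"
    by (simp add: C_def m_def t_def corrected_G_def mult.assoc)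
qed

end

section \<open>Second moments of the uniform distribution on the sphere\<close>

lemma borel_measurable_vec_nth [measurable (raw)]:
  fixes g :: "'a \<Rightarrow> ('b::topological_space)^'n"
  assumes "g \<in> borel_measurable M"
  shows "(\<lambda>x. g x $ i) \<in> borel_measurable M"
  by (rule borel_measurable_continuous_on[OF _ assms]) (intro continuous_intros)

lemma Basis_real_vec: "(Basis :: (real^'n) set) = range (\<lambda>i. axis i 1)"
  by (auto simp: Basis_vec_def)

lemma prod_Basis_real_vec: "(\<Prod>b\<in>(Basis :: (real^'n) set). g b) = (\<Prod>i\<in>UNIV. g (axis i 1))"
proof -
  have "inj (\<lambda>i::'n. axis i (1::real))" by (auto simp: inj_def axis_eq_axis)
  then show ?thesis by (simp add: Basis_real_vec prod.reindex)
qed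

text \<open>Checked on boxes: permuting coordinates only reorders the side lengths in the
  volume.\<close>

lemma lborel_permute:
  fixes p :: "'n::finite \<Rightarrow> 'n"
  assumes p: "bij p"
  shows "distr lborel borel (\<lambda>x::real^'n. \<chi> k. x $ p k) = lborel"
proof (rule lborel_eqI[symmetric])
  let ?T = "\<lambda>x::real^'n. \<chi> k. x $ p k"
  have T [measurable]: "?T \<in> borel \<rightarrow>\<^sub>M borel"
    by (intro borel_measurable_continuous_onI continuous_intros)
  fix l u :: "real^'n" assume le: "\<And>b. b \<in> Basis \<Longrightarrow> l \<bullet> b \<le> u \<bullet> b"
  have le': "l $ k \<le> u $ k" for k using le[of "axis k 1"] by (simp add: inner_axis)
  define l' u' where "l' = (\<chi> k. l $ (inv p k))" and "u' = (\<chi> k. u $ (inv p k))"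
  have pinv: "p (inv p k) = k" "inv p (p k) = k" for k
    using p by (simp_all add: bij_is_surj surj_f_inv_f bij_is_inj)
  have "?T -` box l u = box l' u'"
    unfolding l'_def u'_def by (auto simp: mem_box_cart) (metis pinv)+
  then have "emeasure (distr lborel borel ?T) (box l u) = emeasure lborel (box l' u')"
    by (simp add: emeasure_distr)
  also have "\<dots> = (\<Prod>b\<in>Basis. (u' - l') \<bullet> b)"
    using le' by (intro emeasure_lborel_box) (auto simp: Basis_real_vec inner_axis l'_def u'_def)
  also have "(\<Prod>b\<in>Basis. (u' - l') \<bullet> b) = (\<Prod>k\<in>UNIV. (u - l) $ (inv p k))"
    by (simp add: prod_Basis_real_vec inner_axis l'_def u'_def)
  also have "\<dots> = (\<Prod>k\<in>UNIV. (u - l) $ k)"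
    using bij_imp_bij_inv[OF p] by (rule prod.reindex_bij_betw)
  also have "\<dots> = (\<Prod>b\<in>Basis. (u - l) \<bullet> b)"
    by (simp add: prod_Basis_real_vec inner_axis)
  finally show "emeasure (distr lborel borel ?T) (box l u) = (\<Prod>b\<in>Basis. (u - l) \<bullet> b)" .
qed simp

text \<open>An affine substitution whose coordinate factors have absolute value 1.\<close>

lemma lborel_sign_change:
  fixes \<sigma> :: "'n::finite \<Rightarrow> real"
  assumes \<sigma>: "\<And>k. \<bar>\<sigma> k\<bar> = 1"
  shows "distr lborel borel (\<lambda>x::real^'n. \<chi> k. \<sigma> k * x $ k) = lborel"
proof -
  define c where "c = (\<lambda>b::real^'n. (\<chi> k. \<sigma> k) \<bullet> b)"
  have c: "\<bar>c b\<bar> = 1" if "b \<in> Basis" for b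
    using that \<sigma> by (auto simp: Basis_real_vec c_def inner_axis)
  have T: "(\<lambda>x::real^'n. \<chi> k. \<sigma> k * x $ k) = (\<lambda>x. 0 + (\<Sum>j\<in>Basis. (c j * (x \<bullet> j)) *\<^sub>R j))"
  proof
    fix x :: "real^'n"
    have inj: "inj (\<lambda>i::'n. axis i (1::real))" by (auto simp: inj_def axis_eq_axis)
    have "(\<Sum>j\<in>Basis. (c j * (x \<bullet> j)) *\<^sub>R j) = (\<Sum>i\<in>UNIV. (\<sigma> i * x $ i) *\<^sub>R axis i 1)"
      using inj by (simp add: Basis_real_vec sum.reindex c_def inner_axis)
    also have "\<dots> = (\<chi> k. \<sigma> k * x $ k)"
      by (simp add: vec_eq_iff axis_def if_distrib sum.delta cong: if_cong)
    finally show "(\<chi> k. \<sigma> k * x $ k) = 0 + (\<Sum>j\<in>Basis. (c j * (x \<bullet> j)) *\<^sub>R j)" by simp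
  qed
  have "lborel = density (distr lborel borel (\<lambda>x::real^'n. 0 + (\<Sum>j\<in>Basis. (c j * (x \<bullet> j)) *\<^sub>R j)))
      (\<lambda>_. (\<Prod>j\<in>Basis. \<bar>c j\<bar>))"
    using c by (intro lborel_affine_euclidean) force
  then have "lborel = density (distr lborel borel (\<lambda>x::real^'n. \<chi> k. \<sigma> k * x $ k)) (\<lambda>_. ennreal 1)"
    unfolding T[symmetric] using c by simp
  then show ?thesis by (simp add: density_1)
qed

text \<open>Such a \<open>T\<close> preserves the uniform measure on the ball and commutes with the
  radial projection \<open>sgn\<close>, so it preserves the image measure.\<close>

lemma distr_unif_sphere:
  fixes T :: "real^'n \<Rightarrow> real^'n"
  assumes T [measurable]: "T \<in> borel \<rightarrow>\<^sub>M borel" and lborel: "distr lborel borel T = lborel"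
    and norm: "\<And>x. norm (T x) = norm x" and scale: "\<And>c x. T (c *\<^sub>R x) = c *\<^sub>R T x"
  shows "distr unif_sphere borel T = unif_sphere"
proof -
  let ?U = "uniform_measure lborel (ball (0::real^'n) 1)"
  have "distr ?U borel T = ?U"
  proof (rule measure_eqI)
    fix X assume "X \<in> sets (distr ?U borel T)"
    then have X [measurable]: "X \<in> sets borel" by simp
    have "ball 0 1 \<inter> T -` X = T -` (ball 0 1 \<inter> X)" by (auto simp: norm)
    moreover have "emeasure lborel (T -` (ball 0 1 \<inter> X)) = emeasure (distr lborel borel T) (ball 0 1 \<inter> X)"
      by (subst emeasure_distr) auto
    moreover have "T -` X \<in> sets borel" using measurable_sets[OF T X] by simp
    ultimately show "emeasure (distr ?U borel T) X = emeasure ?U X"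
      by (subst emeasure_distr) (simp_all add: lborel)
  qed simp
  moreover have "T \<circ> sgn = sgn \<circ> T"
    by (simp add: fun_eq_iff sgn_div_norm norm scale)
  moreover have "distr (distr ?U borel sgn) borel T = distr ?U borel (T \<circ> sgn)"
    by (rule distr_distr) auto
  moreover have "distr (distr ?U borel T) borel sgn = distr ?U borel (sgn \<circ> T)"
    by (rule distr_distr) auto
  ultimately show ?thesis by (simp add: unif_sphere_def)
qed

lemma sets_unif_sphere [simp, measurable_cong]: "sets unif_sphere = sets borel"
  by (simp add: unif_sphere_def)

lemma integrable_unif_sphere_product:
  "integrable unif_sphere (\<lambda>u::real^'n. u $ i * u $ j)"
proof -
  interpret prob_space "unif_sphere :: (real^'n) measure" by (rule prob_space_unif_sphere)
  show ?thesis
  proof (rule integrable_const_bound[where B=1])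
    show "AE u in (unif_sphere :: (real^'n) measure). norm (u $ i * u $ j) \<le> 1"
      using AE_unif_sphere
    proof eventually_elim
      case (elim u)
      then have "norm u = 1" by simp
      then have "\<bar>u $ i\<bar> \<le> 1" "\<bar>u $ j\<bar> \<le> 1"
        using component_le_norm_cart[of u] by auto
      then show ?case by (simp add: abs_mult mult_le_one)
    qed
  qed measurable
qed

text \<open>Flipping the sign of one coordinate reverses a mixed moment; swapping coordinates makes
  all squares have equal mean, and the squares sum to 1 almost everywhere.\<close>

lemma unif_sphere_second_moment:
  "(\<integral>u. u $ i * u $ j \<partial>(unif_sphere :: (real^'n) measure)) = (if i = j then 1 / real CARD('n) else 0)"
proof -
  interpret prob_space "unif_sphere :: (real^'n) measure" by (rule prob_space_unif_sphere)
  let ?E = "\<lambda>g. (\<integral>u. g u \<partial>(unif_sphere :: (real^'n) measure))"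
  have invariant: "?E (\<lambda>u. g (T u)) = ?E g"
    if "T \<in> borel \<rightarrow>\<^sub>M borel" "g \<in> borel_measurable borel" "distr unif_sphere borel T = unif_sphere"
    for g :: "real^'n \<Rightarrow> real" and T
  proof -
    have "T \<in> unif_sphere \<rightarrow>\<^sub>M borel" using that(1) by simp
    from integral_distr[OF this that(2)] that(3) show ?thesis by simp
  qed
  show ?thesis
  proof (cases "i = j")
    case False
    define \<sigma> :: "'n \<Rightarrow> real" where "\<sigma> = (\<lambda>k. if k = i then -1 else 1)"
    let ?T = "\<lambda>x::real^'n. \<chi> k. \<sigma> k * x $ k"
    have T: "?T \<in> borel \<rightarrow>\<^sub>M borel"
      by (intro borel_measurable_continuous_onI continuous_intros)
    have "distr unif_sphere borel ?T = unif_sphere"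
    proof (rule distr_unif_sphere[OF T])
      show "distr lborel borel ?T = lborel" by (rule lborel_sign_change) (simp add: \<sigma>_def)
      show "norm (?T x) = norm x" for x
      proof -
        have "(\<sigma> k)\<^sup>2 = 1" for k by (simp add: \<sigma>_def)
        then show ?thesis by (simp add: norm_vec_def L2_set_def power_mult_distrib)
      qed
    qed (simp add: vec_eq_iff)
    from invariant[OF T _ this, of "\<lambda>u. u $ i * u $ j"]
    have "?E (\<lambda>u. - (u $ i * u $ j)) = ?E (\<lambda>u. u $ i * u $ j)" using False by (simp add: \<sigma>_def)
    then show ?thesis using False by simp
  next
    case True
    have eq: "?E (\<lambda>u. u $ k * u $ k) = ?E (\<lambda>u. u $ i * u $ i)" for k
    proof -
      define p where "p = (\<lambda>m. if m = i then k else if m = k then i else m)"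
      have "p \<circ> p = id" by (auto simp: p_def)
      then have p: "bij p" by (metis o_bij)
      let ?T = "\<lambda>x::real^'n. \<chi> m. x $ p m"
      have T: "?T \<in> borel \<rightarrow>\<^sub>M borel"
        by (intro borel_measurable_continuous_onI continuous_intros)
      have "distr unif_sphere borel ?T = unif_sphere"
      proof (rule distr_unif_sphere[OF T])
        show "distr lborel borel ?T = lborel" by (rule lborel_permute[OF p])
        show "norm (?T x) = norm x" for x
          using sum.reindex_bij_betw[OF p, of "\<lambda>m. (x $ m)\<^sup>2"] by (simp add: norm_vec_def L2_set_def)
      qed (simp add: vec_eq_iff)
      from invariant[OF T _ this, of "\<lambda>u. u $ i * u $ i"] show ?thesis by (simp add: p_def)
    qed
    have "real CARD('n) * ?E (\<lambda>u. u $ i * u $ i) = (\<Sum>k\<in>(UNIV::'n set). ?E (\<lambda>u. u $ k * u $ k))"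
    proof -
      have "(\<Sum>k\<in>(UNIV::'n set). ?E (\<lambda>u. u $ k * u $ k)) = (\<Sum>k\<in>(UNIV::'n set). ?E (\<lambda>u. u $ i * u $ i))"
        by (intro sum.cong refl eq)
      then show ?thesis by simp
    qed
    also have "\<dots> = ?E (\<lambda>u. \<Sum>k\<in>UNIV. u $ k * u $ k)"
      by (subst Bochner_Integration.integral_sum) (simp_all add: integrable_unif_sphere_product)
    also have "\<dots> = ?E (\<lambda>u. 1)"
    proof (rule integral_cong_AE)
      show "AE u in (unif_sphere :: (real^'n) measure). (\<Sum>k\<in>UNIV. u $ k * u $ k) = 1"
        using AE_unif_sphere
      proof eventually_elim
        case (elim u)
        then have "norm u = 1" by simp
        then show ?case by (simp add: norm_eq_1 inner_vec_def)
      qed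
    qed measurable
    finally show ?thesis using True by (simp add: prob_space field_simps)
  qed
qed

lemma inner_mult_vec_sum: "w \<bullet> (B *v w) = (\<Sum>i\<in>UNIV. \<Sum>j\<in>UNIV. B $ i $ j * (w $ i * w $ j))"
  for B :: "real^'n^'n"
  by (simp add: inner_vec_def matrix_vector_mult_def sum_distrib_left mult_ac)

text \<open>Lets a bound on the trace alone make every entry of a random matrix integrable.\<close>

lemma psd_entry_le:
  fixes B :: "real^'n^'n"
  assumes B: "psd B"
  shows "\<bar>B $ i $ j\<bar> \<le> trace B"
proof -
  have e: "axis i 1 \<bullet> (B *v axis j 1) = B $ i $ j" for i j
    by (simp add: inner_axis' matrix_vector_mult_basis column_def)
  have nn: "0 \<le> B $ i $ i" for i using B e[of i i] by (metis psd_def)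
  have le: "B $ i $ i \<le> trace B" for i
    unfolding trace_def using nn by (intro member_le_sum) auto
  have "\<bar>B $ i $ j\<bar> \<le> sqrt (B $ i $ i) * sqrt (B $ j $ j)"
    using psd_Cauchy_Schwarz[OF B, of "axis i 1" "axis j 1"] by (simp add: e)
  also have "\<dots> \<le> sqrt (trace B) * sqrt (trace B)"
    using nn le by (intro mult_mono real_sqrt_le_mono) (auto intro: order_trans)
  also have "\<dots> = trace B" using nn[of i] le[of i] by simp
  finally show ?thesis .
qed

text \<open>\<open>N\<close> carries the information available before \<open>w\<close> is drawn.
  Instead of conditioning on it, the form is expanded entrywise: each \<open>B $ i $ j\<close> is
  independent of the product of the coordinates \<open>i\<close> and \<open>j\<close> of
  \<open>w\<close>, so the expectations factor and the second moments leave only the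
  diagonal.\<close>

lemma (in prob_space) expectation_quadratic_form:
  fixes B :: "'a \<Rightarrow> real^'n^'n" and w :: "'a \<Rightarrow> real^'n"
  assumes N: "space N = space M" and B: "B \<in> borel_measurable N"
    and indep: "indep_set (sets N) (sets (vimage_algebra (space M) w borel))"
    and w [measurable]: "w \<in> borel_measurable M" and unif: "distr M borel w = unif_sphere"
    and psd: "\<And>\<omega>. \<omega> \<in> space M \<Longrightarrow> psd (B \<omega>)"
    and K: "\<And>\<omega>. \<omega> \<in> space M \<Longrightarrow> trace (B \<omega>) \<le> K"
  shows "integrable M (\<lambda>\<omega>. w \<omega> \<bullet> (B \<omega> *v w \<omega>))"
    and "integrable M (\<lambda>\<omega>. trace (B \<omega>))"
    and "expectation (\<lambda>\<omega>. w \<omega> \<bullet> (B \<omega> *v w \<omega>)) = expectation (\<lambda>\<omega>. trace (B \<omega>)) / real CARD('n)"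
proof -
  have NM: "sets N \<subseteq> sets M" by (rule indep_setD_ev1[OF indep])
  have BM [measurable]: "B \<in> borel_measurable M"
    using B NM N by (auto simp: measurable_def)
  have int_B: "integrable M (\<lambda>\<omega>. B \<omega> $ i $ j)" for i j
    using psd_entry_le[OF psd] K
    by (intro integrable_const_bound[where B = K] AE_I2) (force intro: order_trans)+
  then show "integrable M (\<lambda>\<omega>. trace (B \<omega>))" by (simp add: trace_def)
  have int_w: "integrable M (\<lambda>\<omega>. w \<omega> $ i * w \<omega> $ j)"
    and mom_w: "expectation (\<lambda>\<omega>. w \<omega> $ i * w \<omega> $ j) = (if i = j then 1 / real CARD('n) else 0)" for i j
    using integrable_unif_sphere_product[of i j] unif_sphere_second_moment[of i j]
    unfolding unif[symmetric] by (simp_all add: integrable_distr_eq integral_distr)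
  have "indep_var borel (\<lambda>\<omega>. B \<omega> $ i $ j) borel (\<lambda>\<omega>. w \<omega> $ i * w \<omega> $ j)" for i j
    unfolding indep_var_eq
  proof (intro conjI)
    have Bij: "(\<lambda>\<omega>. B \<omega> $ i $ j) \<in> borel_measurable N" using B by measurable
    have "sigma_sets (space M) {(\<lambda>\<omega>. B \<omega> $ i $ j) -` A \<inter> space M |A. A \<in> sets borel} \<subseteq> sets N"
      using measurable_sets[OF Bij] N by (subst N[symmetric], intro sets.sigma_sets_subset) auto
    moreover have "sigma_sets (space M) {(\<lambda>\<omega>. w \<omega> $ i * w \<omega> $ j) -` A \<inter> space M |A. A \<in> sets borel}
        \<subseteq> sets (vimage_algebra (space M) w borel)"
    proof -
      let ?V = "vimage_algebra (space M) w borel"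
      have "w \<in> ?V \<rightarrow>\<^sub>M borel" by (rule measurable_vimage_algebra1) auto
      then have "(\<lambda>\<omega>. w \<omega> $ i * w \<omega> $ j) \<in> borel_measurable ?V" by measurable
      from measurable_sets[OF this]
      have "{(\<lambda>\<omega>. w \<omega> $ i * w \<omega> $ j) -` A \<inter> space M |A. A \<in> sets borel} \<subseteq> sets ?V" by auto
      from sets.sigma_sets_subset[OF this] show ?thesis by simp
    qed
    ultimately show "indep_set
        (sigma_sets (space M) {(\<lambda>\<omega>. B \<omega> $ i $ j) -` A \<inter> space M |A. A \<in> sets borel})
        (sigma_sets (space M) {(\<lambda>\<omega>. w \<omega> $ i * w \<omega> $ j) -` A \<inter> space M |A. A \<in> sets borel})"
      using indep unfolding indep_sets2_eq by blast
  qed measurable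
  from indep_var_integrable[OF this int_B int_w] indep_var_lebesgue_integral[OF this int_B int_w]
  have int: "integrable M (\<lambda>\<omega>. B \<omega> $ i $ j * (w \<omega> $ i * w \<omega> $ j))"
    and eq: "expectation (\<lambda>\<omega>. B \<omega> $ i $ j * (w \<omega> $ i * w \<omega> $ j))
      = expectation (\<lambda>\<omega>. B \<omega> $ i $ j) * (if i = j then 1 / real CARD('n) else 0)" for i j
    by (simp_all add: mom_w)
  show "integrable M (\<lambda>\<omega>. w \<omega> \<bullet> (B \<omega> *v w \<omega>))"
    unfolding inner_mult_vec_sum by (intro Bochner_Integration.integrable_sum int)
  have "expectation (\<lambda>\<omega>. w \<omega> \<bullet> (B \<omega> *v w \<omega>))
      = (\<Sum>i\<in>UNIV. \<Sum>j\<in>UNIV. expectation (\<lambda>\<omega>. B \<omega> $ i $ j) * (if i = j then 1 / real CARD('n) else 0))"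
    unfolding inner_mult_vec_sum by (simp add: int eq)
  also have "\<dots> = (\<Sum>i\<in>UNIV. expectation (\<lambda>\<omega>. B \<omega> $ i $ i)) / real CARD('n)"
    by (simp add: if_distrib sum.delta sum_divide_distrib cong: if_cong)
  also have "(\<Sum>i\<in>UNIV. expectation (\<lambda>\<omega>. B \<omega> $ i $ i)) = expectation (\<lambda>\<omega>. trace (B \<omega>))"
    unfolding trace_def by (simp add: int_B)
  finally show "expectation (\<lambda>\<omega>. w \<omega> \<bullet> (B \<omega> *v w \<omega>)) = expectation (\<lambda>\<omega>. trace (B \<omega>)) / real CARD('n)" .
qed

section \<open>Measurability\<close>

lemma borel_measurable_vec_lambda [measurable (raw)]:
  fixes g :: "'a \<Rightarrow> 'n::finite \<Rightarrow> 'b::euclidean_space"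
  assumes g: "\<And>i. (\<lambda>x. g x i) \<in> borel_measurable M"
  shows "(\<lambda>x. \<chi> i. g x i) \<in> borel_measurable M"
proof -
  have "(\<lambda>x. (\<chi> i. g x i) \<bullet> b) \<in> borel_measurable M" if b: "b \<in> Basis" for b :: "'b^'n"
  proof -
    obtain i u where "b = axis i u" using b by (auto simp: Basis_vec_def)
    then show ?thesis using g[of i] by (simp add: inner_axis)
  qed
  then show ?thesis using borel_measurable_euclidean_space by blast
qed

lemma borel_measurable_matrix_mult [measurable (raw)]:
  fixes A B :: "'a \<Rightarrow> real^'n^'n"
  assumes [measurable]: "A \<in> borel_measurable M" "B \<in> borel_measurable M"
  shows "(\<lambda>x. A x ** B x) \<in> borel_measurable M"
  unfolding matrix_matrix_mult_def by measurable

lemma borel_measurable_matrix_vector_mult [measurable (raw)]: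
  fixes A :: "'a \<Rightarrow> real^'n^'n"
  assumes [measurable]: "A \<in> borel_measurable M" "u \<in> borel_measurable M"
  shows "(\<lambda>x. A x *v u x) \<in> borel_measurable M"
  unfolding matrix_vector_mult_def by measurable

lemma borel_measurable_outer [measurable (raw)]:
  fixes u v :: "'a \<Rightarrow> real^'n"
  assumes [measurable]: "u \<in> borel_measurable M" "v \<in> borel_measurable M"
  shows "(\<lambda>x. outer (u x) (v x)) \<in> borel_measurable M"
  unfolding outer_def by measurable

lemma borel_measurable_matrix_functions [measurable (raw)]:
  fixes A :: "'a \<Rightarrow> real^'n^'n"
  assumes [measurable]: "A \<in> borel_measurable M"
  shows "(\<lambda>x. transpose (A x)) \<in> borel_measurable M"
    and "(\<lambda>x. trace (A x)) \<in> borel_measurable M"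
    and "(\<lambda>x. det (A x)) \<in> borel_measurable M"
  unfolding transpose_def trace_def det_def by measurable

text \<open>Writes the entries as quotients of determinants, whose measurability is
  immediate.\<close>

lemma matrix_inv_cramer:
  fixes A :: "real^'n^'n"
  assumes "det A \<noteq> 0"
  shows "matrix_inv A = (\<chi> k m. det (\<chi> i j. if j = k then (if i = m then 1 else 0) else A $ i $ j) / det A)"
proof -
  have inv: "invertible A" using assms by (simp add: invertible_det_nz)
  have "matrix_inv A $ k $ m = det (\<chi> i j. if j = k then (if i = m then 1 else 0) else A $ i $ j) / det A" for k m
  proof -
    define b where "b = (axis m 1 :: real^'n)"
    have "A *v (matrix_inv A *v b) = b"
      using inv by (simp add: matrix_vector_mul_assoc matrix_inv_right)
    then have "matrix_inv A *v b = (\<chi> k. det (\<chi> i j. if j = k then b $ i else A $ i $ j) / det A)"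
      using cramer[OF assms] by blast
    then have "(matrix_inv A *v b) $ k = det (\<chi> i j. if j = k then b $ i else A $ i $ j) / det A" by simp
    moreover have "(matrix_inv A *v b) $ k = matrix_inv A $ k $ m"
      by (simp add: b_def matrix_vector_mult_basis column_def)
    moreover have bi: "b $ i = (if i = m then 1 else 0)" for i by (simp add: b_def axis_def)
    ultimately show ?thesis unfolding bi by simp
  qed
  then show ?thesis by (simp add: vec_eq_iff)
qed

text \<open>For a singular matrix, \<^const>\<open>matrix_inv\<close> selects from an empty set, so its value is
  a constant.\<close>

lemma borel_measurable_matrix_inv [measurable (raw)]:
  fixes A :: "'a \<Rightarrow> real^'n^'n"
  assumes [measurable]: "A \<in> borel_measurable M"
  shows "(\<lambda>x. matrix_inv (A x)) \<in> borel_measurable M"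
proof -
  define C where "C = (SOME B :: real^'n^'n. False)"
  have "matrix_inv X = C" if "det X = 0" for X :: "real^'n^'n"
  proof -
    have "\<not> invertible X" using that by (simp add: invertible_det_nz)
    then have "(\<lambda>B. X ** B = mat 1 \<and> B ** X = mat 1) = (\<lambda>B. False)" by (auto simp: invertible_def)
    then show ?thesis unfolding matrix_inv_def C_def by (rule arg_cong)
  qed
  then have eq: "matrix_inv (A x) = (if det (A x) = 0 then C
      else (\<chi> k m. det (\<chi> i j. if j = k then (if i = m then 1 else 0) else A x $ i $ j) / det (A x)))" for x
    using matrix_inv_cramer[of "A x"] by simp
  show ?thesis unfolding eq by measurable
qed

lemma borel_measurable_sr1_update [measurable (raw)]:
  fixes G A :: "'a \<Rightarrow> real^'n^'n"
  assumes [measurable]: "G \<in> borel_measurable M" "A \<in> borel_measurable M" "u \<in> borel_measurable M"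
  shows "(\<lambda>x. sr1_update (G x) (A x) (u x)) \<in> borel_measurable M"
  unfolding sr1_update_def by measurable

lemma borel_measurable_bfgs_update [measurable (raw)]:
  fixes G A :: "'a \<Rightarrow> real^'n^'n"
  assumes [measurable]: "G \<in> borel_measurable M" "A \<in> borel_measurable M" "u \<in> borel_measurable M"
  shows "(\<lambda>x. bfgs_update (G x) (A x) (u x)) \<in> borel_measurable M"
  unfolding bfgs_update_def by measurable

lemma borel_measurable_bfgs_factor_update [measurable (raw)]:
  fixes F A :: "'a \<Rightarrow> real^'n^'n"
  assumes [measurable]: "F \<in> borel_measurable M" "A \<in> borel_measurable M"
    "u \<in> borel_measurable M" "w \<in> borel_measurable M"
  shows "(\<lambda>x. bfgs_factor_update (F x) (A x) (u x) (w x)) \<in> borel_measurable M"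
  unfolding bfgs_factor_update_def Let_def by measurable

lemma borel_measurable_gap [measurable (raw)]:
  fixes A G :: "'a \<Rightarrow> real^'n^'n"
  assumes [measurable]: "A \<in> borel_measurable M" "G \<in> borel_measurable M"
  shows "(\<lambda>x. gap upd \<mu> (A x) (G x)) \<in> borel_measurable M"
  by (cases upd) simp_all

lemma borel_measurable_qn_update:
  fixes A G F :: "'a \<Rightarrow> real^'n^'n"
  assumes [measurable]: "A \<in> borel_measurable M" "G \<in> borel_measurable M" "w \<in> borel_measurable M"
    and F: "upd = BFGS \<Longrightarrow> F \<in> borel_measurable M"
  shows "(\<lambda>x. qn_update upd (A x) (G x) (F x) (w x)) \<in> borel_measurable M"
    and "(\<lambda>x. score upd \<mu> (A x) (G x) (F x)) \<in> borel_measurable M"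
  using F by (cases upd; simp del: transpose_matrix_vector)+

section \<open>Borel measurability of the gradient and the Hessian\<close>

context self_concordant_objective
begin

lemma borel_measurable_grad [measurable]: "grad f \<in> borel_measurable borel"
proof (rule borel_measurable_continuous_onI)
  show "continuous_on UNIV (grad f)"
    using twice_diff differentiable_imp_continuous_on
    by (auto simp: twice_differentiable_def differentiable_on_def)
qed

text \<open>Twice differentiability does not assert a continuous Hessian. Strong self-concordance
  bounds the change of the Hessian by a multiple of a local norm, and smoothness turns that norm and
  the Hessian into multiples of Euclidean quantities.\<close>

lemma hessian_entry_lipschitz:
  "\<bar>hessian f y $ i $ j - hessian f x $ i $ j\<bar> \<le> M * sqrt L * L * norm (y - x)"
proof -
  define E where "E = hessian f y - hessian f x"
  define m where "m = local_norm f x (y - x)"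
  have H: "posdef (hessian f z)" for z by (rule posdef_hessian)
  have HL: "h \<bullet> (hessian f z *v h) \<le> L * (h \<bullet> h)" for h z
    using loewner_leD[OF hessian_upper, of h z] by (simp add: scaleR_mult_vec)
  have m: "0 \<le> m" by (simp add: m_def local_norm_nonneg)
  have "local_norm f x (x - y) = m"
    using local_norm_scaleR[of f x "-1" "y - x"] by (simp add: m_def)
  then have "h \<bullet> (hessian f y *v h) - h \<bullet> (hessian f x *v h) \<le> M * m * (h \<bullet> (hessian f x *v h))"
    "h \<bullet> (hessian f x *v h) - h \<bullet> (hessian f y *v h) \<le> M * m * (h \<bullet> (hessian f y *v h))" for h
    using hessian_change[of h y x x] hessian_change[of h x x y] by (simp_all add: m_def algebra_simps)
  moreover have "M * m * (h \<bullet> (hessian f z *v h)) \<le> M * m * (L * (h \<bullet> h))" for h z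
    using HL M m by (intro mult_left_mono) auto
  ultimately have E: "\<bar>h \<bullet> (E *v h)\<bar> \<le> (M * m * L) * (h \<bullet> (mat 1 *v h))" for h
    unfolding E_def by (simp add: mv_simps abs_le_iff mult.assoc) (meson order_trans)
  have "transpose E = E" by (simp add: E_def mat_transpose_simps posdef_sym H)
  moreover have "0 \<le> M * m * L" using M m L by simp
  ultimately have "\<bar>E $ i $ j\<bar> \<le> M * m * L"
    using bilinear_form_le[OF _ psd_mat_1 _ E, of "axis i 1" "axis j 1"]
    by (simp add: inner_axis' matrix_vector_mult_basis[of E] column_def)
  also have "m \<le> sqrt L * norm (y - x)"
    using HL[of "y - x" x] by (simp add: m_def local_norm_def norm_eq_sqrt_inner flip: real_sqrt_mult)
  then have "M * m * L \<le> M * sqrt L * L * norm (y - x)"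
    using M L by (simp add: mult_ac)
  finally show ?thesis by (simp add: E_def)
qed

lemma borel_measurable_hessian [measurable]: "hessian f \<in> borel_measurable borel"
proof -
  have "continuous_on UNIV (\<lambda>x. hessian f x $ i $ j)" for i j
  proof (rule lipschitz_on_continuous_on[where L = "M * sqrt L * L"], rule lipschitz_onI)
    show "dist (hessian f x $ i $ j) (hessian f y $ i $ j) \<le> M * sqrt L * L * dist x y" for x y
      using hessian_entry_lipschitz[of x i j y] by (simp add: dist_norm dist_real_def)
  qed (use M L in auto)
  then have [measurable]: "(\<lambda>x. hessian f x $ i $ j) \<in> borel_measurable borel" for i j
    by (rule borel_measurable_continuous_onI)
  have "(\<lambda>x. \<chi> i j. hessian f x $ i $ j) \<in> borel_measurable borel" by measurable
  then show ?thesis by simp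
qed

lemma borel_measurable_newton_decrement [measurable]: "newton_decrement f \<in> borel_measurable borel"
  unfolding newton_decrement_def by measurable

end

section \<open>Quasi-Newton runs\<close>

text \<open>A single trajectory. Nothing is assumed about the directions \<open>w\<close>, so what
  follows from these axioms alone holds on every sample path.\<close>

locale quasi_newton_run = self_concordant_objective f M \<mu> L
  for f :: "real^'n \<Rightarrow> real" and M \<mu> L :: real +
  fixes upd :: update_rule and \<eta> c d :: real and x0 :: "real^'n"
    and x w :: "nat \<Rightarrow> real^'n" and G F :: "nat \<Rightarrow> real^'n^'n"
  assumes points: "quasi_newton_points f x0 x G"
    and G_Suc: "\<And>k. G (Suc k) = qn_update upd (hessian f (x (Suc k))) (corrected_G f M x G k)
        (corrected_L f M x F k) (w k)"
    and F_0: "upd = BFGS \<Longrightarrow> transpose (F 0) ** F 0 = matrix_inv (G 0)"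
    and F_Suc: "\<And>k. upd = BFGS \<Longrightarrow> F (Suc k) = bfgs_factor_update (corrected_L f M x F k)
        (hessian f (x (Suc k))) (transpose (corrected_L f M x F k) *v w k) (w k)"
    and \<eta>: "1 \<le> \<eta>"
    and init: "hessian f x0 \<preceq> G 0" "G 0 \<preceq> \<eta> *\<^sub>R hessian f x0"
    and c: "c = (case upd of BFGS \<Rightarrow> 1 | SR1 \<Rightarrow> L / \<mu>)"
    and d: "d = real CARD('n)" "2 \<le> d"
    and start: "M * newton_decrement f x0 \<le> ln 2 / (4 * \<eta> * (2 * c * d + 1))"
begin

lemma x_0: "x 0 = x0" and x_Suc: "x (Suc k) = x k - matrix_inv (G k) *v grad f (x k)"
  using points by (auto simp: quasi_newton_points_def)

lemma c_ge_1: "1 \<le> c"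
  using c condition_number_ge_1 by (cases upd) auto

lemma cd_ge_2: "2 \<le> c * d"
  using mult_mono[of 1 c 2 d] c_ge_1 d by simp

lemma qn_update_bounds:
  assumes "posdef A" "A \<preceq> H" "H \<preceq> t *\<^sub>R A" "1 \<le> t"
  shows "A \<preceq> qn_update upd A H K v" "qn_update upd A H K v \<preceq> t *\<^sub>R A"
  using bfgs_update_bounds[OF assms] sr1_update_bounds[OF assms(2)] loewner_le_trans[OF _ assms(3)]
  by (cases upd; simp del: transpose_matrix_vector)+

text \<open>The 20 is 4 times 5: \<open>2cd + 1 \<ge> 5\<close> because \<open>cd \<ge> 2\<close>,
  and \<open>ln 2 < 1\<close>.\<close>

lemma start_small: "M * newton_decrement f x0 \<le> 1 / (20 * \<eta>)"
proof -
  have "ln 2 / (4 * \<eta> * (2 * c * d + 1)) \<le> 1 / (4 * \<eta> * 5)"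
    using cd_ge_2 \<eta> ln_2_less_1 by (intro frac_le mult_left_mono) auto
  then show ?thesis using start by (simp add: mult_ac)
qed

lemma rate:
  shows hessian_le_G: "hessian f (x k) \<preceq> G k"
    and G_le_hessian: "G k \<preceq> (2 * \<eta>) *\<^sub>R hessian f (x k)"
    and newton_decrement_le: "newton_decrement f (x k) \<le> (1 - 1 / (2 * \<eta>)) ^ k * newton_decrement f x0"
proof -
  have "hessian f (x (Suc k)) \<preceq> G (Suc k) \<and> G (Suc k) \<preceq> t *\<^sub>R hessian f (x (Suc k))"
    if "1 \<le> t" "hessian f (x (Suc k)) \<preceq> corrected_G f M x G k"
      "corrected_G f M x G k \<preceq> t *\<^sub>R hessian f (x (Suc k))" for k t
    unfolding G_Suc using qn_update_bounds[OF posdef_hessian that(2,3,1)] by simp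
  note main = quasi_newton_linear_rate[OF points \<eta> init this start_small]
  show "hessian f (x k) \<preceq> G k" by (rule main(1))
  show "G k \<preceq> (2 * \<eta>) *\<^sub>R hessian f (x k)" by (rule main(2))
  show "newton_decrement f (x k) \<le> (1 - 1 / (2 * \<eta>)) ^ k * newton_decrement f x0" by (rule main(3))
qed

lemma newton_decrement_le_start: "newton_decrement f (x k) \<le> newton_decrement f x0"
proof -
  have "(1 - 1 / (2 * \<eta>)) ^ k \<le> 1" using \<eta> by (intro power_le_one) auto
  then have "(1 - 1 / (2 * \<eta>)) ^ k * newton_decrement f x0 \<le> 1 * newton_decrement f x0"
    by (intro mult_right_mono newton_decrement_nonneg)
  then show ?thesis using newton_decrement_le[of k] by simp
qed

lemma step_small: "M * newton_decrement f (x k) \<le> 1"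
proof -
  have "M * newton_decrement f (x k) \<le> M * newton_decrement f x0"
    using newton_decrement_le_start M by (intro mult_left_mono) auto
  also have "\<dots> \<le> 1 / (20 * \<eta>)" by (rule start_small)
  also have "\<dots> \<le> 1" using \<eta> by (simp add: divide_le_eq)
  finally show ?thesis .
qed

lemma two_\<eta>: "1 \<le> 2 * \<eta>"
  using \<eta> by simp

lemmas correction = correction_bounds[where x = x and G = G, OF hessian_le_G G_le_hessian two_\<eta> x_Suc]

text \<open>Multiplying \<open>G\<close> by \<open>t\<close> divides its inverse by \<open>t\<close>
  and hence its factor by \<open>sqrt t\<close>; the update then keeps the relation by
  \<open>bfgs_factor_update_correct\<close>.\<close>

lemma factor_correct:
  assumes BFGS: "upd = BFGS"
  shows "transpose (F k) ** F k = matrix_inv (G k)"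
    and "transpose (corrected_L f M x F k) ** corrected_L f M x F k = matrix_inv (corrected_G f M x G k)"
proof -
  have G: "posdef (G k)" for k by (rule posdef_mono[OF posdef_hessian hessian_le_G])
  have scaled: "transpose (corrected_L f M x F k) ** corrected_L f M x F k = matrix_inv (corrected_G f M x G k)"
    if F: "transpose (F k) ** F k = matrix_inv (G k)" for k
  proof -
    define t where "t = correction f M x k"
    have t: "1 \<le> t" unfolding t_def by (rule correction(1)[of k])
    have "transpose (corrected_L f M x F k) ** corrected_L f M x F k = (1 / t) *\<^sub>R matrix_inv (G k)"
      using t unfolding F[symmetric] corrected_L_def t_def[symmetric]
      by (simp add: transpose_scalar matrix_scaleR_right matrix_scaleR_left divide_inverse
          flip: real_sqrt_inverse)
    moreover have "matrix_inv (corrected_G f M x G k) = (1 / t) *\<^sub>R matrix_inv (G k)"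
      using t posdef_invertible[OF G[of k]] unfolding corrected_G_def t_def[symmetric]
      by (intro matrix_inv_unique) (simp add: matrix_scaleR_right matrix_scaleR_left matrix_inv_right)
    ultimately show ?thesis by simp
  qed
  have F: "transpose (F k) ** F k = matrix_inv (G k)" for k
  proof (induction k)
    case 0
    then show ?case using F_0 BFGS by simp
  next
    case (Suc k)
    have "posdef (corrected_G f M x G k)"
      by (rule posdef_mono[OF posdef_hessian correction(4)[of k]])
    from bfgs_factor_update_correct[OF posdef_hessian this scaled[OF Suc] refl]
    show ?case unfolding F_Suc[OF BFGS] G_Suc BFGS qn_update.simps .
  qed
  then show "transpose (F k) ** F k = matrix_inv (G k)" .
  show "transpose (corrected_L f M x F k) ** corrected_L f M x F k = matrix_inv (corrected_G f M x G k)"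
    by (rule scaled[OF F])
qed

section \<open>The potential along a run\<close>

definition step_score :: "nat \<Rightarrow> real^'n^'n" where
  "step_score k = score upd \<mu> (hessian f (x (Suc k))) (corrected_G f M x G k) (corrected_L f M x F k)"

definition potential :: "nat \<Rightarrow> real" where
  "potential k = gap upd \<mu> (hessian f (x k)) (G k) + 2 * c * d * (M * newton_decrement f (x k))"

lemma gap_G_nonneg: "0 \<le> gap upd \<mu> (hessian f (x k)) (G k)"
  by (intro gap_nonneg posdef_hessian hessian_le_G \<mu>)

lemma G_le_gap: "G k \<preceq> (1 + gap upd \<mu> (hessian f (x k)) (G k)) *\<^sub>R hessian f (x k)"
  by (intro loewner_gap posdef_hessian hessian_le_G \<mu> hessian_lower)

lemma gap_le_potential: "gap upd \<mu> (hessian f (x k)) (G k) \<le> potential k"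
  using cd_ge_2 M newton_decrement_nonneg by (simp add: potential_def)

lemma potential_nonneg: "0 \<le> potential k"
  using gap_G_nonneg gap_le_potential order_trans by blast

lemma gap_G_le: "gap upd \<mu> (hessian f (x k)) (G k) \<le> c * d * (2 * \<eta> - 1)"
  unfolding d(1) by (intro gap_le_initial[where L = L] posdef_hessian hessian_le_G G_le_hessian two_\<eta> \<mu> hessian_upper c)

text \<open>The initial gap is at most \<open>cd (\<eta> - 1)\<close>, and the missing
  \<open>cd\<close> pays for the decrement term since
  \<open>2 M \<lambda>_0 \<le> 1\<close>.\<close>

lemma potential_0: "potential 0 \<le> c * d * \<eta>"
proof -
  have "gap upd \<mu> (hessian f (x 0)) (G 0) \<le> c * d * (\<eta> - 1)"
    unfolding d(1) x_0 by (intro gap_le_initial[where L = L] posdef_hessian init \<eta> \<mu> hessian_upper c)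
  moreover have "c * d * (2 * (M * newton_decrement f x0)) \<le> c * d * 1"
  proof (intro mult_left_mono)
    have "1 / (20 * \<eta>) \<le> 1 / 2" using \<eta> by (simp add: field_simps)
    then show "2 * (M * newton_decrement f x0) \<le> 1" using start_small by simp
  qed (use cd_ge_2 in auto)
  ultimately show ?thesis by (simp add: potential_def x_0 algebra_simps)
qed

lemma newton_decrement_step:
  "newton_decrement f (x (Suc k)) \<le> potential k * newton_decrement f (x k)"
  unfolding potential_def by (intro potential_step(1) x_Suc hessian_le_G c d step_small)

lemma psd_step_score: "psd (step_score k)"
  unfolding step_score_def by (intro psd_score posdef_hessian correction(4)[of k] \<mu>)

text \<open>A crude bound that depends neither on the path nor on \<open>k\<close>; it provides the
  integrability of the scores. It uses that the correction factor is at most 2.\<close>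

lemma trace_step_score_le: "trace (step_score k) \<le> 4 * (c * d * (2 * \<eta> - 1) + 2 * c * d) + d"
proof -
  define t where "t = correction f M x k"
  have t: "1 \<le> t" "t \<le> 2"
    using correction(1,2)[of k] step_small[of k] by (auto simp: t_def)
  have "gap upd \<mu> (hessian f (x (Suc k))) (t *\<^sub>R G k)
      \<le> t\<^sup>2 * (gap upd \<mu> (hessian f (x k)) (G k) + 2 * c * real CARD('n) * (t - 1))"
    using correction(3)[of k] t
    by (intro gap_correct[where L = L] posdef_hessian hessian_le_G \<mu> L hessian_upper c) (auto simp: t_def)
  also have "\<dots> \<le> 2\<^sup>2 * (c * d * (2 * \<eta> - 1) + 2 * c * d * 1)"
    unfolding d(1)[symmetric] using t cd_ge_2 gap_G_nonneg gap_G_le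
    by (intro mult_mono power_mono add_mono mult_left_mono) (auto intro!: add_nonneg_nonneg mult_nonneg_nonneg)
  finally have "gap upd \<mu> (hessian f (x (Suc k))) (corrected_G f M x G k)
      \<le> 4 * (c * d * (2 * \<eta> - 1) + 2 * c * d)"
    by (simp add: t_def corrected_G_def)
  moreover have "trace (step_score k) \<le> gap upd \<mu> (hessian f (x (Suc k))) (corrected_G f M x G k) + d"
  proof (cases upd)
    case SR1
    then show ?thesis using d unfolding step_score_def by (simp only: trace_score_SR1)
  next
    case BFGS
    have "posdef (corrected_G f M x G k)"
      by (rule posdef_mono[OF posdef_hessian correction(4)[of k]])
    from trace_score_BFGS[OF this factor_correct(2)[OF BFGS]] show ?thesis
      unfolding step_score_def unfolding BFGS d(1) by (simp del: score.simps gap.simps)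
  qed
  ultimately show ?thesis by simp
qed

text \<open>The linear rate replaces \<lambda>_k in the exponent by its bound in terms of
  \<lambda>_0, which makes the factor the same on all paths.\<close>

lemma potential_Suc:
  assumes w: "norm (w k) = 1"
  shows "potential (Suc k) \<le> (1 - 1 / d) * exp (2 * (2 * c * d + 1) * (M * newton_decrement f x0)
      * (1 - 1 / (2 * \<eta>)) ^ k) * potential k + (trace (step_score k) / d - w k \<bullet> (step_score k *v w k))"
proof -
  define b where "b = 2 * (2 * c * d + 1)"
  have b: "0 \<le> b" using cd_ge_2 by (simp add: b_def)
  have q: "0 \<le> 1 - 1 / d" using d(2) by (simp add: divide_le_eq)
  have "gap upd \<mu> (hessian f (x (Suc k))) (G (Suc k))
      \<le> (1 - 1 / d) * gap upd \<mu> (hessian f (x (Suc k))) (corrected_G f M x G k)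
        + (trace (step_score k) / d - w k \<bullet> (step_score k *v w k))"
    unfolding G_Suc step_score_def d(1)
    by (intro gap_update posdef_hessian correction(4)[of k] \<mu> factor_correct(2) w)
  moreover have "(1 - 1 / d) * gap upd \<mu> (hessian f (x (Suc k))) (corrected_G f M x G k)
      + 2 * c * d * (M * newton_decrement f (x (Suc k)))
      \<le> (1 - 1 / d) * exp (b * (M * newton_decrement f (x k))) * potential k"
    unfolding potential_def b_def by (intro potential_step(2) x_Suc hessian_le_G c d step_small)
  moreover have "(1 - 1 / d) * exp (b * (M * newton_decrement f (x k))) * potential k
      \<le> (1 - 1 / d) * exp (b * (M * newton_decrement f x0) * (1 - 1 / (2 * \<eta>)) ^ k) * potential k"
  proof (intro mult_right_mono mult_left_mono potential_nonneg q)
    have "b * (M * newton_decrement f (x k)) \<le> b * (M * ((1 - 1 / (2 * \<eta>)) ^ k * newton_decrement f x0))"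
      using b M newton_decrement_le by (intro mult_left_mono) auto
    then show "exp (b * (M * newton_decrement f (x k)))
        \<le> exp (b * (M * newton_decrement f x0) * (1 - 1 / (2 * \<eta>)) ^ k)"
      by (simp add: mult_ac)
  qed
  ultimately show ?thesis by (simp add: potential_def b_def)
qed

text \<open>The denominator is \<open>1 / (2 * \<eta>)\<close>, so the quotient is
  \<open>4 \<eta> (2cd+1) M \<lambda>_0\<close> and the claim restates the starting
  condition.\<close>

lemma decay_budget:
  shows "0 \<le> 2 * (2 * c * d + 1) * (M * newton_decrement f x0)" (is "0 \<le> ?b")
    and "2 * (2 * c * d + 1) * (M * newton_decrement f x0) / (1 - (1 - 1 / (2 * \<eta>))) \<le> ln 2"
proof -
  show "0 \<le> ?b" using cd_ge_2 M newton_decrement_nonneg by simp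
  have "0 < 4 * \<eta> * (2 * c * d + 1)" using cd_ge_2 \<eta> by simp
  then have "4 * \<eta> * (2 * c * d + 1) * (M * newton_decrement f x0) \<le> ln 2"
    using start by (simp add: pos_le_divide_eq mult.commute)
  then show "?b / (1 - (1 - 1 / (2 * \<eta>))) \<le> ln 2" using \<eta> by (simp add: mult_ac)
qed

text \<open>Stated for an abstract sequence because it serves both the potential on a greedy path
  and its expectation in the random method.\<close>

lemma expected_decay:
  fixes e :: "nat \<Rightarrow> real"
  assumes "\<And>k. e (Suc k) \<le> (1 - 1 / d) * exp (2 * (2 * c * d + 1) * (M * newton_decrement f x0)
      * (1 - 1 / (2 * \<eta>)) ^ k) * e k" and "e 0 \<le> c * d * \<eta>"
  shows "e k \<le> 2 * c * d * \<eta> * (1 - 1 / d) ^ k"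
proof -
  have "e k \<le> 2 * (c * d * \<eta>) * (1 - 1 / d) ^ k"
  proof (rule perturbed_geometric_decay[OF assms])
    show "0 \<le> 1 - 1 / d" using d(2) by (simp add: divide_le_eq)
    show "0 \<le> c * d * \<eta>" using cd_ge_2 \<eta> by simp
    show "0 \<le> 1 - 1 / (2 * \<eta>)" "1 - 1 / (2 * \<eta>) < 1" using \<eta> by (simp_all add: divide_le_eq)
  qed (rule decay_budget)+
  then show ?thesis by (simp add: mult.assoc)
qed

lemma superlinear_rate:
  assumes "\<And>k. potential k \<le> K * q ^ k" "0 \<le> K" "0 \<le> q"
  shows "newton_decrement f (x k) \<le> K ^ k * q ^ (k * (k - 1) div 2) * newton_decrement f x0"
  using superlinear_product[of "\<lambda>k. newton_decrement f (x k)", OF newton_decrement_step assms(1)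
      newton_decrement_nonneg assms(2,3)]
  by (simp add: x_0)

lemma greedy_potential_le:
  assumes "\<And>k. trace (step_score k) / d \<le> w k \<bullet> (step_score k *v w k)" "\<And>k. norm (w k) = 1"
  shows "potential k \<le> 2 * c * d * \<eta> * (1 - 1 / d) ^ k"
proof (rule expected_decay[where e = potential, OF _ potential_0])
  fix k show "potential (Suc k) \<le> (1 - 1 / d) * exp (2 * (2 * c * d + 1) * (M * newton_decrement f x0)
      * (1 - 1 / (2 * \<eta>)) ^ k) * potential k"
    using potential_Suc[OF assms(2), of k] assms(1)[of k] by linarith
qed

text \<open>The greedy rule maximises the form of the residual; the score differs from it by the
  positive factor \<open>1 / \<mu>\<close>.\<close>

lemma sr1_greedy_score:
  assumes "upd = SR1" "sr1_greedy f M x G w"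
  shows "trace (step_score k) / d \<le> w k \<bullet> (step_score k *v w k)" "norm (w k) = 1"
proof -
  note g = trace_le_max_Basis[OF assms(2)[unfolded sr1_greedy_def, rule_format, of k]]
  show "norm (w k) = 1" by (rule g(2))
  show "trace (step_score k) / d \<le> w k \<bullet> (step_score k *v w k)"
    using divide_right_mono[OF g(1), of \<mu>] \<mu> unfolding step_score_def unfolding assms(1) score.simps
    by (simp add: trace_scaleR scaleR_mult_vec d(1) divide_inverse mult_ac)
qed

lemma bfgs_greedy_score:
  assumes "upd = BFGS" "bfgs_greedy f M x F w"
  shows "trace (step_score k) / d \<le> w k \<bullet> (step_score k *v w k)" "norm (w k) = 1"
  using trace_le_max_Basis[OF assms(2)[unfolded bfgs_greedy_def Let_def, rule_format, of k]]
  unfolding step_score_def unfolding assms(1) score.simps d(1) by simp_all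

end

section \<open>The random method\<close>

text \<open>\<open>N\<close> will be either the whole space or the past before the
  \<open>k\<close>-th draw. The index shift matters: \<open>x (Suc k)\<close> depends on
  \<open>G k\<close> but not on \<open>w k\<close>, so the score of step \<open>k\<close> is
  determined by the directions with index below \<open>k\<close>.\<close>

lemma (in self_concordant_objective) borel_measurable_run:
  fixes x w :: "nat \<Rightarrow> 'a \<Rightarrow> real^'n" and G F :: "nat \<Rightarrow> 'a \<Rightarrow> real^'n^'n"
  assumes run: "\<And>\<omega>. \<omega> \<in> space N \<Longrightarrow> quasi_newton_run f M \<mu> L upd \<eta> c d x0
      (\<lambda>k. x k \<omega>) (\<lambda>k. w k \<omega>) (\<lambda>k. G k \<omega>) (\<lambda>k. F k \<omega>)"
    and G0: "G 0 \<in> borel_measurable N" and F0: "upd = BFGS \<Longrightarrow> F 0 \<in> borel_measurable N"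
    and w: "\<And>i. i < k \<Longrightarrow> w i \<in> borel_measurable N"
  shows "x k \<in> borel_measurable N" and "x (Suc k) \<in> borel_measurable N"
    and "G k \<in> borel_measurable N"
    and "(\<lambda>\<omega>. quasi_newton_run.step_score f M \<mu> upd (\<lambda>k. x k \<omega>) (\<lambda>k. G k \<omega>) (\<lambda>k. F k \<omega>) k)
        \<in> borel_measurable N"
proof -
  have x_Suc: "x (Suc j) \<in> borel_measurable N"
    if [measurable]: "x j \<in> borel_measurable N" "G j \<in> borel_measurable N" for j
  proof -
    have "(\<lambda>\<omega>. x j \<omega> - matrix_inv (G j \<omega>) *v grad f (x j \<omega>)) \<in> borel_measurable N" by measurable
    then show ?thesis
      by (subst measurable_cong[OF quasi_newton_run.x_Suc[OF run]])
  qed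
  have corrected: "(\<lambda>\<omega>. corrected_G f M (\<lambda>k. x k \<omega>) (\<lambda>k. G k \<omega>) j) \<in> borel_measurable N"
    "upd = BFGS \<Longrightarrow> (\<lambda>\<omega>. corrected_L f M (\<lambda>k. x k \<omega>) (\<lambda>k. F k \<omega>) j) \<in> borel_measurable N"
    if x [measurable]: "x j \<in> borel_measurable N" and G [measurable]: "G j \<in> borel_measurable N"
      and F: "upd = BFGS \<Longrightarrow> F j \<in> borel_measurable N" for j
  proof -
    note x_Suc[OF x G, measurable]
    have [measurable]: "(\<lambda>\<omega>. correction f M (\<lambda>k. x k \<omega>) j) \<in> borel_measurable N"
      unfolding correction_def local_norm_def by measurable
    show "(\<lambda>\<omega>. corrected_G f M (\<lambda>k. x k \<omega>) (\<lambda>k. G k \<omega>) j) \<in> borel_measurable N"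
      unfolding corrected_G_def by measurable
    assume "upd = BFGS"
    note F[OF this, measurable]
    show "(\<lambda>\<omega>. corrected_L f M (\<lambda>k. x k \<omega>) (\<lambda>k. F k \<omega>) j) \<in> borel_measurable N"
      unfolding corrected_L_def by measurable
  qed
  have main: "x j \<in> borel_measurable N \<and> G j \<in> borel_measurable N \<and>
      (upd = BFGS \<longrightarrow> F j \<in> borel_measurable N)" if "j \<le> k" for j
    using that
  proof (induction j)
    case 0
    have "(\<lambda>\<omega>. x0) \<in> borel_measurable N" by measurable
    then have "x 0 \<in> borel_measurable N"
      by (subst measurable_cong[OF quasi_newton_run.x_0[OF run]])
    then show ?case using G0 F0 by simp
  next
    case (Suc j)
    then have x: "x j \<in> borel_measurable N" and G: "G j \<in> borel_measurable N"
      and F: "upd = BFGS \<Longrightarrow> F j \<in> borel_measurable N" by auto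
    have [measurable]: "w j \<in> borel_measurable N" using Suc.prems by (intro w) simp
    note x_Suc[OF x G, measurable]
    note corrected(1)[OF x G F, measurable]
    note cF = corrected(2)[OF x G F]
    have "(\<lambda>\<omega>. qn_update upd (hessian f (x (Suc j) \<omega>)) (corrected_G f M (\<lambda>k. x k \<omega>) (\<lambda>k. G k \<omega>) j)
        (corrected_L f M (\<lambda>k. x k \<omega>) (\<lambda>k. F k \<omega>) j) (w j \<omega>)) \<in> borel_measurable N"
      by (rule borel_measurable_qn_update(1)[OF _ _ _ cF]) measurable
    then have "G (Suc j) \<in> borel_measurable N"
      by (subst measurable_cong[OF quasi_newton_run.G_Suc[OF run]])
    moreover have "F (Suc j) \<in> borel_measurable N" if BFGS: "upd = BFGS"
    proof -
      have [measurable]: "(\<lambda>\<omega>. corrected_L f M (\<lambda>k. x k \<omega>) (\<lambda>k. F k \<omega>) j) \<in> borel_measurable N"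
        by (intro corrected(2) x G F BFGS)
      have "(\<lambda>\<omega>. bfgs_factor_update (corrected_L f M (\<lambda>k. x k \<omega>) (\<lambda>k. F k \<omega>) j) (hessian f (x (Suc j) \<omega>))
          (transpose (corrected_L f M (\<lambda>k. x k \<omega>) (\<lambda>k. F k \<omega>) j) *v w j \<omega>) (w j \<omega>)) \<in> borel_measurable N"
        by measurable
      then show ?thesis
        by (subst measurable_cong[OF quasi_newton_run.F_Suc[OF run BFGS]])
    qed
    ultimately show ?case using x_Suc[OF x G] by simp
  qed
  then have x: "x k \<in> borel_measurable N" and G: "G k \<in> borel_measurable N"
    and F: "upd = BFGS \<Longrightarrow> F k \<in> borel_measurable N" by auto
  show "x k \<in> borel_measurable N" "G k \<in> borel_measurable N" by (fact x, fact G)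
  show xS [measurable]: "x (Suc k) \<in> borel_measurable N" by (rule x_Suc[OF x G])
  note corrected(1)[OF x G F, measurable]
  have "(\<lambda>\<omega>. score upd \<mu> (hessian f (x (Suc k) \<omega>)) (corrected_G f M (\<lambda>k. x k \<omega>) (\<lambda>k. G k \<omega>) k)
        (corrected_L f M (\<lambda>k. x k \<omega>) (\<lambda>k. F k \<omega>) k)) \<in> borel_measurable N"
    by (rule borel_measurable_qn_update(2)[OF _ _ x corrected(2)[OF x G F]]) measurable
  then show "(\<lambda>\<omega>. quasi_newton_run.step_score f M \<mu> upd (\<lambda>k. x k \<omega>) (\<lambda>k. G k \<omega>) (\<lambda>k. F k \<omega>) k)
        \<in> borel_measurable N"
    by (subst measurable_cong[OF quasi_newton_run.step_score_def[OF run]])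
qed

text \<open>The past is kept abstract because the initial data differ: \<open>G 0\<close> for SR1,
  the pair of \<open>G 0\<close> and \<open>F 0\<close> for BFGS.\<close>

locale random_quasi_newton = prob_space P + self_concordant_objective f M \<mu> L
  for P :: "'w measure" and f :: "real^'n \<Rightarrow> real" and M \<mu> L :: real +
  fixes upd :: update_rule and \<eta> c d :: real and x0 :: "real^'n"
    and x w :: "nat \<Rightarrow> 'w \<Rightarrow> real^'n" and G F :: "nat \<Rightarrow> 'w \<Rightarrow> real^'n^'n"
    and past :: "nat \<Rightarrow> 'w measure"
  assumes run: "\<And>\<omega>. \<omega> \<in> space P \<Longrightarrow> quasi_newton_run f M \<mu> L upd \<eta> c d x0
      (\<lambda>k. x k \<omega>) (\<lambda>k. w k \<omega>) (\<lambda>k. G k \<omega>) (\<lambda>k. F k \<omega>)"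
    and w_measurable: "\<And>k. w k \<in> borel_measurable P"
    and w_unif: "\<And>k. distr P borel (w k) = unif_sphere"
    and space_past: "\<And>k. space (past k) = space P"
    and G0_past: "\<And>k. G 0 \<in> borel_measurable (past k)"
    and F0_past: "\<And>k. upd = BFGS \<Longrightarrow> F 0 \<in> borel_measurable (past k)"
    and w_past: "\<And>i k. i < k \<Longrightarrow> w i \<in> borel_measurable (past k)"
    and indep_past: "\<And>k. indep_set (sets (past k)) (sets (vimage_algebra (space P) (w k) borel))"
begin

abbreviation \<theta> :: "nat \<Rightarrow> 'w \<Rightarrow> real" where
  "\<theta> k \<omega> \<equiv> quasi_newton_run.potential f M \<mu> upd c d (\<lambda>k. x k \<omega>) (\<lambda>k. G k \<omega>) k"

abbreviation S :: "nat \<Rightarrow> 'w \<Rightarrow> real^'n^'n" where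
  "S k \<omega> \<equiv> quasi_newton_run.step_score f M \<mu> upd (\<lambda>k. x k \<omega>) (\<lambda>k. G k \<omega>) (\<lambda>k. F k \<omega>) k"

abbreviation D :: "nat \<Rightarrow> 'w \<Rightarrow> real" where
  "D k \<omega> \<equiv> gap upd \<mu> (hessian f (x k \<omega>)) (G k \<omega>)"

lemma some_run: obtains \<omega> where "\<omega> \<in> space P"
  using not_empty by blast

lemma sets_past: "sets (past k) \<subseteq> events"
  by (rule indep_setD_ev1[OF indep_past])

lemma past_measurable: "g \<in> measurable (past k) N \<Longrightarrow> g \<in> measurable P N"
  using sets_past[of k] space_past[of k] by (auto simp: measurable_def)

lemma x_measurable [measurable]: "x k \<in> borel_measurable P"
  and G_measurable [measurable]: "G k \<in> borel_measurable P"
  using borel_measurable_run(1,3)[OF run past_measurable[OF G0_past] past_measurable[OF F0_past] w_measurable]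
  by auto

lemma D_measurable [measurable]: "D k \<in> borel_measurable P"
  by measurable

lemma \<theta>_eq: "\<omega> \<in> space P \<Longrightarrow> \<theta> k \<omega> = D k \<omega> + 2 * c * d * (M * newton_decrement f (x k \<omega>))"
  by (rule quasi_newton_run.potential_def[OF run])

lemma \<theta>_measurable [measurable]: "\<theta> k \<in> borel_measurable P"
proof -
  have "(\<lambda>\<omega>. D k \<omega> + 2 * c * d * (M * newton_decrement f (x k \<omega>))) \<in> borel_measurable P" by measurable
  then show ?thesis by (subst measurable_cong[OF \<theta>_eq])
qed

lemma D_bounds:
  assumes "\<omega> \<in> space P"
  shows "0 \<le> D k \<omega>" "D k \<omega> \<le> \<theta> k \<omega>" "0 \<le> \<theta> k \<omega>" "\<theta> k \<omega> \<le> c * d * (2 * \<eta> + 1)"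
proof -
  interpret quasi_newton_run f M \<mu> L upd \<eta> c d x0 "\<lambda>k. x k \<omega>" "\<lambda>k. w k \<omega>" "\<lambda>k. G k \<omega>" "\<lambda>k. F k \<omega>"
    by (rule run[OF assms])
  show "0 \<le> D k \<omega>" by (rule gap_G_nonneg)
  show "D k \<omega> \<le> \<theta> k \<omega>" by (rule gap_le_potential)
  show "0 \<le> \<theta> k \<omega>" by (rule potential_nonneg)
  have "2 * c * d * (M * newton_decrement f (x k \<omega>)) \<le> 2 * c * d * 1"
    using cd_ge_2 step_small[of k] by (intro mult_left_mono) auto
  then show "\<theta> k \<omega> \<le> c * d * (2 * \<eta> + 1)"
    using gap_G_le[of k] by (simp add: potential_def algebra_simps)
qed

lemma integrable_\<theta>: "integrable P (\<theta> k)" and integrable_D: "integrable P (D k)"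
proof -
  show "integrable P (\<theta> k)"
    using D_bounds[of _ k]
    by (intro integrable_const_bound[where B = "c * d * (2 * \<eta> + 1)"] AE_I2) auto
  show "integrable P (D k)"
    using D_bounds[of _ k]
    by (intro integrable_const_bound[where B = "c * d * (2 * \<eta> + 1)"] AE_I2) (force intro: order_trans)+
qed

lemma norm_w: "AE \<omega> in P. norm (w k \<omega>) = 1"
proof -
  have "AE u in distr P borel (w k). u \<in> sphere 0 1"
    unfolding w_unif by (rule AE_unif_sphere)
  then have "AE \<omega> in P. w k \<omega> \<in> sphere 0 1"
    using w_measurable[of k] by (subst (asm) AE_distr_iff) auto
  then show ?thesis by simp
qed

text \<open>By \<open>expectation_quadratic_form\<close> the shortfall in
  \<open>potential_Suc\<close> has mean zero, and the path-independent factor \<open>a\<close>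
  leaves the expectation.\<close>

lemma expectation_\<theta>_Suc:
  "expectation (\<theta> (Suc k)) \<le> (1 - 1 / d) * exp (2 * (2 * c * d + 1) * (M * newton_decrement f x0)
      * (1 - 1 / (2 * \<eta>)) ^ k) * expectation (\<theta> k)"
proof -
  define a where "a = (1 - 1 / d) * exp (2 * (2 * c * d + 1) * (M * newton_decrement f x0)
      * (1 - 1 / (2 * \<eta>)) ^ k)"
  obtain \<omega>0 where "\<omega>0 \<in> space P" by (rule some_run)
  then have d: "d = real CARD('n)" by (rule quasi_newton_run.d(1)[OF run])
  have run': "\<And>\<omega>. \<omega> \<in> space (past k) \<Longrightarrow> quasi_newton_run f M \<mu> L upd \<eta> c d x0
      (\<lambda>k. x k \<omega>) (\<lambda>k. w k \<omega>) (\<lambda>k. G k \<omega>) (\<lambda>k. F k \<omega>)"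
    using run space_past by simp
  have S: "S k \<in> borel_measurable (past k)"
    by (rule borel_measurable_run(4)[OF run' G0_past F0_past w_past])
  note q = expectation_quadratic_form[OF space_past S indep_past w_measurable w_unif
      quasi_newton_run.psd_step_score[OF run] quasi_newton_run.trace_step_score_le[OF run]]
  have "expectation (\<theta> (Suc k))
      \<le> expectation (\<lambda>\<omega>. a * \<theta> k \<omega> + (trace (S k \<omega>) / d - w k \<omega> \<bullet> (S k \<omega> *v w k \<omega>)))"
  proof (rule integral_mono_AE)
    show "integrable P (\<lambda>\<omega>. a * \<theta> k \<omega> + (trace (S k \<omega>) / d - w k \<omega> \<bullet> (S k \<omega> *v w k \<omega>)))"
      using integrable_\<theta> q(1,2)
      by (intro Bochner_Integration.integrable_add Bochner_Integration.integrable_diff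
          integrable_mult_right integrable_divide) auto
    \<comment> \<open>The recursion needs a direction of norm 1, which a sphere-distributed variable
      has only almost everywhere.\<close>
    show "AE \<omega> in P. \<theta> (Suc k) \<omega> \<le> a * \<theta> k \<omega> + (trace (S k \<omega>) / d - w k \<omega> \<bullet> (S k \<omega> *v w k \<omega>))"
      using norm_w[of k] AE_space
    proof eventually_elim
      case (elim \<omega>)
      show ?case unfolding a_def by (rule quasi_newton_run.potential_Suc[OF run[OF elim(2)] elim(1)])
    qed
  qed (rule integrable_\<theta>)
  also have "\<dots> = a * expectation (\<theta> k)"
    using integrable_\<theta>[of k] q d by simp
  finally show ?thesis unfolding a_def .
qed

lemma expectation_\<theta>_le: "expectation (\<theta> k) \<le> 2 * c * d * \<eta> * (1 - 1 / d) ^ k"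
proof -
  obtain \<omega>0 where \<omega>0: "\<omega>0 \<in> space P" by (rule some_run)
  have "expectation (\<theta> 0) \<le> expectation (\<lambda>\<omega>. c * d * \<eta>)"
    using quasi_newton_run.potential_0[OF run]
    by (intro integral_mono integrable_\<theta>) auto
  then have "expectation (\<theta> 0) \<le> c * d * \<eta>" by (simp add: prob_space)
  from quasi_newton_run.expected_decay[OF run[OF \<omega>0], of "\<lambda>k. expectation (\<theta> k)", OF expectation_\<theta>_Suc this]
  show ?thesis .
qed

lemma expectation_D_le: "expectation (D k) \<le> 2 * c * d * \<eta> * (1 - 1 / d) ^ k"
proof -
  have "expectation (D k) \<le> expectation (\<theta> k)"
    by (intro integral_mono integrable_\<theta> integrable_D D_bounds)
  then show ?thesis using expectation_\<theta>_le[of k] by simp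
qed

text \<open>Markov's inequality at the level \<open>4cd\<^sup>3\<eta>/\<delta> (1 - 1/(d+1))\<^sup>k\<close> leaves probabilities
  \<open>\<delta>/(2d\<^sup>2) (1 - 1/d\<^sup>2)\<^sup>k\<close>, because \<open>(1 - 1/d) / (1 - 1/(d+1)) = 1 - 1/d\<^sup>2\<close>; they sum to \<open>\<delta>/2\<close>.\<close>

lemma potential_tail:
  assumes \<delta>: "0 < \<delta>"
  shows "prob {\<omega> \<in> space P. \<forall>k. \<theta> k \<omega> \<le> 4 * c * d ^ 3 * \<eta> / \<delta> * (1 - 1 / (d + 1)) ^ k} \<ge> 1 - \<delta>"
proof -
  obtain \<omega>0 where \<omega>0: "\<omega>0 \<in> space P" by (rule some_run)
  interpret r: quasi_newton_run f M \<mu> L upd \<eta> c d x0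
    "\<lambda>k. x k \<omega>0" "\<lambda>k. w k \<omega>0" "\<lambda>k. G k \<omega>0" "\<lambda>k. F k \<omega>0"
    by (rule run[OF \<omega>0])
  have d: "2 \<le> d" by (rule r.d(2))
  have c: "0 < c" "0 < \<eta>" using r.c_ge_1 r.\<eta> by auto
  define t where "t = (\<lambda>k. 4 * c * d ^ 3 * \<eta> / \<delta> * (1 - 1 / (d + 1)) ^ k)"
  have q: "1 - 1 / (d + 1) = d / (d + 1)" using d by (simp add: field_simps)
  have t: "0 < t k" for k unfolding t_def q using d c \<delta> by simp
  define A where "A = (\<lambda>k. {\<omega> \<in> space P. t k \<le> \<theta> k \<omega>})"
  define \<rho> where "\<rho> = 1 - 1 / d\<^sup>2"
  have d2: "4 \<le> d\<^sup>2" using d power_mono[of 2 d 2] by simp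
  have "0 < 1 / d\<^sup>2" "1 / d\<^sup>2 \<le> 1" using d2 d by (auto simp: divide_le_eq)
  then have \<rho>: "norm \<rho> < 1" by (simp add: \<rho>_def)
  have A: "prob (A k) \<le> \<delta> / (2 * d\<^sup>2) * \<rho> ^ k" for k
  proof -
    have "prob (A k) \<le> expectation (\<theta> k) / t k"
      unfolding A_def using D_bounds t
      by (intro integral_Markov_inequality_measure[where A = "space P"] integrable_\<theta> AE_I2) auto
    also have "\<dots> \<le> 2 * c * d * \<eta> * (1 - 1 / d) ^ k / t k"
      using t by (intro divide_right_mono expectation_\<theta>_le) (simp add: less_imp_le)
    also have "\<dots> = (2 * c * d * \<eta> / (4 * c * d ^ 3 * \<eta> / \<delta>)) * ((1 - 1 / d) / (1 - 1 / (d + 1))) ^ k"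
      by (simp add: t_def power_divide)
    also have "2 * c * d * \<eta> / (4 * c * d ^ 3 * \<eta> / \<delta>) = \<delta> / (2 * d\<^sup>2)"
      using c d \<delta> by (simp add: field_simps power2_eq_square power3_eq_cube)
    also have "(1 - 1 / d) / (1 - 1 / (d + 1)) = \<rho>"
      unfolding q \<rho>_def using d by (simp add: field_simps power2_eq_square)
    finally show ?thesis .
  qed
  have sums: "(\<lambda>k. \<delta> / (2 * d\<^sup>2) * \<rho> ^ k) sums (\<delta> / (2 * d\<^sup>2) * (1 / (1 - \<rho>)))"
    by (intro sums_mult geometric_sums \<rho>)
  have summ: "summable (\<lambda>k. prob (A k))"
    using A by (intro summable_comparison_test'[OF sums_summable[OF sums]]) simp
  have ev: "A k \<in> events" for k unfolding A_def by measurable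
  have "prob (\<Union>k. A k) \<le> (\<Sum>k. prob (A k))"
    using ev by (intro finite_measure_subadditive_countably summ) auto
  also have "\<dots> \<le> (\<Sum>k. \<delta> / (2 * d\<^sup>2) * \<rho> ^ k)"
    by (intro suminf_le A summ sums_summable[OF sums])
  also have "\<dots> = \<delta> / (2 * d\<^sup>2) * (1 / (1 - \<rho>))" by (rule sums_unique[OF sums, symmetric])
  also have "\<dots> = \<delta> / 2" using d by (simp add: \<rho>_def)
  finally have "1 - \<delta> \<le> 1 - prob (\<Union>k. A k)" using \<delta> by simp
  also have "\<dots> = prob (space P - (\<Union>k. A k))" using ev by (intro prob_compl[symmetric]) auto
  also have "\<dots> \<le> prob {\<omega> \<in> space P. \<forall>k. \<theta> k \<omega> \<le> t k}"
    by (intro finite_measure_mono) (auto simp: A_def not_le less_imp_le)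
  finally show ?thesis unfolding t_def .
qed

end

lemma (in prob_space) random_directions_past:
  fixes init :: "'a \<Rightarrow> 'b::topological_space" and w :: "nat \<Rightarrow> 'a \<Rightarrow> real^'n"
  assumes "random_directions M init w"
  defines "past \<equiv> \<lambda>k. vimage_algebra (space M) (\<lambda>\<omega>. (init \<omega>, \<lambda>i\<in>{..<k}. w i \<omega>))
      (borel \<Otimes>\<^sub>M Pi\<^sub>M {..<k} (\<lambda>_. borel))"
  shows "init \<in> borel_measurable (past k)"
    and "i < k \<Longrightarrow> w i \<in> borel_measurable (past k)"
proof -
  let ?\<Phi> = "\<lambda>\<omega>. (init \<omega>, \<lambda>i\<in>{..<k}. w i \<omega>)"
  have \<Phi>: "?\<Phi> \<in> past k \<rightarrow>\<^sub>M borel \<Otimes>\<^sub>M Pi\<^sub>M {..<k} (\<lambda>_. borel)"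
    unfolding past_def by (rule measurable_vimage_algebra1) (auto simp: space_pair_measure space_PiM)
  from measurable_compose[OF \<Phi> measurable_fst] show "init \<in> borel_measurable (past k)" by simp
  assume i: "i < k"
  then have "(\<lambda>g. g i) \<in> Pi\<^sub>M {..<k} (\<lambda>_. borel) \<rightarrow>\<^sub>M (borel :: (real^'n) measure)"
    by (intro measurable_component_singleton) auto
  from measurable_compose[OF measurable_compose[OF \<Phi> measurable_snd] this] i
  show "w i \<in> borel_measurable (past k)" by simp
qed

theorem theorem19:
  fixes f :: "real^'n \<Rightarrow> real"
    and M \<mu> L \<eta> c d :: real
    and P :: "'w measure"
    and upd :: update_rule
    and dir :: direction_rule
    and x0 :: "real^'n"
    and x w :: "nat \<Rightarrow> 'w \<Rightarrow> real^'n"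
    and G F :: "nat \<Rightarrow> 'w \<Rightarrow> real^'n^'n"
  assumes "prob_space P"
    and "d = real CARD('n)" and "CARD('n) \<ge> 2"
    and "M > 0" and "\<mu> > 0" and "L > 0" and "\<eta> \<ge> 1"
    and "twice_differentiable f"
    and "strongly_self_concordant M f"
    and "strongly_convex \<mu> f"
    and "smooth L f"
    and "quasi_newton_method P upd dir f M x0 x G F w"
    and "G 0 \<in> borel_measurable P"
    and "\<And>\<omega>. \<omega> \<in> space P \<Longrightarrow> hessian f x0 \<preceq> G 0 \<omega> \<and> G 0 \<omega> \<preceq> \<eta> *\<^sub>R hessian f x0"
    and "c = (case upd of BFGS \<Rightarrow> 1 | SR1 \<Rightarrow> L / \<mu>)"
    and "M * newton_decrement f x0 \<le> ln 2 / (4 * \<eta> * (2 * c * d + 1))"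
  shows "\<exists>\<Delta> :: nat \<Rightarrow> 'w \<Rightarrow> real.
    (\<forall>k. \<Delta> k \<in> borel_measurable P \<and>
         (\<forall>\<omega>\<in>space P. 0 \<le> \<Delta> k \<omega> \<and>
            hessian f (x k \<omega>) \<preceq> G k \<omega> \<and> G k \<omega> \<preceq> (1 + \<Delta> k \<omega>) *\<^sub>R hessian f (x k \<omega>)) \<and>
         integrable P (\<Delta> k) \<and>
         (\<integral>\<omega>. \<Delta> k \<omega> \<partial>P) \<le> 2 * c * d * \<eta> * (1 - 1 / d) ^ k) \<and>
    (dir = Greedy \<longrightarrow>
       (\<forall>\<omega>\<in>space P. \<forall>k.
          \<Delta> k \<omega> \<le> 2 * c * d * \<eta> * (1 - 1 / d) ^ k \<and>
          newton_decrement f (x k \<omega>)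
            \<le> (2 * c * d * \<eta>) ^ k * (1 - 1 / d) ^ (k * (k - 1) div 2) * newton_decrement f x0)) \<and>
    (dir = Random \<longrightarrow>
       (\<forall>\<delta>. 0 < \<delta> \<and> \<delta> < 1 \<longrightarrow>
          measure P {\<omega> \<in> space P. \<forall>k.
            \<Delta> k \<omega> \<le> 4 * c * d ^ 3 * \<eta> / \<delta> * (1 - 1 / (d + 1)) ^ k \<and>
            newton_decrement f (x k \<omega>)
              \<le> (4 * c * d ^ 3 * \<eta> / \<delta>) ^ k * (1 - 1 / (d + 1)) ^ (k * (k - 1) div 2)
                 * newton_decrement f x0}
          \<ge> 1 - \<delta>))"
proof -
  interpret prob_space P by fact
  interpret self_concordant_objective f M \<mu> L by unfold_locales fact+
  have d: "d = real CARD('n)" "2 \<le> d" using assms(2,3) by auto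
  have rd: "sr1_run f M x0 (\<lambda>k. x k \<omega>) (\<lambda>k. G k \<omega>) (\<lambda>k. w k \<omega>)" if "upd = SR1" "\<omega> \<in> space P" for \<omega>
    using assms(12) that by (cases dir) auto
  have bd: "bfgs_run f M x0 (\<lambda>k. x k \<omega>) (\<lambda>k. G k \<omega>) (\<lambda>k. F k \<omega>) (\<lambda>k. w k \<omega>)" if "upd = BFGS" "\<omega> \<in> space P" for \<omega>
    using assms(12) that by (cases dir) auto
  have run: "quasi_newton_run f M \<mu> L upd \<eta> c d x0 (\<lambda>k. x k \<omega>) (\<lambda>k. w k \<omega>) (\<lambda>k. G k \<omega>) (\<lambda>k. F k \<omega>)"
    if \<omega>: "\<omega> \<in> space P" for \<omega>
  proof unfold_locales
    show "quasi_newton_points f x0 (\<lambda>k. x k \<omega>) (\<lambda>k. G k \<omega>)"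
      using rd[OF _ \<omega>] bd[OF _ \<omega>] by (cases upd) (auto simp: sr1_run_def bfgs_run_def)
    show "G (Suc k) \<omega> = qn_update upd (hessian f (x (Suc k) \<omega>)) (corrected_G f M (\<lambda>k. x k \<omega>) (\<lambda>k. G k \<omega>) k)
        (corrected_L f M (\<lambda>k. x k \<omega>) (\<lambda>k. F k \<omega>) k) (w k \<omega>)" for k
      using rd[OF _ \<omega>] bd[OF _ \<omega>] by (cases upd) (auto simp: sr1_run_def bfgs_run_def Let_def)
    show "transpose (F 0 \<omega>) ** F 0 \<omega> = matrix_inv (G 0 \<omega>)" if "upd = BFGS"
      using bd[OF that \<omega>] by (simp add: bfgs_run_def)
    show "F (Suc k) \<omega> = bfgs_factor_update (corrected_L f M (\<lambda>k. x k \<omega>) (\<lambda>k. F k \<omega>) k)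
        (hessian f (x (Suc k) \<omega>)) (transpose (corrected_L f M (\<lambda>k. x k \<omega>) (\<lambda>k. F k \<omega>) k) *v w k \<omega>) (w k \<omega>)"
      if "upd = BFGS" for k
      using bd[OF that \<omega>] by (simp add: bfgs_run_def Let_def)
    show "hessian f x0 \<preceq> G 0 \<omega>" "G 0 \<omega> \<preceq> \<eta> *\<^sub>R hessian f x0" using assms(14)[OF \<omega>] by auto
  qed (fact assms d)+
  obtain \<omega>0 where \<omega>0: "\<omega>0 \<in> space P" using not_empty by blast
  have cd: "2 \<le> c * d" by (rule quasi_newton_run.cd_ge_2[OF run[OF \<omega>0]])
  show ?thesis
  proof (cases dir)
    case Greedy
    have "trace (quasi_newton_run.step_score f M \<mu> upd (\<lambda>k. x k \<omega>) (\<lambda>k. G k \<omega>) (\<lambda>k. F k \<omega>) k) / d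
        \<le> w k \<omega> \<bullet> (quasi_newton_run.step_score f M \<mu> upd (\<lambda>k. x k \<omega>) (\<lambda>k. G k \<omega>) (\<lambda>k. F k \<omega>) k *v w k \<omega>)
      \<and> norm (w k \<omega>) = 1" if \<omega>: "\<omega> \<in> space P" for \<omega> k
    proof (cases upd)
      case SR1
      then have "sr1_greedy f M (\<lambda>k. x k \<omega>) (\<lambda>k. G k \<omega>) (\<lambda>k. w k \<omega>)"
        using assms(12) Greedy \<omega> by simp
      from quasi_newton_run.sr1_greedy_score[OF run[OF \<omega>] SR1 this] show ?thesis by blast
    next
      case BFGS
      then have "bfgs_greedy f M (\<lambda>k. x k \<omega>) (\<lambda>k. F k \<omega>) (\<lambda>k. w k \<omega>)"
        using assms(12) Greedy \<omega> by simp
      from quasi_newton_run.bfgs_greedy_score[OF run[OF \<omega>] BFGS this] show ?thesis by blast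
    qed
    then have pot: "quasi_newton_run.potential f M \<mu> upd c d (\<lambda>k. x k \<omega>) (\<lambda>k. G k \<omega>) k
        \<le> 2 * c * d * \<eta> * (1 - 1 / d) ^ k" if \<omega>: "\<omega> \<in> space P" for \<omega> k
      using quasi_newton_run.greedy_potential_le[OF run[OF \<omega>]] \<omega> by blast
    \<comment> \<open>The witness is this constant sequence instead of the gap: with ties broken
      non-measurably the gap need not be a random variable.\<close>
    define B where "B = (\<lambda>k. 2 * c * d * \<eta> * (1 - 1 / d) ^ k)"
    have q: "0 \<le> 1 - 1 / d" "0 \<le> 2 * c * d * \<eta>" using d(2) cd assms(7) by (simp_all add: divide_le_eq)
    have B: "0 \<le> B k" for k unfolding B_def using q by simp
    have "hessian f (x k \<omega>) \<preceq> G k \<omega> \<and> G k \<omega> \<preceq> (1 + B k) *\<^sub>R hessian f (x k \<omega>) \<and>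
        newton_decrement f (x k \<omega>)
            \<le> (2 * c * d * \<eta>) ^ k * (1 - 1 / d) ^ (k * (k - 1) div 2) * newton_decrement f x0"
      if \<omega>: "\<omega> \<in> space P" for \<omega> k
    proof -
      interpret r: quasi_newton_run f M \<mu> L upd \<eta> c d x0
        "\<lambda>k. x k \<omega>" "\<lambda>k. w k \<omega>" "\<lambda>k. G k \<omega>" "\<lambda>k. F k \<omega>"
        by (rule run[OF \<omega>])
      have "gap upd \<mu> (hessian f (x k \<omega>)) (G k \<omega>) \<le> B k"
        using r.gap_le_potential[of k] pot[OF \<omega>, of k] by (simp add: B_def)
      then have "(1 + gap upd \<mu> (hessian f (x k \<omega>)) (G k \<omega>)) *\<^sub>R hessian f (x k \<omega>)
          \<preceq> (1 + B k) *\<^sub>R hessian f (x k \<omega>)"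
        by (intro loewner_scaleR_left_mono posdef_hessian) simp
      with r.G_le_gap[of k] r.hessian_le_G[of k] r.superlinear_rate[OF pot[OF \<omega>] q(2,1), of k]
      show ?thesis using loewner_le_trans by blast
    qed
    then show ?thesis
      using Greedy B by (intro exI[of _ "\<lambda>k \<omega>. B k"]) (auto simp: prob_space B_def)
  next
    case Random
    define past where "past = (\<lambda>k. case upd of
        SR1 \<Rightarrow> vimage_algebra (space P) (\<lambda>\<omega>. (G 0 \<omega>, \<lambda>i\<in>{..<k}. w i \<omega>)) (borel \<Otimes>\<^sub>M Pi\<^sub>M {..<k} (\<lambda>_. borel))
      | BFGS \<Rightarrow> vimage_algebra (space P) (\<lambda>\<omega>. ((G 0 \<omega>, F 0 \<omega>), \<lambda>i\<in>{..<k}. w i \<omega>))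
          (borel \<Otimes>\<^sub>M Pi\<^sub>M {..<k} (\<lambda>_. borel)))"
    have rs: "random_directions P (G 0) w" if "upd = SR1" using assms(12) Random that by simp
    have rb: "random_directions P (\<lambda>\<omega>. (G 0 \<omega>, F 0 \<omega>)) w" if "upd = BFGS" using assms(12) Random that by simp
    have pair: "(\<lambda>\<omega>. (G 0 \<omega>, F 0 \<omega>)) \<in> borel_measurable (past k)" if "upd = BFGS" for k
      using random_directions_past(1)[OF rb[OF that]] that by (simp add: past_def)
    \<comment> \<open>The past makes the pair measurable for the Borel sets of the product type;
      continuous projections recover its components.\<close>
    have proj: "fst \<in> borel_measurable borel" "snd \<in> borel_measurable borel"
      for proj :: "(real^'n^'n) \<times> (real^'n^'n) \<Rightarrow> real^'n^'n"
      by (intro borel_measurable_continuous_onI continuous_intros)+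
    interpret random_quasi_newton P f M \<mu> L upd \<eta> c d x0 x w G F past
    proof (intro random_quasi_newton.intro random_quasi_newton_axioms.intro)
      fix k
      show "w k \<in> borel_measurable P" "distr P borel (w k) = unif_sphere"
        using rs rb by (cases upd; simp add: random_directions_def)+
      show "space (past k) = space P" by (cases upd) (simp_all add: past_def)
      show "indep_set (sets (past k)) (sets (vimage_algebra (space P) (w k) borel))"
        using rs rb by (cases upd) (simp_all add: past_def random_directions_def)
      show "w i \<in> borel_measurable (past k)" if "i < k" for i
        using random_directions_past(2)[OF rs that] random_directions_past(2)[OF rb that]
        by (cases upd) (simp_all add: past_def)
      show "F 0 \<in> borel_measurable (past k)" if "upd = BFGS"
        using measurable_compose[OF pair[OF that] proj(2)] by simp
      show "G 0 \<in> borel_measurable (past k)"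
      proof (cases upd)
        case SR1
        then show ?thesis using random_directions_past(1)[OF rs] by (simp add: past_def)
      next
        case BFGS
        then show ?thesis using measurable_compose[OF pair[OF BFGS] proj(1)] by simp
      qed
    qed (fact run prob_space_axioms self_concordant_objective_axioms)+
    have main: "1 - \<delta> \<le> prob {\<omega> \<in> space P. \<forall>k.
            D k \<omega> \<le> 4 * c * d ^ 3 * \<eta> / \<delta> * (1 - 1 / (d + 1)) ^ k \<and>
            newton_decrement f (x k \<omega>)
              \<le> (4 * c * d ^ 3 * \<eta> / \<delta>) ^ k * (1 - 1 / (d + 1)) ^ (k * (k - 1) div 2)
                 * newton_decrement f x0}" (is "_ \<le> prob ?E") if \<delta>: "0 < \<delta>" for \<delta>
    proof -
      have K: "0 \<le> 4 * c * d ^ 3 * \<eta> / \<delta>" "0 \<le> 1 - 1 / (d + 1)"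
        using cd d assms(7) \<delta> quasi_newton_run.c_ge_1[OF run[OF \<omega>0]] by (auto simp: divide_le_eq)
      \<comment> \<open>One event suffices for both claims: the potential dominates the gap, and its
        bounds for all \<open>k\<close> yield the superlinear rate.\<close>
      have "1 - \<delta> \<le> prob {\<omega> \<in> space P. \<forall>k. \<theta> k \<omega> \<le> 4 * c * d ^ 3 * \<eta> / \<delta> * (1 - 1 / (d + 1)) ^ k}"
        by (rule potential_tail[OF \<delta>])
      also have "\<dots> \<le> prob ?E"
      proof (rule finite_measure_mono)
        show "?E \<in> events" by measurable
        show "{\<omega> \<in> space P. \<forall>k. \<theta> k \<omega> \<le> 4 * c * d ^ 3 * \<eta> / \<delta> * (1 - 1 / (d + 1)) ^ k} \<subseteq> ?E"
          using quasi_newton_run.superlinear_rate[OF run _ K] order_trans[OF D_bounds(2)] by blast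
      qed
      finally show ?thesis .
    qed
    show ?thesis
      \<comment> \<open>The witness is the gap \<open>D\<close>, which is measurable here because
        the directions are.\<close>
      using Random main D_bounds(1) integrable_D expectation_D_le
        quasi_newton_run.hessian_le_G[OF run] quasi_newton_run.G_le_gap[OF run]
      by (intro exI[of _ D]) auto
  qed
qed

end
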